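(* In $\overline{\mathbb{H}}^5$, among the congruent ball packings of classical balls generated by simply truncated Coxeter orthoschemes with parallel faces, i.e. by the orthoscheme with Schläfli symbol $\{4,3,4,3,3,\infty\}$ (the only one in dimension $5$), the densest is the ball configuration $\mathcal{B}_{\{4,3,4,3,3,\infty\}}$ given by the images of the inball of this orthoscheme, and its density is $\approx 0.0140$.
   Context: Simply truncated Coxeter orthoschemes with parallel faces. Let $\mathbb{R}^{n+1}$ carry the Lorentzian form $\langle x,y\rangle=-x^0y^0+x^1y^1+\dots+x^ny^n$, and use the projective model of $\mathbb{H}^n$ (curvature $-1$), with $\overline{\mathbb{H}}^n=\mathbb{H}^n\cup\partial\mathbb{H}^n$. For a symbol $\{m_1,\dots,m_n,\infty\}$ let $H^0,\dots,H^{n+1}$ be hyperplanes with outward unit normals $b^0,\dots,b^{n+1}$ satisfying $\langle b^i,b^i\rangle=1$, $\langle b^{i-1},b^i\rangle=-\cos(\pi/m_i)$ for $1\le i\le n$, $\langle b^n,b^{n+1}\rangle=-1$ (i.e. $H^n,H^{n+1}$ are parallel), and $\langle b^i,b^j\rangle=0$ for $|i-j|\ge 2$. The truncated orthoscheme $\widehat{\mathcal S}$ is the polytope bounded by $H^0,\dots,H^{n+1}$ (here $H^0,\dots,H^n$ bound an orthoscheme one of whose principal vertices is an outer point, and $H^{n+1}$ is the polar hyperplane of that vertex). $\Gamma$ is the discrete group generated by the reflections in $H^0,\dots,H^{n+1}$; the images of $\widehat{\mathcal S}$ under $\Gamma$ tile $\overline{\mathbb{H}}^n$. Here $n=5$.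 Ball packings. A congruent ball packing of classical balls generated by $\widehat{\mathcal S}$ consists of the $\Gamma$-images of a ball $\mathcal B$ (of finite radius, with center in $\mathbb{H}^n$) contained in $\widehat{\mathcal S}$; its density is $\mathrm{vol}(\mathcal B)/\mathrm{vol}(\widehat{\mathcal S})$. The inball of $\widehat{\mathcal S}$ is the ball of maximal radius contained in $\widehat{\mathcal S}$. The sign $\approx$ indicates a decimal approximation accurate to within one unit of the last displayed digit. *)

theory Defs
  imports "HOL-Analysis.Analysis"
begin

text \<open>
  The Lorentzian space of dimension \<open>n + 1\<close> is \<open>real \<times> 'a\<close> with \<open>n = DIM('a)\<close>; the first component
  is the time coordinate. In the projective model the points of hyperbolic space are the vectors
  \<open>y\<close> of the open unit ball of \<open>'a\<close>, those of its boundary are the unit vectors, and \<open>y\<close> stands for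
  the projective point with representative \<open>(1, y)\<close>.
\<close>

definition lorentz :: "real \<times> 'a::euclidean_space \<Rightarrow> real \<times> 'a \<Rightarrow> real" where
  "lorentz x y = - (fst x * fst y) + snd x \<bullet> snd y"

definition hyp_space :: "'a::euclidean_space set" where
  "hyp_space = ball 0 1"

definition closed_hyp_space :: "'a::euclidean_space set" where
  "closed_hyp_space = cball 0 1"

definition hyp_dist :: "'a::euclidean_space \<Rightarrow> 'a \<Rightarrow> real" where
  "hyp_dist x y =
     arcosh (- lorentz (1, x) (1, y) / sqrt (lorentz (1, x) (1, x) * lorentz (1, y) (1, y)))"

definition hyp_ball :: "'a::euclidean_space \<Rightarrow> real \<Rightarrow> 'a set" where
  "hyp_ball c r = {y \<in> hyp_space. hyp_dist c y \<le> r}"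

text \<open>
  The Riemannian volume for curvature \<open>-1\<close>: in the projective model its density with respect to
  Lebesgue measure is \<open>(1 - |y|\<^sup>2)\<close> to the power \<open>-(n + 1)/2\<close>.
\<close>

definition hyp_measure :: "'a::euclidean_space measure" where
  "hyp_measure = density lborel
     (\<lambda>y. ennreal ((1 - (norm y)\<^sup>2) powr (- (real DIM('a) + 1) / 2)) * indicator hyp_space y)"

text \<open>
  A family \<open>b\<close> lists the normals \<open>b 0, \<dots>, b (n + 1)\<close>; its values at larger indices are irrelevant.
\<close>

definition truncated_polytope :: "(nat \<Rightarrow> real \<times> 'a::euclidean_space) \<Rightarrow> 'a set" where
  "truncated_polytope b =
     {y \<in> closed_hyp_space. \<forall>i \<le> DIM('a) + 1. lorentz (1, y) (b i) \<le> 0}"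

text \<open>
  The vertex of the orthoscheme opposite to the \<open>k\<close>-th facet, given by a homogeneous representative;
  the principal vertices are those with \<open>k = 0\<close> and \<open>k = n\<close>.
\<close>

definition orthoscheme_vertex ::
    "(nat \<Rightarrow> real \<times> 'a::euclidean_space) \<Rightarrow> nat \<Rightarrow> real \<times> 'a \<Rightarrow> bool" where
  "orthoscheme_vertex b k p \<longleftrightarrow>
     p \<noteq> 0 \<and> (\<forall>j \<le> DIM('a). j \<noteq> k \<longrightarrow> lorentz p (b j) = 0)"

definition outer_point :: "real \<times> 'a::euclidean_space \<Rightarrow> bool" where
  "outer_point p \<longleftrightarrow> lorentz p p > 0"

text \<open>
  The list \<open>m\<close> consists of the finite entries of the symbol \<open>{m\<^sub>1, \<dots>, m\<^sub>n, \<infinity>}\<close>, so \<open>m ! i\<close> is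
  \<open>m\<^sub>i\<^sub>+\<^sub>1\<close>. The Gram conditions do not distinguish \<open>b\<close> from \<open>-b\<close>; that the normals point outwards is
  the condition that the polytope has an interior point. By the Gram conditions \<open>b (n + 1)\<close> is
  orthogonal to \<open>b 0, \<dots>, b (n - 1)\<close> and has norm 1: it represents the principal vertex opposite to
  the \<open>n\<close>-th facet, which is therefore outer, and the last hyperplane is the polar hyperplane of
  that vertex. The truncation is simple if the other principal vertex is not outer.
\<close>

definition simply_truncated_orthoscheme ::
    "nat list \<Rightarrow> (nat \<Rightarrow> real \<times> 'a::euclidean_space) \<Rightarrow> bool" where
  "simply_truncated_orthoscheme m b \<longleftrightarrow>
     length m = DIM('a) \<and> (\<forall>i < DIM('a). 3 \<le> m ! i) \<and>
     (\<forall>i \<le> DIM('a) + 1. lorentz (b i) (b i) = 1) \<and>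
     (\<forall>i < DIM('a). lorentz (b i) (b (i + 1)) = - cos (pi / real (m ! i))) \<and>
     lorentz (b DIM('a)) (b (DIM('a) + 1)) = -1 \<and>
     (\<forall>i j. i + 2 \<le> j \<and> j \<le> DIM('a) + 1 \<longrightarrow> lorentz (b i) (b j) = 0) \<and>
     (\<exists>y \<in> hyp_space. \<forall>i \<le> DIM('a) + 1. lorentz (1, y) (b i) < 0) \<and>
     (\<forall>p. orthoscheme_vertex b 0 p \<longrightarrow> \<not> outer_point p)"

definition reflection :: "real \<times> 'a::euclidean_space \<Rightarrow> real \<times> 'a \<Rightarrow> real \<times> 'a" where
  "reflection u x = x - (2 * lorentz x u) *\<^sub>R u"

text \<open>The generators are involutions, so the monoid they generate is a group.\<close>

inductive_set reflection_group ::
    "(nat \<Rightarrow> real \<times> 'a::euclidean_space) \<Rightarrow> (real \<times> 'a \<Rightarrow> real \<times> 'a) set"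
  for b where
    "id \<in> reflection_group b"
  | "g \<in> reflection_group b \<Longrightarrow> i \<le> DIM('a) + 1 \<Longrightarrow> reflection (b i) \<circ> g \<in> reflection_group b"

definition projective_action ::
    "(real \<times> 'a::euclidean_space \<Rightarrow> real \<times> 'a) \<Rightarrow> 'a \<Rightarrow> 'a" where
  "projective_action g y = snd (g (1, y)) /\<^sub>R fst (g (1, y))"

definition group_images :: "(nat \<Rightarrow> real \<times> 'a::euclidean_space) \<Rightarrow> 'a set \<Rightarrow> 'a set set" where
  "group_images b B = (\<lambda>g. projective_action g ` B) ` reflection_group b"

definition contained_ball ::
    "(nat \<Rightarrow> real \<times> 'a::euclidean_space) \<Rightarrow> 'a \<Rightarrow> real \<Rightarrow> bool" where
  "contained_ball b c r \<longleftrightarrow>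
     c \<in> hyp_space \<and> 0 < r \<and> hyp_ball c r \<subseteq> truncated_polytope b"

definition inball :: "(nat \<Rightarrow> real \<times> 'a::euclidean_space) \<Rightarrow> 'a set \<Rightarrow> bool" where
  "inball b B \<longleftrightarrow>
     (\<exists>c r. contained_ball b c r \<and> B = hyp_ball c r \<and>
            (\<forall>c' r'. contained_ball b c' r' \<longrightarrow> r' \<le> r))"

definition packing_density :: "(nat \<Rightarrow> real \<times> 'a::euclidean_space) \<Rightarrow> 'a set \<Rightarrow> real" where
  "packing_density b B =
     measure hyp_measure B / measure hyp_measure (truncated_polytope b)"

text \<open>\<open>P\<close> is a congruent ball packing generated by the truncated orthoscheme, of density \<open>d\<close>.\<close>

definition congruent_ball_packing ::
    "(nat \<Rightarrow> real \<times> 'a::euclidean_space) \<Rightarrow> 'a set set \<Rightarrow> real \<Rightarrow> bool" where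
  "congruent_ball_packing b P d \<longleftrightarrow>
     (\<exists>c r. contained_ball b c r \<and> P = group_images b (hyp_ball c r) \<and>
            d = packing_density b (hyp_ball c r))"

end

theory Submission
  imports Defs
begin

text \<open>
  All assertions are reduced to Lorentzian linear algebra and to two volumes.

  The symbol. The Gram matrix of the seven normals in dimension six is singular. As \<open>b 5 + b 6\<close> is a
  null vector, this makes the Gram matrix of \<open>b 0, \<dots>, b 3\<close> singular, and
  \<open>(1 - cos\<^sup>2 (\<pi>/m\<^sub>1)) (1 - cos\<^sup>2 (\<pi>/m\<^sub>3)) = cos\<^sup>2 (\<pi>/m\<^sub>2)\<close> has the only solution \<open>4, 3, 4\<close>. Since
  the other principal vertex is not outer, \<open>b 1, \<dots>, b 5\<close> have a semidefinite Gram matrix, and this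
  leaves \<open>m\<^sub>4 = m\<^sub>5 = 3\<close> (lemma \<open>symbol_unique\<close>).

  Coordinates. Any normals with this symbol are the image of explicit ones under a linear Lorentz
  isometry (lemma \<open>orthoscheme_coordinates\<close>). With the ideal vertex \<open>b 5 + b 6\<close> at infinity of the
  upper half space, the polytope is the part outside the unit hemisphere of the prism over
  \<open>0 \<le> x\<^sub>1 \<le> x\<^sub>2 \<le> x\<^sub>3 \<le> 1/2\<close>, \<open>0 \<le> x\<^sub>4 \<le> 1/2\<close>.

  The inball. A ball lies in the polytope if and only if its centre is at distance at least the
  radius from every hyperplane (lemma \<open>contained_ball_iff\<close>). In the coordinates this is a system of
  linear inequalities on the hyperboloid, and it bounds the radius by \<open>sinh r \<le> 1 / \<surd>(34 + 30 \<surd>2)\<close>,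
  with equality for a single centre (lemma \<open>model_inradius\<close>). As the volume of a ball depends only
  on its radius and strictly increases with it, the inball gives the unique densest packing.

  The volumes. The hyperbolic volume of a set is six times the Lebesgue measure of the part below
  the hyperboloid of the cone over it (lemma \<open>emeasure_hyp_measure\<close>). This makes it invariant under
  linear Lorentz isometries, whose determinant is \<open>1\<close> or \<open>-1\<close>, and allows other affine charts of the
  same cone. Slicing the cone over a ball by the time coordinate gives the volume of the ball for
  small radii up to a relative error of \<open>10\<^sup>-\<^sup>4\<close> (lemma \<open>hyp_ball_volume\<close>), and the chart adapted to
  the ideal vertex gives for the polytope \<open>1/24\<close> of the integral of \<open>(1 - |x|\<^sup>2)\<^sup>-\<^sup>2\<close> over the cube
  \<open>[0, 1/2]\<^sup>4\<close> (lemma \<open>emeasure_truncated_polytope\<close>). Its integrand is singular at a second ideal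
  vertex. The power series in \<open>|x|\<^sup>2\<close>, truncated after 32 terms, bounds it below; by the inequality
  \<open>(1 - |x|\<^sup>2)\<^sup>2 \<ge> 16 \<Prod> \<surd>(1/4 - x\<^sub>i\<^sup>2)\<close> the remainder is bounded by a polynomial in \<open>|x|\<^sup>2\<close> against
  arcsine weights. All moments that occur are rational up to a power of \<open>\<pi>\<close> and are obtained from
  those in one variable by binomial convolution, evaluated with integers.
\<close>

section \<open>Lorentzian geometry\<close>

lemma lorentz_commute: "lorentz x y = lorentz y x"
  by (simp add: lorentz_def inner_commute mult.commute)

lemma lorentz_simps [simp]:
  "lorentz (x + y) z = lorentz x z + lorentz y z"
  "lorentz z (x + y) = lorentz z x + lorentz z y"
  "lorentz (x - y) z = lorentz x z - lorentz y z"
  "lorentz z (x - y) = lorentz z x - lorentz z y"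
  "lorentz (c *\<^sub>R x) z = c * lorentz x z"
  "lorentz z (c *\<^sub>R x) = c * lorentz z x"
  "lorentz (- x) z = - lorentz x z"
  "lorentz z (- x) = - lorentz z x"
  "lorentz 0 z = 0"
  "lorentz z 0 = 0"
  by (simp_all add: lorentz_def algebra_simps)

lemma lorentz_sum_left: "lorentz (\<Sum>i\<in>I. f i) z = (\<Sum>i\<in>I. lorentz (f i) z)"
  by (induction I rule: infinite_finite_induct) simp_all

lemma lorentz_self: "lorentz p p = (norm (snd p))\<^sup>2 - (fst p)\<^sup>2"
  by (simp add: lorentz_def power2_norm_eq_inner) (simp add: power2_eq_square)

text \<open>
  Tested against the vector obtained from \<open>x\<close> by reversing time.
\<close>
lemma lorentz_nondegenerate:
  assumes "\<And>y. lorentz x y = 0"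
  shows "x = 0"
proof -
  have "lorentz x (- fst x, snd x) = 0" by (rule assms)
  then have "fst x * fst x + snd x \<bullet> snd x = 0"
    by (simp add: lorentz_def)
  then show ?thesis
    by (metis add_nonneg_eq_0_iff inner_eq_zero_iff inner_ge_zero inner_real_def prod.collapse zero_prod_def)
qed

lemma norm_snd_le_of_causal: "lorentz p p \<le> 0 \<Longrightarrow> norm (snd p) \<le> \<bar>fst p\<bar>"
  by (simp add: lorentz_self flip: abs_le_square_iff)

lemma norm_snd_less_of_timelike: "lorentz p p < 0 \<Longrightarrow> norm (snd p) < \<bar>fst p\<bar>"
  by (metis abs_norm_cancel abs_square_less_1 diff_less_0_iff_less lorentz_self power2_abs power2_less_imp_less abs_ge_zero)

text \<open>
  This is how positive semidefiniteness of a Gram matrix enters: vectors orthogonal to a point that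
  is not outer span a subspace on which the form is semidefinite.
\<close>
lemma orthogonal_to_causal_spacelike:
  assumes "p \<noteq> 0" "lorentz p p \<le> 0" "lorentz p v = 0"
  shows "lorentz v v \<ge> 0"
proof -
  have le: "norm (snd p) \<le> \<bar>fst p\<bar>" by (rule norm_snd_le_of_causal) fact
  have nz: "fst p \<noteq> 0"
    using le assms(1) by (metis abs_zero norm_le_zero_iff prod.collapse zero_prod_def)
  have "\<bar>fst p\<bar> * \<bar>fst v\<bar> = \<bar>snd p \<bullet> snd v\<bar>"
    using assms(3) by (simp add: lorentz_def flip: abs_mult)
  also have "\<dots> \<le> norm (snd p) * norm (snd v)" by (rule Cauchy_Schwarz_ineq2)
  also have "\<dots> \<le> \<bar>fst p\<bar> * norm (snd v)" by (intro mult_right_mono le) simp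
  finally have "\<bar>fst v\<bar> \<le> norm (snd v)" using nz by simp
  then have "(fst v)\<^sup>2 \<le> (norm (snd v))\<^sup>2"
    by (metis abs_le_square_iff abs_norm_cancel)
  then show ?thesis by (simp add: lorentz_self)
qed

text \<open>
  With \<open>a, b\<close> the absolute times and \<open>x, y\<close> the spatial norms, the difference of the two sides is at
  least \<open>(a b - x y)\<^sup>2 - (a\<^sup>2 - x\<^sup>2) (b\<^sup>2 - y\<^sup>2) = (a y - b x)\<^sup>2\<close>.
\<close>
lemma reverse_Cauchy_Schwarz:
  assumes "lorentz p p \<le> 0" "lorentz q q \<le> 0"
  shows "lorentz p p * lorentz q q \<le> (lorentz p q)\<^sup>2"
proof -
  define a x b y where d: "a = \<bar>fst p\<bar>" "x = norm (snd p)" "b = \<bar>fst q\<bar>" "y = norm (snd q)"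
  have le: "x \<le> a" "y \<le> b" "0 \<le> x" "0 \<le> y"
    unfolding d using norm_snd_le_of_causal[OF assms(1)] norm_snd_le_of_causal[OF assms(2)] by simp_all
  have "lorentz p p * lorentz q q = (x\<^sup>2 - a\<^sup>2) * (y\<^sup>2 - b\<^sup>2)"
    by (simp add: lorentz_self d)
  also have "\<dots> = (a * b - x * y)\<^sup>2 - (a * y - b * x)\<^sup>2"
    by (simp add: power2_eq_square algebra_simps)
  also have "\<dots> \<le> (a * b - x * y)\<^sup>2" by simp
  also have "\<dots> \<le> (lorentz p q)\<^sup>2"
  proof (rule abs_le_square_iff[THEN iffD1])
    have "\<bar>snd p \<bullet> snd q\<bar> \<le> x * y" unfolding d by (rule Cauchy_Schwarz_ineq2)
    moreover have "\<bar>fst p * fst q\<bar> = a * b" by (simp add: d abs_mult)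
    moreover have "x * y \<le> a * b" by (intro mult_mono le) (use le in auto)
    ultimately show "\<bar>a * b - x * y\<bar> \<le> \<bar>lorentz p q\<bar>"
      unfolding lorentz_def by linarith
  qed
  finally show ?thesis .
qed

text \<open>
  Time orientation read off from the form, which makes it accessible to linear isometries.
\<close>
lemma lorentz_neg_of_future:
  assumes "lorentz p p < 0" "lorentz q q \<le> 0" "q \<noteq> 0" "fst p > 0"
  shows "lorentz p q < 0 \<longleftrightarrow> fst q > 0"
proof -
  have p: "norm (snd p) < fst p" using norm_snd_less_of_timelike[OF assms(1)] assms(4) by simp
  have q: "norm (snd q) \<le> \<bar>fst q\<bar>" by (rule norm_snd_le_of_causal) fact
  have nz: "fst q \<noteq> 0"
    using q assms(3) by (metis abs_zero norm_le_zero_iff prod.collapse zero_prod_def)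
  have "\<bar>snd p \<bullet> snd q\<bar> \<le> norm (snd p) * norm (snd q)" by (rule Cauchy_Schwarz_ineq2)
  also have "\<dots> \<le> norm (snd p) * \<bar>fst q\<bar>" by (intro mult_left_mono q) simp
  also have "\<dots> < fst p * \<bar>fst q\<bar>" by (intro mult_strict_right_mono p) (use nz in auto)
  finally have *: "\<bar>snd p \<bullet> snd q\<bar> < \<bar>fst p * fst q\<bar>" using assms(4) by (simp add: abs_mult)
  show ?thesis
  proof
    assume "fst q > 0"
    then have "fst p * fst q > 0" using assms(4) by simp
    then show "lorentz p q < 0" using * unfolding lorentz_def by linarith
  next
    assume "lorentz p q < 0"
    then have "fst p * fst q > 0" using * unfolding lorentz_def by linarith
    then show "fst q > 0" using assms(4) by (simp add: zero_less_mult_iff)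
  qed
qed

text \<open>
  The representative of a point of hyperbolic space on the upper sheet \<open>\<langle>p, p\<rangle> = -1\<close>, where
  \<open>- \<langle>p, q\<rangle>\<close> is the hyperbolic cosine of a distance and \<open>- \<langle>p, b\<rangle>\<close>, for a unit normal \<open>b\<close>, the
  hyperbolic sine of a signed distance from a hyperplane.
\<close>
definition hyperboloid_point :: "'a::euclidean_space \<Rightarrow> real \<times> 'a" where
  "hyperboloid_point c = (1 / sqrt (1 - (norm c)\<^sup>2)) *\<^sub>R (1, c)"

lemma hyp_space_iff: "c \<in> hyp_space \<longleftrightarrow> (norm c)\<^sup>2 < 1"
  by (simp add: hyp_space_def abs_square_less_1)

lemma lorentz_hyperboloid_point:
  assumes "c \<in> hyp_space"
  shows "lorentz (hyperboloid_point c) (hyperboloid_point c) = -1" "fst (hyperboloid_point c) > 0"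
proof -
  have "1 - (norm c)\<^sup>2 > 0" using assms by (simp add: hyp_space_iff)
  then show "lorentz (hyperboloid_point c) (hyperboloid_point c) = -1" "fst (hyperboloid_point c) > 0"
    using lorentz_self[of "(1, c)"]
    by (auto simp: hyperboloid_point_def divide_simps simp del: scaleR_Pair simp flip: power2_eq_square)
qed

lemma timelike_in_hyp_space:
  assumes "lorentz p p < 0"
  shows "snd p /\<^sub>R fst p \<in> hyp_space"
proof -
  have "norm (snd p) < \<bar>fst p\<bar>" by (rule norm_snd_less_of_timelike) fact
  then show ?thesis by (simp add: hyp_space_def field_simps divide_simps split: if_splits)
qed

lemma hyperboloid_point_of_timelike:
  assumes "lorentz p p < 0" "fst p > 0"
  shows "hyperboloid_point (snd p /\<^sub>R fst p) = (1 / sqrt (- lorentz p p)) *\<^sub>R p"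
proof -
  have eq: "1 - (norm (snd p /\<^sub>R fst p))\<^sup>2 = (- lorentz p p) / (fst p)\<^sup>2"
    using assms by (simp add: lorentz_self power_mult_distrib field_simps)
  have "sqrt ((- lorentz p p) / (fst p)\<^sup>2) = sqrt (- lorentz p p) / fst p"
    using assms by (simp only: real_sqrt_divide real_sqrt_abs abs_of_pos)
  then show ?thesis
    unfolding hyperboloid_point_def eq using assms
    by (intro prod_eqI) (simp_all add: field_simps)
qed

lemma hyperboloid_pointI:
  assumes "lorentz p p = -1" "fst p > 0"
  shows "hyperboloid_point (snd p /\<^sub>R fst p) = p"
  using hyperboloid_point_of_timelike[of p] assms by simp

lemma hyperboloid_point_inj:
  assumes "hyperboloid_point c = hyperboloid_point d" "c \<in> hyp_space" "d \<in> hyp_space"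
  shows "c = d"
proof -
  have "snd (hyperboloid_point x) /\<^sub>R fst (hyperboloid_point x) = x" if "x \<in> hyp_space" for x :: 'a
    using that by (auto simp: hyperboloid_point_def hyp_space_iff)
  then show ?thesis using assms by metis
qed

lemma lorentz_hyperboloid_points:
  assumes "c \<in> hyp_space" "y \<in> hyp_space"
  shows "1 \<le> - lorentz (hyperboloid_point c) (hyperboloid_point y)"
proof -
  let ?c = "hyperboloid_point c" and ?y = "hyperboloid_point y"
  note c = lorentz_hyperboloid_point[OF assms(1)] and y = lorentz_hyperboloid_point[OF assms(2)]
  have "1 \<le> (lorentz ?c ?y)\<^sup>2"
    using reverse_Cauchy_Schwarz[of ?c ?y] c y by simp
  moreover have "?y \<noteq> 0" using y(2) by auto
  then have "lorentz ?c ?y < 0"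
    using lorentz_neg_of_future[of ?c ?y] c y by simp
  ultimately show ?thesis
    by (metis abs_1 abs_le_square_iff abs_of_neg one_power2)
qed

lemma hyp_dist_eq:
  assumes "c \<in> hyp_space" "y \<in> hyp_space"
  shows "hyp_dist c y = arcosh (- lorentz (hyperboloid_point c) (hyperboloid_point y))"
proof -
  have "lorentz (1, c) (1, c) * lorentz (1, y) (1, y) = (1 - (norm c)\<^sup>2) * (1 - (norm y)\<^sup>2)"
    by (simp add: lorentz_self algebra_simps)
  then show ?thesis
    unfolding hyp_dist_def hyperboloid_point_def lorentz_simps by (simp add: real_sqrt_mult mult.commute)
qed

lemma hyp_ball_iff:
  assumes "c \<in> hyp_space" "0 \<le> r"
  shows "y \<in> hyp_ball c r \<longleftrightarrow>
    y \<in> hyp_space \<and> - lorentz (hyperboloid_point c) (hyperboloid_point y) \<le> cosh r"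
proof (cases "y \<in> hyp_space")
  case True
  let ?k = "- lorentz (hyperboloid_point c) (hyperboloid_point y)"
  have k: "1 \<le> ?k" by (rule lorentz_hyperboloid_points) fact+
  have "arcosh ?k \<le> r \<longleftrightarrow> ?k \<le> cosh r"
  proof -
    have "arcosh ?k \<le> r \<longleftrightarrow> cosh (arcosh ?k) \<le> cosh r"
      using assms(2) k arcosh_nonneg_real[OF k] by (subst cosh_real_nonneg_le_iff) auto
    then show ?thesis using k by simp
  qed
  then show ?thesis using True assms by (simp add: hyp_ball_def hyp_dist_eq)
qed (simp add: hyp_ball_def)

text \<open>
  The distance \<open>d\<close> from the centre to the hyperplane has \<open>sinh d = a\<close> with \<open>a = - \<langle>c, b\<rangle>\<close>. If
  \<open>\<langle>y, b\<rangle> = e > 0\<close> and \<open>a \<ge> 0\<close>, splitting off the components along \<open>b\<close> gives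
  \<open>cosh d(c, y) \<ge> \<surd>(1 + a\<^sup>2) \<surd>(1 + e\<^sup>2) + a e > cosh d\<close>. In the other direction, the point at
  distance \<open>r\<close> on the perpendicular from the centre must not have crossed the hyperplane.
\<close>
lemma hyp_ball_in_halfspace_iff:
  assumes c: "c \<in> hyp_space" and r: "0 \<le> r" and b: "lorentz b b = 1"
  shows "(\<forall>y\<in>hyp_ball c r. lorentz (1, y) b \<le> 0) \<longleftrightarrow> sinh r \<le> - lorentz (hyperboloid_point c) b"
proof -
  define C where "C = hyperboloid_point c"
  define a where "a = - lorentz C b"
  have CC: "lorentz C C = -1" "fst C > 0" using lorentz_hyperboloid_point[OF c] by (simp_all add: C_def)
  have bC: "lorentz C b = - a" "lorentz b C = - a" by (simp_all add: a_def lorentz_commute[of b])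
  have sa: "sqrt (1 + a\<^sup>2) > 0" "(sqrt (1 + a\<^sup>2))\<^sup>2 = 1 + a\<^sup>2"
    by (simp_all add: add_pos_nonneg)
  show ?thesis unfolding C_def[symmetric] a_def[symmetric]
  proof
    assume L: "\<forall>y\<in>hyp_ball c r. lorentz (1, y) b \<le> 0"
    \<comment> \<open>the end of the perpendicular: \<open>b - a C\<close> is tangent at \<open>C\<close> and has length \<open>\<surd>(1 + a\<^sup>2)\<close>\<close>
    define Y where "Y = cosh r *\<^sub>R C + (sinh r / sqrt (1 + a\<^sup>2)) *\<^sub>R (b - a *\<^sub>R C)"
    define k where "k = sinh r / sqrt (1 + a\<^sup>2)"
    have k2: "k\<^sup>2 * (1 + a\<^sup>2) = (sinh r)\<^sup>2"
      using sa by (simp add: k_def power_divide)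
    have Yk: "Y = cosh r *\<^sub>R C + k *\<^sub>R (b - a *\<^sub>R C)" by (simp add: Y_def k_def)
    have "lorentz Y Y = - (cosh r)\<^sup>2 + k\<^sup>2 * (1 + a\<^sup>2)"
      by (simp add: Yk CC bC b algebra_simps power2_eq_square)
    then have YY: "lorentz Y Y = -1" unfolding k2 by (simp add: sinh_square_eq)
    have CY: "lorentz C Y = - cosh r" by (simp add: Yk CC bC algebra_simps)
    have "Y \<noteq> 0" using YY by auto
    then have fY: "fst Y > 0"
      using lorentz_neg_of_future[of C Y] CC YY CY cosh_real_pos[of r] by simp
    define y where "y = snd Y /\<^sub>R fst Y"
    have hy: "hyperboloid_point y = Y" unfolding y_def by (rule hyperboloid_pointI) fact+
    have "y \<in> hyp_space" unfolding y_def by (rule timelike_in_hyp_space) (simp add: YY)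
    then have "y \<in> hyp_ball c r"
      using CY by (subst hyp_ball_iff[OF c r]) (simp add: hy flip: C_def)
    then have "lorentz (1, y) b \<le> 0" using L by blast
    moreover have "Y = fst Y *\<^sub>R (1, y)" using fY by (simp add: y_def prod_eq_iff)
    ultimately have "lorentz Y b \<le> 0"
      using fY by (metis lorentz_simps(5) mult_nonneg_nonpos order_less_imp_le)
    moreover have "lorentz Y b = - (a * cosh r) + k * (1 + a\<^sup>2)"
      by (simp add: Yk bC b algebra_simps power2_eq_square)
    moreover have "k * (1 + a\<^sup>2) = sinh r * sqrt (1 + a\<^sup>2)"
      using sa by (metis k_def nonzero_eq_divide_eq order_less_irrefl power2_eq_square mult.assoc)
    ultimately have le: "sinh r * sqrt (1 + a\<^sup>2) \<le> a * cosh r" by simp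
    have s0: "0 \<le> sinh r" using r by simp
    then have "0 \<le> sinh r * sqrt (1 + a\<^sup>2)" using sa(1) by simp
    then have "0 \<le> a * cosh r" using le by linarith
    then have a0: "0 \<le> a" using cosh_real_pos[of r] by (simp add: zero_le_mult_iff)
    have "(sinh r * sqrt (1 + a\<^sup>2))\<^sup>2 \<le> (a * cosh r)\<^sup>2"
      using le s0 sa(1) by (intro power_mono) simp_all
    then have "(sinh r)\<^sup>2 * (1 + a\<^sup>2) \<le> a\<^sup>2 * (1 + (sinh r)\<^sup>2)"
      by (simp add: power_mult_distrib sa(2) cosh_square_eq add.commute del: real_sqrt_pow2_iff real_sqrt_pow2)
    then have "(sinh r)\<^sup>2 \<le> a\<^sup>2" by (simp add: algebra_simps)
    then show "sinh r \<le> a" using a0 by (rule power2_le_imp_le)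
  next
    assume le: "sinh r \<le> a"
    show "\<forall>y\<in>hyp_ball c r. lorentz (1, y) b \<le> 0"
    proof (rule ballI, rule ccontr)
      fix y assume y: "y \<in> hyp_ball c r" and "\<not> lorentz (1, y) b \<le> 0"
      then have pos: "lorentz (1, y) b > 0" by simp
      define Y where "Y = hyperboloid_point y"
      have yh: "y \<in> hyp_space" and CY: "- lorentz C Y \<le> cosh r"
        using y by (simp_all add: hyp_ball_iff[OF c r] C_def Y_def)
      have CY1: "1 \<le> - lorentz C Y" unfolding C_def Y_def by (rule lorentz_hyperboloid_points) fact+
      define e where "e = lorentz Y b"
      have e: "e > 0" using pos yh by (simp add: e_def Y_def hyperboloid_point_def hyp_space_iff del: scaleR_Pair)
      have YY: "lorentz Y Y = -1" using lorentz_hyperboloid_point[OF yh] by (simp add: Y_def)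
      have bY: "lorentz Y b = e" "lorentz b Y = e" by (simp_all add: e_def lorentz_commute[of b])
      have s0: "0 \<le> sinh r" using r by simp
      then have a0: "0 \<le> a" using le by linarith
      \<comment> \<open>orthogonal projections to the hyperplane of \<open>b\<close>\<close>
      define C' Y' where "C' = C + a *\<^sub>R b" and "Y' = Y - e *\<^sub>R b"
      have C': "lorentz C' C' = - (1 + a\<^sup>2)"
        by (simp add: C'_def CC bC b power2_eq_square algebra_simps)
      have Y': "lorentz Y' Y' = - (1 + e\<^sup>2)"
        by (simp add: Y'_def YY bY b power2_eq_square algebra_simps)
      have CY': "lorentz C' Y' = lorentz C Y + a * e"
        by (simp add: C'_def Y'_def bY bC b algebra_simps)
      have n: "0 \<le> a\<^sup>2" "0 \<le> e\<^sup>2" by simp_all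
      have "(1 + a\<^sup>2) * (1 + e\<^sup>2) \<le> (lorentz C Y + a * e)\<^sup>2"
        using reverse_Cauchy_Schwarz[of C' Y'] n unfolding C' Y' CY' minus_mult_minus by linarith
      then have A: "sqrt ((1 + a\<^sup>2) * (1 + e\<^sup>2)) \<le> \<bar>lorentz C Y + a * e\<bar>"
        by (metis real_sqrt_abs real_sqrt_le_iff)
      have "a * e = sqrt (a\<^sup>2 * e\<^sup>2)" using a0 e by (simp add: real_sqrt_mult)
      also have "\<dots> \<le> sqrt ((1 + a\<^sup>2) * (1 + e\<^sup>2))"
        unfolding real_sqrt_le_iff by (intro mult_mono) simp_all
      finally have "sqrt ((1 + a\<^sup>2) * (1 + e\<^sup>2)) \<le> - lorentz C Y - a * e"
        using A CY1 by linarith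
      then have B: "sqrt ((1 + a\<^sup>2) * (1 + e\<^sup>2)) \<le> cosh r"
        using CY a0 e mult_nonneg_nonneg[of a e] by linarith
      have "cosh r = sqrt (1 + (sinh r)\<^sup>2)"
        using cosh_square_eq[of r] cosh_real_nonneg[of r] by (metis real_sqrt_unique add.commute)
      also have "\<dots> \<le> sqrt (1 + a\<^sup>2)"
        using le s0 by (simp add: power_mono)
      also have "\<dots> < sqrt ((1 + a\<^sup>2) * (1 + e\<^sup>2))"
        using e sa by (simp add: algebra_simps add_pos_nonneg)
      finally show False using B by simp
    qed
  qed
qed

lemma hyp_ball_subset_hyp_space: "hyp_ball c r \<subseteq> hyp_space"
  by (auto simp: hyp_ball_def)

lemma contained_ball_iff:
  fixes b :: "nat \<Rightarrow> real \<times> 'a::euclidean_space"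
  assumes "\<forall>i \<le> DIM('a) + 1. lorentz (b i) (b i) = 1"
  shows "contained_ball b c r \<longleftrightarrow>
    c \<in> hyp_space \<and> 0 < r \<and> (\<forall>i \<le> DIM('a) + 1. sinh r \<le> - lorentz (hyperboloid_point c) (b i))"
proof (cases "c \<in> hyp_space \<and> 0 < r")
  case True
  have "hyp_ball c r \<subseteq> truncated_polytope b \<longleftrightarrow>
     (\<forall>i \<le> DIM('a) + 1. \<forall>y\<in>hyp_ball c r. lorentz (1, y) (b i) \<le> 0)"
    using hyp_ball_subset_hyp_space[of c r]
    by (fastforce simp: truncated_polytope_def hyp_space_def closed_hyp_space_def)
  also have "\<dots> \<longleftrightarrow> (\<forall>i \<le> DIM('a) + 1. sinh r \<le> - lorentz (hyperboloid_point c) (b i))"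
    using True assms hyp_ball_in_halfspace_iff[of c r] by auto
  finally show ?thesis using True by (simp add: contained_ball_def)
qed (auto simp: contained_ball_def)

section \<open>Hyperbolic volume as Lebesgue measure of cones\<close>

lemma nn_integral_lborel_scaleR:
  fixes f :: "'a::euclidean_space \<Rightarrow> ennreal"
  assumes [measurable]: "f \<in> borel_measurable borel" and c: "c \<noteq> 0"
  shows "(\<integral>\<^sup>+x. f x \<partial>lborel) = ennreal (\<bar>c\<bar> ^ DIM('a)) * (\<integral>\<^sup>+x. f (c *\<^sub>R x) \<partial>lborel)"
  by (subst lborel_affine[OF c, of 0])
     (simp add: nn_integral_density nn_integral_distr nn_integral_cmult)

lemma nn_integral_power_up_to:
  fixes w :: real
  assumes "0 \<le> w"
  shows "(\<integral>\<^sup>+h. ennreal (h ^ n) * indicator {0<..w} h \<partial>lborel) = ennreal (w ^ Suc n / real (Suc n))"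
proof -
  have "(\<integral>\<^sup>+h. ennreal (h ^ n) * indicator {0..w} h \<partial>lborel) = ennreal (w ^ Suc n / real (Suc n) - 0 ^ Suc n / real (Suc n))"
    using assms
    by (intro nn_integral_FTC_Icc) (auto intro!: derivative_eq_intros simp: field_simps simp del: power_Suc of_nat_Suc)
  moreover have "(\<integral>\<^sup>+h. ennreal (h ^ n) * indicator {0<..w} h \<partial>lborel) = (\<integral>\<^sup>+h. ennreal (h ^ n) * indicator {0..w} h \<partial>lborel)"
    by (intro nn_integral_cong_AE, rule AE_I[where N="{0}"]) (auto simp: indicator_def split: if_splits)
  ultimately show ?thesis by simp
qed

text \<open>
  Integration along rays: over \<open>x\<close> the factor \<open>h\<close> runs up to \<open>q x\<close> to the power \<open>-1/2\<close>, with density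
  \<open>h\<^sup>n\<close>. The function \<open>q\<close> is arbitrary because different affine charts of the same cone give
  different \<open>q\<close>: comparing two of them is a projective change of variables.
\<close>
lemma emeasure_homogeneous_cone:
  fixes q :: "'a::euclidean_space \<Rightarrow> real"
  assumes [measurable]: "A \<in> sets borel" "q \<in> borel_measurable borel"
    and q: "\<And>x. x \<in> A \<Longrightarrow> 0 < q x"
  shows "emeasure lborel {p :: real \<times> 'a. 0 < fst p \<and> snd p /\<^sub>R fst p \<in> A \<and> (fst p)\<^sup>2 * q (snd p /\<^sub>R fst p) \<le> 1}
    = ennreal (1 / (real DIM('a) + 1)) * (\<integral>\<^sup>+x. ennreal (q x powr (- (real DIM('a) + 1) / 2)) * indicator A x \<partial>lborel)"
proof -
  let ?n = "DIM('a)"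
  let ?S = "{p :: real \<times> 'a. 0 < fst p \<and> snd p /\<^sub>R fst p \<in> A \<and> (fst p)\<^sup>2 * q (snd p /\<^sub>R fst p) \<le> 1}"
  have "{p \<in> space (borel \<Otimes>\<^sub>M borel). 0 < fst p \<and> snd p /\<^sub>R fst p \<in> A \<and> (fst p)\<^sup>2 * q (snd p /\<^sub>R fst p) \<le> 1}
    \<in> sets (borel \<Otimes>\<^sub>M borel)" by measurable
  then have [measurable]: "?S \<in> sets (borel \<Otimes>\<^sub>M borel)" by (simp add: space_pair_measure)
  have "emeasure lborel ?S = (\<integral>\<^sup>+h. \<integral>\<^sup>+y. indicator ?S (h, y) \<partial>lborel \<partial>lborel)"
    by (subst lborel_prod[symmetric], subst lborel.emeasure_pair_measure) simp_all
  also have "\<dots> = (\<integral>\<^sup>+h. \<integral>\<^sup>+x. ennreal (h ^ ?n) * indicator {0<..} h * indicator ?S (h, h *\<^sub>R x) \<partial>lborel \<partial>lborel)"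
  proof (rule nn_integral_cong)
    fix h :: real
    show "(\<integral>\<^sup>+y. indicator ?S (h, y) \<partial>lborel) = (\<integral>\<^sup>+x. ennreal (h ^ ?n) * indicator {0<..} h * indicator ?S (h, h *\<^sub>R x) \<partial>lborel)"
    proof (cases "h > 0")
      case True
      then show ?thesis
        by (subst nn_integral_lborel_scaleR[of _ h]) (auto simp: nn_integral_cmult)
    qed simp
  qed
  also have "\<dots> = (\<integral>\<^sup>+x. \<integral>\<^sup>+h. ennreal (h ^ ?n) * indicator {0<..} h * indicator ?S (h, h *\<^sub>R x) \<partial>lborel \<partial>lborel)"
    by (rule lborel_pair.Fubini'[symmetric]) simp
  also have "\<dots> = (\<integral>\<^sup>+x. ennreal (1 / (real ?n + 1)) * (ennreal (q x powr (- (real ?n + 1) / 2)) * indicator A x) \<partial>lborel)"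
  proof (rule nn_integral_cong)
    fix x :: 'a
    show "(\<integral>\<^sup>+h. ennreal (h ^ ?n) * indicator {0<..} h * indicator ?S (h, h *\<^sub>R x) \<partial>lborel) =
      ennreal (1 / (real ?n + 1)) * (ennreal (q x powr (- (real ?n + 1) / 2)) * indicator A x)"
    proof (cases "x \<in> A")
      case True
      define w where "w = q x powr (- 1 / 2)"
      have w: "w > 0" "w\<^sup>2 = 1 / q x"
        using q[OF True] by (simp_all add: w_def powr_minus_divide powr_half_sqrt power_divide)
      have "h\<^sup>2 * q x \<le> 1 \<longleftrightarrow> h \<le> w" if "h > 0" for h
      proof -
        have "h\<^sup>2 * q x \<le> 1 \<longleftrightarrow> h\<^sup>2 \<le> w\<^sup>2"
          using q[OF True] by (simp add: w(2) field_simps)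
        also have "\<dots> \<longleftrightarrow> h \<le> w" using that w(1) by simp
        finally show ?thesis .
      qed
      then have "(\<integral>\<^sup>+h. ennreal (h ^ ?n) * indicator {0<..} h * indicator ?S (h, h *\<^sub>R x) \<partial>lborel) =
         (\<integral>\<^sup>+h. ennreal (h ^ ?n) * indicator {0<..w} h \<partial>lborel)"
        using True by (intro nn_integral_cong) (auto simp: indicator_def)
      also have "\<dots> = ennreal (w ^ Suc ?n / real (Suc ?n))"
        by (rule nn_integral_power_up_to) (use w in simp)
      also have "w ^ Suc ?n = q x powr (- (real ?n + 1) / 2)"
      proof -
        have "w ^ Suc ?n = q x powr (real (Suc ?n) * (- 1 / 2))"
          unfolding w_def by (rule powr_power) (use q[OF True] in auto)
        also have "real (Suc ?n) * (- 1 / 2) = - (real ?n + 1) / 2" by (simp add: field_simps)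
        finally show ?thesis .
      qed
      finally show ?thesis
        using True by (simp add: ennreal_mult' flip: ennreal_mult)
    next
      case False
      have "ennreal (h ^ ?n) * indicator {0<..} h * indicator ?S (h, h *\<^sub>R x) = (0 :: ennreal)" for h
        using False by (cases "h > 0") (simp_all add: indicator_def)
      then show ?thesis using False by (simp del: mult_eq_0_iff)
    qed
  qed
  also have "\<dots> = ennreal (1 / (real ?n + 1)) * (\<integral>\<^sup>+x. ennreal (q x powr (- (real ?n + 1) / 2)) * indicator A x \<partial>lborel)"
    by (rule nn_integral_cmult) simp
  finally show ?thesis .
qed

text \<open>
  The part below the hyperboloid of the cone over a set of points; its Lebesgue measure is
  manifestly invariant under linear isometries of the form.
\<close>
definition hyp_cone :: "'a::euclidean_space set \<Rightarrow> (real \<times> 'a) set" where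
  "hyp_cone A = {p. 0 < fst p \<and> lorentz p p < 0 \<and> snd p /\<^sub>R fst p \<in> A \<and> - lorentz p p \<le> 1}"

lemma lorentz_measurable [measurable]:
  "lorentz p \<in> borel_measurable borel" "(\<lambda>x. lorentz x p) \<in> borel_measurable borel"
  "(\<lambda>p. lorentz p p) \<in> borel_measurable borel"
  unfolding lorentz_def by (intro borel_measurable_continuous_onI continuous_intros)+

lemma hyp_space_borel [measurable]: "hyp_space \<in> sets borel"
  by (simp add: hyp_space_def)

lemma sets_hyp_measure [measurable_cong, simp]: "sets hyp_measure = sets borel"
  by (simp add: hyp_measure_def)

lemma emeasure_hyp_measure:
  fixes A :: "'a::euclidean_space set"
  assumes [measurable]: "A \<in> sets borel"
  shows "emeasure hyp_measure A = ennreal (real DIM('a) + 1) * emeasure lborel (hyp_cone A)"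
proof -
  let ?n = "DIM('a)"
  define B where "B = A \<inter> hyp_space"
  have [measurable]: "B \<in> sets borel" by (simp add: B_def)
  have cone: "hyp_cone A = {p. 0 < fst p \<and> snd p /\<^sub>R fst p \<in> B \<and> (fst p)\<^sup>2 * (1 - (norm (snd p /\<^sub>R fst p))\<^sup>2) \<le> 1}"
  proof -
    have "lorentz p p = - ((fst p)\<^sup>2 * (1 - (norm (snd p /\<^sub>R fst p))\<^sup>2))" if "0 < fst p" for p :: "real \<times> 'a"
      using that by (simp add: lorentz_self power_mult_distrib field_simps)
    then show ?thesis
      unfolding hyp_cone_def B_def using timelike_in_hyp_space
      by (auto simp: hyp_space_iff zero_less_mult_iff)
  qed
  have "emeasure hyp_measure A = (\<integral>\<^sup>+x. ennreal ((1 - (norm x)\<^sup>2) powr (- (real ?n + 1) / 2)) * indicator B x \<partial>lborel)"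
    unfolding hyp_measure_def
    by (subst emeasure_density) (auto intro!: nn_integral_cong simp: B_def indicator_def)
  moreover have "emeasure lborel (hyp_cone A) = ennreal (1 / (real ?n + 1)) * \<dots>"
    unfolding cone
    by (rule emeasure_homogeneous_cone) (auto simp: B_def hyp_space_iff)
  moreover have "ennreal (real ?n + 1) * ennreal (1 / (real ?n + 1)) = 1"
    by (subst ennreal_mult[symmetric]) (simp_all del: ennreal_plus)
  ultimately show ?thesis by (simp flip: mult.assoc)
qed

lemma hyp_cone_borel [measurable]:
  fixes A :: "'a::euclidean_space set"
  shows "A \<in> sets borel \<Longrightarrow> hyp_cone A \<in> sets borel"
proof -
  assume [measurable]: "A \<in> sets borel"
  have [measurable]: "(\<lambda>p::real \<times> 'a. lorentz p p) \<in> borel_measurable (borel \<Otimes>\<^sub>M borel)"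
    unfolding borel_prod by measurable
  have "{p \<in> space (borel \<Otimes>\<^sub>M borel). 0 < fst p \<and> lorentz p p < 0 \<and> snd p /\<^sub>R fst p \<in> A \<and> - lorentz p p \<le> 1}
    \<in> sets (borel \<Otimes>\<^sub>M borel)" by measurable
  then show ?thesis by (simp only: hyp_cone_def space_pair_measure borel_prod space_borel UNIV_Times_UNIV UNIV_I simp_thms)
qed

section \<open>Lorentz isometries preserve Lebesgue measure\<close>

text \<open>
  A bijection between the orthonormal bases, extended linearly. It serves to identify coordinate
  spaces of different types, such as \<open>real \<times> real ^ 5\<close> with \<open>real ^ 6\<close>.
\<close>
lemma euclidean_isometry_exists:
  assumes dim: "DIM('a::euclidean_space) = DIM('b::euclidean_space)"
  obtains f :: "'a::euclidean_space \<Rightarrow> 'b::euclidean_space" and g where "linear f" "linear g"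
    "\<And>x y. f x \<bullet> f y = x \<bullet> y" "\<And>x. g (f x) = x" "\<And>y. f (g y) = y"
    "distr lborel borel f = lborel"
proof -
  obtain h where h: "bij_betw h (Basis :: 'a set) (Basis :: 'b set)"
    using dim finite_same_card_bij[OF finite_Basis finite_Basis] by blast
  let ?k = "the_inv_into Basis h"
  define f :: "'a \<Rightarrow> 'b" where "f x = (\<Sum>i\<in>Basis. (x \<bullet> i) *\<^sub>R h i)" for x
  define g :: "'b \<Rightarrow> 'a" where "g y = (\<Sum>i\<in>Basis. (y \<bullet> h i) *\<^sub>R i)" for y
  have lin: "linear f" "linear g"
    by (auto intro!: linearI simp: f_def g_def inner_add_left scaleR_add_left sum.distrib scaleR_sum_right)
  have hB: "h i \<in> Basis" if "i \<in> Basis" for i using h that by (auto simp: bij_betw_def)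
  have hh: "h i \<bullet> h j = (if i = j then 1 else 0)" if "i \<in> Basis" "j \<in> Basis" for i j
    using h that hB by (auto simp: inner_Basis bij_betw_def dest: inj_onD)
  have fh: "f x \<bullet> h j = x \<bullet> j" if "j \<in> Basis" for x j
  proof -
    have "f x \<bullet> h j = (\<Sum>i\<in>Basis. (x \<bullet> i) * (if i = j then 1 else 0))"
      unfolding f_def inner_sum_left using hh that by (intro sum.cong) auto
    also have "\<dots> = x \<bullet> j" using that by (simp add: if_distrib cong: if_cong)
    finally show ?thesis .
  qed
  have gb: "g y \<bullet> i = y \<bullet> h i" if "i \<in> Basis" for y i
    using that by (simp add: g_def inner_sum_left inner_Basis if_distrib cong: if_cong)
  have gf: "g (f x) = x" for x
    by (rule euclidean_eqI) (simp add: gb fh)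
  have eqh: "y = z" if "\<And>i. i \<in> Basis \<Longrightarrow> y \<bullet> h i = z \<bullet> h i" for y z
  proof (rule euclidean_eqI)
    fix b :: 'b assume "b \<in> Basis"
    then obtain i where "i \<in> Basis" "b = h i" using h by (auto simp: bij_betw_def)
    then show "y \<bullet> b = z \<bullet> b" using that by simp
  qed
  have fg: "f (g y) = y" for y by (rule eqh) (simp add: gb fh)
  have iso: "f x \<bullet> f y = x \<bullet> y" for x y
  proof -
    have "f x \<bullet> f y = (\<Sum>i\<in>Basis. (y \<bullet> i) * (f x \<bullet> h i))"
      by (subst (2) f_def) (simp add: inner_sum_right)
    also have "\<dots> = (\<Sum>i\<in>Basis. (y \<bullet> i) * (x \<bullet> i))" by (intro sum.cong) (simp_all add: fh)
    also have "\<dots> = x \<bullet> y" by (subst (2) euclidean_inner) (simp add: mult.commute)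
    finally show ?thesis .
  qed
  have meas: "f \<in> borel_measurable borel"
    using lin(1) by (intro borel_measurable_continuous_onI linear_continuous_on) (simp add: linear_conv_bounded_linear)
  have "lborel = distr lborel borel f"
  proof (rule lborel_eqI)
    fix l u :: 'b assume le: "\<And>b. b \<in> Basis \<Longrightarrow> l \<bullet> b \<le> u \<bullet> b"
    have "f -` box l u = box (g l) (g u)"
    proof -
      have "f x \<in> box l u \<longleftrightarrow> x \<in> box (g l) (g u)" for x
      proof -
        have "f x \<in> box l u \<longleftrightarrow> (\<forall>b\<in>h ` Basis. l \<bullet> b < f x \<bullet> b \<and> f x \<bullet> b < u \<bullet> b)"
          using h by (simp add: box_def bij_betw_def)
        also have "\<dots> \<longleftrightarrow> x \<in> box (g l) (g u)" by (auto simp: box_def gb fh)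
        finally show ?thesis .
      qed
      then show ?thesis by auto
    qed
    then have "emeasure (distr lborel borel f) (box l u) = emeasure lborel (box (g l) (g u))"
      using meas by (simp add: emeasure_distr)
    also have "\<dots> = (\<Prod>i\<in>Basis. (g u - g l) \<bullet> i)"
      using le hB by (intro emeasure_lborel_box) (auto simp: gb)
    also have "(\<Prod>i\<in>Basis. (g u - g l) \<bullet> i) = (\<Prod>i\<in>Basis. (u - l) \<bullet> h i)"
      by (intro prod.cong) (simp_all add: gb inner_diff_left)
    also have "\<dots> = (\<Prod>b\<in>Basis. (u - l) \<bullet> b)"
      using prod.reindex_bij_betw[OF h, of "\<lambda>b. (u - l) \<bullet> b"] by simp
    finally show "emeasure (distr lborel borel f) (box l u) = (\<Prod>b\<in>Basis. (u - l) \<bullet> b)" .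
  qed simp
  then show thesis using that[OF lin iso gf fg] by simp
qed

lemma lborel_distr_linear:
  fixes f :: "real^'n::{finite,wellorder} \<Rightarrow> real^'n::{finite,wellorder}"
  assumes f: "linear f" and det: "\<bar>det (matrix f)\<bar> = 1"
  shows "distr lborel borel f = lborel"
proof -
  have inv: "invertible (matrix f)" using det by (simp add: invertible_det_nz)
  then obtain B where B: "matrix f ** B = mat 1" "B ** matrix f = mat 1"
    by (auto simp: invertible_def)
  define g where "g = (*v) B"
  have lg: "linear g" by (simp add: g_def)
  have fm: "f x = matrix f *v x" for x using f by simp
  have fg: "f (g x) = x" and gf: "g (f x) = x" for x
    unfolding fm[of "g x"] fm[of x] unfolding g_def
    by (simp_all only: matrix_vector_mul_assoc matrix_vector_mul_lid B)
  have "matrix g = B" by (simp add: g_def)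
  then have "det (matrix f) * det (matrix g) = 1"
    by (metis det_I det_mul B(1))
  then have dg: "\<bar>det (matrix g)\<bar> = 1"
    using det by (metis abs_mult abs_one mult_1)
  have meas: "f \<in> borel_measurable borel"
    using f by (intro borel_measurable_continuous_onI linear_continuous_on) (simp add: linear_conv_bounded_linear)
  have "lborel = distr lborel borel f"
  proof (rule lborel_eqI)
    fix l u :: "real^'n::{finite,wellorder}" assume le: "\<And>b. b \<in> Basis \<Longrightarrow> l \<bullet> b \<le> u \<bullet> b"
    have vim: "f -` box l u = g ` box l u"
      using fg gf by (auto simp: image_iff) metis
    have bor: "g ` box l u \<in> sets borel"
      unfolding vim[symmetric] using meas by (simp add: measurable_sets_borel)
    have lm: "g ` box l u \<in> lmeasurable" by (rule measurable_linear_image[OF lg]) simp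
    have "emeasure (distr lborel borel f) (box l u) = emeasure lborel (g ` box l u)"
      using meas by (simp add: emeasure_distr vim)
    also have "\<dots> = emeasure lebesgue (g ` box l u)" using bor by simp
    also have "\<dots> = measure lebesgue (g ` box l u)" using lm by (simp add: emeasure_eq_measure2)
    also have "\<dots> = measure lebesgue (box l u)"
      by (subst measure_linear_image[OF lg]) (simp_all add: dg)
    also have "\<dots> = (\<Prod>b\<in>Basis. (u - l) \<bullet> b)"
      using le by (simp add: measure_lborel_box inner_diff_left)
    finally show "emeasure (distr lborel borel f) (box l u) = (\<Prod>b\<in>Basis. (u - l) \<bullet> b)" .
  qed simp
  then show ?thesis by simp
qed

text \<open>
  In orthonormal coordinates the matrix \<open>A\<close> of a Lorentz isometry satisfies \<open>A\<^sup>T J A = J'\<close> with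
  involutions \<open>J\<close> and \<open>J'\<close>, so its determinant is \<open>1\<close> or \<open>-1\<close>.
\<close>
lemma lborel_distr_lorentz_isometry:
  fixes F :: "real \<times> 'a::euclidean_space \<Rightarrow> real \<times> 'b::euclidean_space"
  assumes dims: "DIM('a) = 5" "DIM('b) = 5"
    and F: "linear F" "\<And>x y. lorentz (F x) (F y) = lorentz x y"
  shows "distr lborel borel F = lborel"
proof -
  obtain f :: "real \<times> 'a \<Rightarrow> real^6" and f' where f: "linear f" "linear f'"
    "\<And>x y. f x \<bullet> f y = x \<bullet> y" "\<And>x. f' (f x) = x" "\<And>y. f (f' y) = y"
    "distr lborel borel f = lborel"
    by (rule euclidean_isometry_exists[where 'a="real \<times> 'a" and 'b="real^6"]) (simp_all add: dims)
  obtain g :: "real \<times> 'b \<Rightarrow> real^6" and g' where g: "linear g" "linear g'"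
    "\<And>x y. g x \<bullet> g y = x \<bullet> y" "\<And>x. g' (g x) = x" "\<And>y. g (g' y) = y"
    "distr lborel borel g = lborel"
    by (rule euclidean_isometry_exists[where 'a="real \<times> 'b" and 'b="real^6"]) (simp_all add: dims)
  define Ja :: "real \<times> 'a \<Rightarrow> real \<times> 'a" where "Ja p = (- fst p, snd p)" for p
  define Jb :: "real \<times> 'b \<Rightarrow> real \<times> 'b" where "Jb p = (- fst p, snd p)" for p
  have lJ: "linear Ja" "linear Jb"
    by (auto intro!: linearI simp: Ja_def Jb_def)
  define ja where "ja = f \<circ> Ja \<circ> f'"
  define jb where "jb = g \<circ> Jb \<circ> g'"
  define k where "k = g \<circ> F \<circ> f'"
  have lin: "linear ja" "linear jb" "linear k"
    unfolding ja_def jb_def k_def using f g F(1) lJ by (auto intro!: linear_compose)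
  have ja: "x \<bullet> ja y = lorentz (f' x) (f' y)" for x y
  proof -
    have "x \<bullet> ja y = f (f' x) \<bullet> f (Ja (f' y))" by (simp add: ja_def f)
    also have "\<dots> = lorentz (f' x) (f' y)" by (subst f(3)) (simp add: Ja_def lorentz_def inner_prod_def)
    finally show ?thesis .
  qed
  have jb: "x \<bullet> jb y = lorentz (g' x) (g' y)" for x y
  proof -
    have "x \<bullet> jb y = g (g' x) \<bullet> g (Jb (g' y))" by (simp add: jb_def g)
    also have "\<dots> = lorentz (g' x) (g' y)" by (subst g(3)) (simp add: Jb_def lorentz_def inner_prod_def)
    finally show ?thesis .
  qed
  have kj: "k x \<bullet> jb (k y) = x \<bullet> ja y" for x y
    by (simp add: jb ja k_def g F(2))
  have works: "matrix ja *v x = ja x" "matrix jb *v x = jb x" "matrix k *v x = k x" for x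
    using lin by simp_all
  have "(transpose (matrix k) ** matrix jb ** matrix k) *v y = matrix ja *v y" for y
  proof (rule vector_eq_ldot[THEN iffD1], rule allI)
    fix x
    have "x \<bullet> ((transpose (matrix k) ** matrix jb ** matrix k) *v y)
        = (matrix k *v x) \<bullet> (matrix jb *v (matrix k *v y))"
      by (simp only: matrix_vector_mul_assoc[symmetric] matrix_mul_assoc dot_lmul_matrix[symmetric]
          vector_transpose_matrix)
    also have "\<dots> = x \<bullet> (matrix ja *v y)" by (simp only: works kj)
    finally show "x \<bullet> ((transpose (matrix k) ** matrix jb ** matrix k) *v y) = x \<bullet> (matrix ja *v y)" .
  qed
  then have "transpose (matrix k) ** matrix jb ** matrix k = matrix ja"
    by (simp add: matrix_eq)
  then have dk: "det (matrix k) * det (matrix jb) * det (matrix k) = det (matrix ja)"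
    by (metis det_mul det_transpose)
  have "ja \<circ> ja = id" by (auto simp: ja_def f Ja_def)
  then have "matrix ja ** matrix ja = mat 1"
    using matrix_compose[OF lin(1) lin(1)] by (simp add: matrix_id_mat_1)
  then have da: "det (matrix ja) * det (matrix ja) = 1" by (metis det_I det_mul)
  have "jb \<circ> jb = id" by (auto simp: jb_def g Jb_def)
  then have "matrix jb ** matrix jb = mat 1"
    using matrix_compose[OF lin(2) lin(2)] by (simp add: matrix_id_mat_1)
  then have db: "det (matrix jb) * det (matrix jb) = 1" by (metis det_I det_mul)
  have "\<bar>det (matrix ja)\<bar> = 1" "\<bar>det (matrix jb)\<bar> = 1"
    using da db by (auto simp: square_eq_1_iff)
  moreover have "\<bar>det (matrix k)\<bar> * \<bar>det (matrix jb)\<bar> * \<bar>det (matrix k)\<bar> = \<bar>det (matrix ja)\<bar>"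
    using dk by (metis abs_mult)
  ultimately have "\<bar>det (matrix k)\<bar> * \<bar>det (matrix k)\<bar> = 1" by simp
  then have "\<bar>det (matrix k)\<bar> = 1" by (auto simp: square_eq_1_iff)
  then have k: "distr lborel borel k = lborel" by (intro lborel_distr_linear lin)
  have meas: "h \<in> borel_measurable borel" if "linear h" for h :: "'x::euclidean_space \<Rightarrow> 'y::euclidean_space"
    using that by (intro borel_measurable_continuous_onI linear_continuous_on) (simp add: linear_conv_bounded_linear)
  have "distr lborel borel g' = distr (distr lborel borel g) borel g'" by (simp add: g(6))
  also have "\<dots> = distr lborel borel (\<lambda>x. x)"
    using g by (subst distr_distr) (auto simp: meas comp_def)
  also have "\<dots> = lborel" by (rule distr_id2) simp
  finally have g': "distr lborel borel g' = lborel" .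
  have Fk: "F = g' \<circ> k \<circ> f" by (auto simp: k_def f g)
  have [measurable]: "f \<in> borel_measurable borel" "g' \<in> borel_measurable borel" "k \<in> borel_measurable borel"
    using f g lin by (simp_all add: meas)
  have "distr lborel borel F = distr lborel borel ((g' \<circ> k) \<circ> f)" by (simp add: Fk)
  also have "\<dots> = distr (distr lborel borel f) borel (g' \<circ> k)"
    by (rule distr_distr[symmetric]) measurable
  also have "\<dots> = distr (distr lborel borel k) borel g'"
    unfolding f(6) by (rule distr_distr[symmetric]) measurable
  finally show ?thesis by (simp add: k g')
qed

section \<open>The Coxeter symbol is determined by linear algebra\<close>

text \<open>
  The equation is \<open>sin 2\<theta> = sin 3\<theta>\<close> for \<open>\<theta> = \<pi> / 5\<close>; the upper bound makes \<open>cos\<^sup>2 (\<pi> / 5)\<close> smaller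
  than \<open>2/3\<close>, the value that a solution \<open>{3, 3, n}\<close> of the determinant equation would need.
\<close>
lemma cos_pi_div_5:
  "4 * (cos (pi / 5))\<^sup>2 = 2 * cos (pi / 5) + 1" "3/4 < cos (pi / 5)" "cos (pi / 5) < 5/6"
proof -
  define x where "x = cos (pi / 5)"
  have x0: "x > 0" unfolding x_def by (rule cos_gt_zero_pi) (use pi_gt_zero in linarith)+
  have s0: "sin (pi / 5) > 0" by (rule sin_gt_zero) (use pi_gt_zero in auto)
  have "sin (2 * (pi / 5)) = sin (pi - 2 * (pi / 5))" by (rule sin_pi_minus[symmetric])
  also have "pi - 2 * (pi / 5) = 2 * (pi / 5) + pi / 5" by (simp add: field_simps)
  also have "sin \<dots> = sin (pi / 5) * (4 * x\<^sup>2 - 1)"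
    unfolding sin_add sin_double cos_double_cos x_def by (simp add: algebra_simps power2_eq_square)
  finally have "2 * sin (pi / 5) * x = sin (pi / 5) * (4 * x\<^sup>2 - 1)"
    by (simp only: sin_double x_def)
  then have "sin (pi / 5) * (2 * x) = sin (pi / 5) * (4 * x\<^sup>2 - 1)" by (simp only: ac_simps)
  then have "2 * x = 4 * x\<^sup>2 - 1" using s0 by simp
  then have eq: "x * (4 * x - 2) = 1" by (simp add: power2_eq_square algebra_simps)
  then show "4 * (cos (pi / 5))\<^sup>2 = 2 * cos (pi / 5) + 1"
    by (simp add: x_def power2_eq_square algebra_simps)
  show "3/4 < cos (pi / 5)"
  proof (rule ccontr)
    assume "\<not> ?thesis"
    then have x: "x \<le> 3/4" by (simp add: x_def)
    have "x * (4 * x - 2) \<le> x * 1" using x x0 by (intro mult_left_mono) auto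
    then have "x * (4 * x - 2) \<le> 3/4" using x by linarith
    then show False using eq by simp
  qed
  show "cos (pi / 5) < 5/6"
  proof (rule ccontr)
    assume "\<not> ?thesis"
    then have "(5/6) * (4/3) \<le> x * (4 * x - 2)" by (intro mult_mono) (auto simp: x_def[symmetric])
    then show False using eq by simp
  qed
qed

lemma cos_pi_div_pos:
  assumes "3 \<le> n" shows "cos (pi / real n) > 0"
proof (rule cos_gt_zero_pi)
  have "pi / real n \<le> pi / 3" using assms by (intro divide_left_mono) auto
  moreover have "pi / real n > 0" using assms by simp
  ultimately show "- (pi/2) < pi / real n" "pi / real n < pi / 2" using pi_gt_zero by linarith+
qed

lemma cos_sq_pi_div_cases:
  assumes "3 \<le> n"
  defines "u \<equiv> (cos (pi / real n))\<^sup>2"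
  shows "n = 3 \<and> u = 1/4 \<or> n = 4 \<and> u = 1/2 \<or> 5 \<le> n \<and> 5/8 < u \<and> u < 2/3 \<or> 6 \<le> n \<and> 3/4 \<le> u \<and> u < 1"
proof -
  consider "n = 3" | "n = 4" | "n = 5" | "n \<ge> 6" using assms(1) by linarith
  then show ?thesis
  proof cases
    case 3
    then have "5/8 < u" "u < 2/3" using cos_pi_div_5 by (simp_all add: u_def)
    then show ?thesis using 3 by simp
  next
    case 4
    have "pi / real n \<le> pi / 6" by (rule divide_left_mono) (use 4 in auto)
    moreover have "0 < pi / real n" using 4 by simp
    moreover have "pi / 6 \<le> pi" by simp
    ultimately have "cos (pi / 6) \<le> cos (pi / real n)" "cos (pi / real n) < cos 0"
      using cos_monotone_0_pi_le[of "pi / real n" "pi / 6"] cos_monotone_0_pi[of 0 "pi / real n"] by linarith+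
    then have "(sqrt 3 / 2)\<^sup>2 \<le> u" "u < 1\<^sup>2"
      unfolding u_def using cos_pi_div_pos[OF assms(1)]
      by (intro power_mono power_strict_mono; simp add: cos_30)+
    then show ?thesis using 4 by (simp add: power_divide)
  qed (auto simp: u_def cos_60 cos_45 power_divide)
qed

text \<open>
  The equation says that the linear Coxeter diagram with labels \<open>n1, n2, n3\<close> has Gram determinant
  zero; the honeycomb \<open>{4, 3, 4}\<close> of cubes is its only solution.
\<close>
lemma parabolic_symbol:
  assumes n: "3 \<le> n1" "3 \<le> n2" "3 \<le> n3"
    and det: "(1 - (cos (pi / real n1))\<^sup>2) * (1 - (cos (pi / real n3))\<^sup>2) = (cos (pi / real n2))\<^sup>2"
  shows "n1 = 4 \<and> n2 = 3 \<and> n3 = 4"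
proof -
  define u v w where "u = (cos (pi / real n1))\<^sup>2" and "v = (cos (pi / real n2))\<^sup>2" and "w = (cos (pi / real n3))\<^sup>2"
  have eq: "(1 - u) * (1 - w) = v" using det by (simp add: u_def v_def w_def)
  have u: "u = 1/4 \<and> n1 = 3 \<or> u = 1/2 \<and> n1 = 4 \<or> 5/8 < u \<and> u < 2/3 \<or> 3/4 \<le> u \<and> u < 1"
    using cos_sq_pi_div_cases[OF n(1)] by (auto simp: u_def)
  have v: "v = 1/4 \<and> n2 = 3 \<or> v = 1/2 \<and> n2 = 4 \<or> 5/8 < v \<and> v < 2/3 \<or> 3/4 \<le> v \<and> v < 1"
    using cos_sq_pi_div_cases[OF n(2)] by (auto simp: v_def)
  have w: "w = 1/4 \<and> n3 = 3 \<or> w = 1/2 \<and> n3 = 4 \<or> 5/8 < w \<and> w < 2/3 \<or> 3/4 \<le> w \<and> w < 1"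
    using cos_sq_pi_div_cases[OF n(3)] by (auto simp: w_def)
  consider "u = 1/4" | "u = 1/2" "n1 = 4" | "5/8 < u" "u < 2/3 \<or> 3/4 \<le> u"
    using u by auto
  then show ?thesis
  proof cases
    case 1
    then have "3 * w = 3 - 4 * v" using eq[unfolded 1] by (simp add: algebra_simps)
    then show ?thesis using v w by (elim disjE conjE) simp_all
  next
    case 2
    then have "w = 1 - 2 * v" using eq[unfolded 2(1)] by (simp add: algebra_simps)
    then show ?thesis using v w 2 by (elim disjE conjE) simp_all
  next
    case 3
    have w1: "w < 1" and v4: "1/4 \<le> v" using v w by auto
    have "(1 - u) * (1 - w) < 3/8 * (1 - w)"
      using 3 w1 by (intro mult_strict_right_mono) auto
    then have "v < 3/8 - 3/8 * w" unfolding eq by (simp add: algebra_simps)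
    then have "w < 1/3" using v4 by simp
    then have w4: "w = 1/4" using w by auto
    have "3 * u = 3 - 4 * v" using eq[unfolded w4] by (simp add: algebra_simps)
    then show ?thesis using v 3 by (elim disjE conjE) simp_all
  qed
qed

lemma dependent_of_many:
  fixes b :: "nat \<Rightarrow> 'v::euclidean_space"
  assumes "DIM('v) \<le> n"
  obtains a :: "nat \<Rightarrow> real" where "(\<Sum>i\<le>n. a i *\<^sub>R b i) = 0" "\<exists>i\<le>n. a i \<noteq> 0"
proof (cases "inj_on b {..n}")
  case True
  then have "card (b ` {..n}) = Suc n" by (simp add: card_image)
  then have "dependent (b ` {..n})" using assms by (intro dependent_biggerset) simp
  then obtain u where u: "\<exists>v\<in>b ` {..n}. u v \<noteq> 0" "(\<Sum>v\<in>b ` {..n}. u v *\<^sub>R v) = 0"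
    using real_vector.dependent_finite[of "b ` {..n}"] by auto
  show thesis
    by (rule that[of "u \<circ> b"]) (use u True in \<open>auto simp: sum.reindex\<close>)
next
  case False
  then obtain i j where ij: "i \<le> n" "j \<le> n" "i \<noteq> j" "b i = b j" by (auto simp: inj_on_def)
  define a :: "nat \<Rightarrow> real" where "a k = (if k = i then 1 else if k = j then - 1 else 0)" for k
  have "(\<Sum>k\<le>n. a k *\<^sub>R b k) = (\<Sum>k\<in>{i, j}. a k *\<^sub>R b k)"
    by (rule sum.mono_neutral_right) (use ij in \<open>auto simp: a_def\<close>)
  also have "\<dots> = 0" using ij by (simp add: a_def)
  finally show thesis by (rule that) (use ij in \<open>auto simp: a_def\<close>)
qed

lemma gram_simps:
  fixes b :: "nat \<Rightarrow> real \<times> 'a::euclidean_space"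
  assumes dim: "DIM('a) = 5" and b: "simply_truncated_orthoscheme m b"
  defines "k \<equiv> \<lambda>i. cos (pi / real (m ! i))"
  shows "\<And>i. i \<le> 6 \<Longrightarrow> lorentz (b i) (b i) = 1"
    "lorentz (b 0) (b 1) = - k 0" "lorentz (b 1) (b 0) = - k 0"
    "lorentz (b 1) (b 2) = - k 1" "lorentz (b 2) (b 1) = - k 1"
    "lorentz (b 2) (b 3) = - k 2" "lorentz (b 3) (b 2) = - k 2"
    "lorentz (b 3) (b 4) = - k 3" "lorentz (b 4) (b 3) = - k 3"
    "lorentz (b 4) (b 5) = - k 4" "lorentz (b 5) (b 4) = - k 4"
    "lorentz (b 5) (b 6) = - 1" "lorentz (b 6) (b 5) = - 1"
    "\<And>i j. i + 2 \<le> j \<Longrightarrow> j \<le> 6 \<Longrightarrow> lorentz (b i) (b j) = 0"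
    "\<And>i j. j + 2 \<le> i \<Longrightarrow> i \<le> 6 \<Longrightarrow> lorentz (b i) (b j) = 0"
proof -
  note b = b[unfolded simply_truncated_orthoscheme_def dim]
  have n: "lorentz (b i) (b (i + 1)) = - k i" if "i < 5" for i
    using b that by (simp add: k_def)
  have z: "lorentz (b i) (b j) = 0" if "i + 2 \<le> j" "j \<le> 6" for i j
    using b that by simp
  show "\<And>i. i \<le> 6 \<Longrightarrow> lorentz (b i) (b i) = 1"
    "\<And>i j. i + 2 \<le> j \<Longrightarrow> j \<le> 6 \<Longrightarrow> lorentz (b i) (b j) = 0"
    "\<And>i j. j + 2 \<le> i \<Longrightarrow> i \<le> 6 \<Longrightarrow> lorentz (b i) (b j) = 0"
    "lorentz (b 5) (b 6) = - 1"  "lorentz (b 6) (b 5) = - 1"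
    using b z by (simp_all add: lorentz_commute[of "b 6"]) (metis lorentz_commute z add_2_eq_Suc')
  show "lorentz (b 0) (b 1) = - k 0" "lorentz (b 1) (b 0) = - k 0"
    "lorentz (b 1) (b 2) = - k 1" "lorentz (b 2) (b 1) = - k 1"
    "lorentz (b 2) (b 3) = - k 2" "lorentz (b 3) (b 2) = - k 2"
    "lorentz (b 3) (b 4) = - k 3" "lorentz (b 4) (b 3) = - k 3"
    "lorentz (b 4) (b 5) = - k 4" "lorentz (b 5) (b 4) = - k 4"
    using n[of 0] n[of 1] n[of 2] n[of 3] n[of 4] by (simp_all add: lorentz_commute numeral_eq_Suc)
qed

text \<open>
  Seven vectors in dimension six are linearly dependent. The last rows of the Gram matrix show that
  in a relation \<open>b 4\<close> does not occur and \<open>b 5, b 6\<close> occur only through the null vector \<open>b 5 + b 6\<close>,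
  so that \<open>b 0, \<dots>, b 3\<close> have a singular Gram matrix; this forces the first three labels. The last
  two follow because \<open>b 1, \<dots>, b 5\<close> are orthogonal to a vertex that is not outer and so have a
  semidefinite Gram matrix.
\<close>
lemma symbol_unique:
  fixes b :: "nat \<Rightarrow> real \<times> 'a::euclidean_space"
  assumes dim: "DIM('a) = 5" and b: "simply_truncated_orthoscheme m b"
  shows "m = [4, 3, 4, 3, 3]"
proof -
  define k where "k i = cos (pi / real (m ! i))" for i
  note G = gram_simps[OF dim b, folded k_def]
  have len: "length m = 5" and m3: "\<And>i. i < 5 \<Longrightarrow> 3 \<le> m ! i"
    and vertex: "\<And>p. orthoscheme_vertex b 0 p \<Longrightarrow> \<not> outer_point p"
    using b unfolding simply_truncated_orthoscheme_def dim by auto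
  have kpos: "k i > 0" if "i < 5" for i using cos_pi_div_pos[OF m3[OF that]] by (simp add: k_def)
  note kp = kpos[of 0] kpos[of 1] kpos[of 2] kpos[of 3] kpos[of 4]
  define u where "u i = (k i)\<^sup>2" for i
  note ucases = cos_sq_pi_div_cases[OF m3, folded k_def, folded u_def]
  obtain a where a: "(\<Sum>i\<le>6. a i *\<^sub>R b i) = 0" "\<exists>i\<le>6. a i \<noteq> 0"
    by (rule dependent_of_many[of 6 b]) (simp_all add: dim)
  have row: "(\<Sum>i\<le>6. a i * lorentz (b i) (b j)) = 0" for j
    using arg_cong[OF a(1), of "\<lambda>x. lorentz x (b j)"] by (simp add: lorentz_sum_left)
  have at6: "{..6::nat} = {0, 1, 2, 3, 4, 5, 6}" by auto
  note R = row[unfolded at6]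
  have r0: "a 0 = k 0 * a 1" using R[of 0] by (simp add: G algebra_simps del: One_nat_def)
  have r1: "a 1 = k 0 * a 0 + k 1 * a 2" using R[of 1] by (simp add: G algebra_simps del: One_nat_def)
  have r2: "a 2 = k 1 * a 1 + k 2 * a 3" using R[of 2] by (simp add: G algebra_simps del: One_nat_def)
  have r3: "a 3 = k 2 * a 2 + k 3 * a 4" using R[of 3] by (simp add: G algebra_simps del: One_nat_def)
  have r4: "a 4 = k 3 * a 3 + k 4 * a 5" using R[of 4] by (simp add: G algebra_simps del: One_nat_def)
  have r5: "a 5 = k 4 * a 4 + a 6" using R[of 5] by (simp add: G algebra_simps del: One_nat_def)
  have r6: "a 6 = a 5" using R[of 6] by (simp add: G algebra_simps del: One_nat_def)
  have a4: "a 4 = 0" using r5 r6 kp by simp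
  have a2: "a 2 \<noteq> 0"
  proof
    assume "a 2 = 0"
    then have "a 3 = 0" using r3 a4 by simp
    moreover have "a 5 = 0" using r4 a4 \<open>a 3 = 0\<close> kp by simp
    moreover have "a 1 = 0" using r2 \<open>a 2 = 0\<close> \<open>a 3 = 0\<close> kp by simp
    ultimately have "a i = 0" if "i \<in> {0, 1, 2, 3, 4, 5, 6}" for i
      using that r0 r6 a4 \<open>a 2 = 0\<close> by auto
    then show False using a(2) at6 by blast
  qed
  have "(1 - u 0) * a 1 = k 1 * a 2" using r1 r0 by (simp add: u_def power2_eq_square algebra_simps)
  moreover have "(1 - u 2) * a 2 = k 1 * a 1" using r2 r3 a4 by (simp add: u_def power2_eq_square algebra_simps)
  ultimately have "(1 - u 0) * ((1 - u 2) * a 2) = k 1 * (k 1 * a 2)"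
    by (simp only: mult.left_commute[of "1 - u 0" "k 1"])
  then have "(1 - u 0) * (1 - u 2) * a 2 = u 1 * a 2"
    by (simp only: u_def power2_eq_square mult.assoc)
  then have det: "(1 - u 0) * (1 - u 2) = u 1" using a2 by simp
  have m02: "m ! 0 = 4 \<and> m ! 1 = 3 \<and> m ! 2 = 4"
    using det unfolding u_def k_def by (intro parabolic_symbol m3) auto
  then have k: "k 1 = 1/2" "u 2 = 1/2" by (simp_all add: k_def cos_60 u_def cos_45 power_divide)
  have u2: "k 2 * k 2 = 1/2" using k(2) by (simp add: u_def power2_eq_square)
  define S where "S = (\<lambda>j. (- fst (b j), snd (b j))) ` {1..5::nat}"
  have "dim S \<le> card S" by (intro dim_le_card') (simp add: S_def)
  also have "\<dots> \<le> 5" using card_image_le[of "{1..5::nat}"] by (simp add: S_def)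
  finally have "dim S < DIM(real \<times> 'a)" by (simp add: dim)
  then obtain p where p: "p \<noteq> 0" and p': "\<And>y. y \<in> span S \<Longrightarrow> orthogonal p y"
    by (rule orthogonal_to_subspace_exists) blast
  have p5: "lorentz p (b j) = 0" if "j \<in> {1..5}" for j
    using p'[OF span_base, of "(- fst (b j), snd (b j))"] that
    by (auto simp: S_def orthogonal_def inner_prod_def lorentz_def)
  have "orthoscheme_vertex b 0 p" using p p5 by (auto simp: orthoscheme_vertex_def dim)
  then have "lorentz p p \<le> 0" using vertex by (fastforce simp: outer_point_def)
  note psd = orthogonal_to_causal_spacelike[OF p this]
  have p5: "lorentz p (b 1) = 0" "lorentz p (b 2) = 0" "lorentz p (b 3) = 0" "lorentz p (b 4) = 0" "lorentz p (b 5) = 0"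
    using p5 by simp_all
  \<comment> \<open>Gram-Schmidt orthogonalization of \<open>b 1, b 2, \<dots>\<close>; each norm must be nonnegative.\<close>
  define e2 where "e2 = b 2 + (1/2) *\<^sub>R b 1"
  have e2: "lorentz e2 e2 = 3/4" "lorentz e2 (b 3) = - k 2" "lorentz (b 3) e2 = - k 2"
    "lorentz e2 (b 4) = 0" "lorentz (b 4) e2 = 0" "lorentz e2 (b 5) = 0" "lorentz p e2 = 0"
    by (simp_all add: e2_def G k(1) p5 del: One_nat_def)
  define e3 where "e3 = b 3 + (4/3 * k 2) *\<^sub>R e2"
  have e3: "lorentz e3 e3 = 1/3" "lorentz e3 (b 4) = - k 3" "lorentz (b 4) e3 = - k 3"
    "lorentz e3 (b 5) = 0" "lorentz p e3 = 0"
    using u2 by (simp_all add: e3_def G e2 p5)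
  define e4 where "e4 = b 4 + (3 * k 3) *\<^sub>R e3"
  have e4: "lorentz e4 e4 = 1 - 3 * u 3" "lorentz e4 (b 5) = - k 4" "lorentz (b 5) e4 = - k 4" "lorentz p e4 = 0"
    by (simp_all add: e4_def G e3 p5 u_def power2_eq_square lorentz_commute[of "b 5"])
  have "u 3 \<le> 1/3" using psd[OF e4(4)] e4(1) by simp
  then have m3': "m ! 3 = 3" "u 3 = 1/4" using ucases[of 3] by auto
  define e5 where "e5 = b 5 + (4 * k 4) *\<^sub>R e4"
  have "0 \<le> lorentz e5 e5" by (rule psd) (simp add: e5_def p5 e4)
  also have "lorentz e5 e5 = 1 - 8 * u 4 + 16 * u 4 * lorentz e4 e4"
    by (simp add: e5_def G e4(2,3) u_def power2_eq_square algebra_simps)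
  also have "\<dots> = 1 - 4 * u 4" using e4(1) m3'(2) by simp
  finally have "u 4 \<le> 1/4" by simp
  then have m4: "m ! 4 = 3" using ucases[of 4] by auto
  show ?thesis
    by (rule nth_equalityI) (use len m02 m3' m4 in \<open>auto simp: less_Suc_eq eval_nat_numeral\<close>)
qed

section \<open>Coordinates adapted to the cusp\<close>

type_synonym model_space = "real \<times> real \<times> real \<times> real \<times> real \<times> real"

text \<open>
  The seven normals in coordinates \<open>(T, w\<^sub>1, w\<^sub>2, w\<^sub>3, w\<^sub>4, z)\<close>. The vector
  \<open>b 5 + b 6 = (1/2, 0, 0, 0, 0, 1/2)\<close> is null and represents an ideal vertex; on a point of
  hyperbolic space \<open>T - z > 0\<close>, and \<open>x\<^sub>i = w\<^sub>i / (T - z)\<close> are the horospherical coordinates of the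
  upper half space with this vertex at infinity. There the facets other than \<open>b 4\<close> are vertical,
  over the prism \<open>0 \<le> x\<^sub>1 \<le> x\<^sub>2 \<le> x\<^sub>3 \<le> 1/2\<close>, \<open>0 \<le> x\<^sub>4 \<le> 1/2\<close>, and \<open>b 4\<close> is the unit hemisphere.
\<close>
definition model_normal :: "nat \<Rightarrow> model_space" where
  "model_normal i =
    [(0, -1, 0, 0, 0, 0), (0, 1 / sqrt 2, - 1 / sqrt 2, 0, 0, 0), (0, 0, 1 / sqrt 2, - 1 / sqrt 2, 0, 0),
     (1/2, 0, 0, 1, 0, 1/2), (0, 0, 0, 0, 0, -1), (1/2, 0, 0, 0, 1, 1/2), (0, 0, 0, 0, -1, 0)] ! i"

lemma model_normal_simps:
  "model_normal 0 = (0, -1, 0, 0, 0, 0)"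
  "model_normal 1 = (0, 1 / sqrt 2, - 1 / sqrt 2, 0, 0, 0)"
  "model_normal 2 = (0, 0, 1 / sqrt 2, - 1 / sqrt 2, 0, 0)"
  "model_normal 3 = (1/2, 0, 0, 1, 0, 1/2)"
  "model_normal 4 = (0, 0, 0, 0, 0, -1)"
  "model_normal 5 = (1/2, 0, 0, 0, 1, 1/2)"
  "model_normal 6 = (0, 0, 0, 0, -1, 0)"
  by (simp_all add: model_normal_def)

lemma all_le_6: "(\<forall>i\<le>6. P i) \<longleftrightarrow> P 0 \<and> P 1 \<and> P 2 \<and> P 3 \<and> P 4 \<and> P 5 \<and> P (6::nat)"
proof -
  have "(\<forall>i\<le>6. P i) \<longleftrightarrow> (\<forall>i\<in>{..6}. P i)" unfolding Ball_def atMost_iff by (rule refl)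
  also have "{..6::nat} = {0, 1, 2, 3, 4, 5, 6}" by auto
  finally show ?thesis by simp
qed

lemma lorentz_tuple:
  "lorentz (T, w1, w2, w3, w4, z) (T', w1', w2', w3', w4', z') =
    - (T * T') + (w1 * w1' + w2 * w2' + w3 * w3' + w4 * w4' + z * z' :: real)"
  by (simp add: lorentz_def inner_prod_def)

text \<open>
  For a point of the hyperboloid, \<open>s > 0\<close> is the hyperbolic sine of a radius such that the ball of
  this radius lies in the polytope; for \<open>s = 0\<close> the conditions describe the polytope itself.
\<close>
lemma model_constraints:
  "(\<forall>i\<le>6. s \<le> - lorentz (T, w1, w2, w3, w4, z) (model_normal i)) \<longleftrightarrow>
    s \<le> w1 \<and> sqrt 2 * s \<le> w2 - w1 \<and> sqrt 2 * s \<le> w3 - w2 \<and> s \<le> (T - z) / 2 - w3 \<and>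
    s \<le> z \<and> s \<le> (T - z) / 2 - w4 \<and> s \<le> w4"
  unfolding all_le_6 model_normal_simps lorentz_tuple
  by (simp add: field_simps) (auto simp: field_simps)

lemma bij_of_lorentz_isometry:
  fixes f :: "real \<times> 'a::euclidean_space \<Rightarrow> real \<times> 'b::euclidean_space"
  assumes "DIM('a) = DIM('b)" and f: "linear f" "\<And>x y. lorentz (f x) (f y) = lorentz x y"
  shows "bij f"
proof -
  have "x = 0" if "f x = 0" for x
    by (rule lorentz_nondegenerate) (metis f(2) that lorentz_simps(9))
  then have inj: "inj f" using f(1) by (simp add: linear_injective_0)
  have "dim (range f) = DIM(real \<times> 'b)"
    using dim_image_eq[of f UNIV] f(1) inj assms(1) by simp
  then have "span (range f) = UNIV" by (simp only: dim_eq_full)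
  moreover have "span (range f) = range f"
    using f(1) by (simp add: linear_subspace_image span_eq_iff)
  ultimately show ?thesis using inj by (simp add: bij_def)
qed

lemma future_iff_null:
  assumes q: "lorentz q q < 0" and m: "lorentz m m = 0" "m \<noteq> 0" "fst m > 0"
  shows "fst q > 0 \<longleftrightarrow> lorentz q m < 0"
proof (cases "fst q > 0")
  case True
  then show ?thesis using lorentz_neg_of_future[of q m] q m by simp
next
  case False
  have "fst q \<noteq> 0" using norm_snd_less_of_timelike[OF q] by auto
  then have "fst (- q) > 0" using False by simp
  then have "lorentz (- q) m < 0" using lorentz_neg_of_future[of "- q" m] q m by simp
  then show ?thesis using False by simp
qed

text \<open>
  The normals \<open>b 0, \<dots>, b 4, b 6\<close> yield an orthonormal basis by the same linear combinations as in
  the model, and \<open>b 5\<close> is determined by its inner products. Since the normals are outward, interior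
  points have negative product with the null vector \<open>b 5 + b 6\<close>, which therefore is future in both;
  this fixes the time orientation.
\<close>
lemma orthoscheme_coordinates:
  fixes b :: "nat \<Rightarrow> real \<times> 'a::euclidean_space"
  assumes dim: "DIM('a) = 5" and b: "simply_truncated_orthoscheme [4, 3, 4, 3, 3] b"
  obtains f :: "model_space \<Rightarrow> real \<times> 'a" where
    "linear f" "\<And>x y. lorentz (f x) (f y) = lorentz x y"
    "\<And>i. i \<le> 6 \<Longrightarrow> f (model_normal i) = b i"
    "\<And>p. lorentz p p < 0 \<Longrightarrow> fst (f p) > 0 \<longleftrightarrow> fst p > 0"
proof -
  define r where "r = sqrt (2 :: real)"
  have rr: "r * r = 2" "r * (r * x) = 2 * x" for x by (simp_all add: r_def flip: mult.assoc)
  have nths: "[4, 3, 4, 3, 3::nat] ! 0 = 4" "[4, 3, 4, 3, 3::nat] ! 1 = 3" "[4, 3, 4, 3, 3::nat] ! 2 = 4"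
    "[4, 3, 4, 3, 3::nat] ! 3 = 3" "[4, 3, 4, 3, 3::nat] ! 4 = 3" by simp_all
  have cs: "cos (pi / real 4) = r / 2" "cos (pi / real 3) = 1 / 2"
    by (simp_all add: cos_45 cos_60 r_def)
  note G = gram_simps[OF dim b, unfolded nths cs]
  define f1 where "f1 = - b 0"
  have g1: "lorentz f1 f1 = 1" "lorentz f1 (b 1) = r / 2" "lorentz (b 1) f1 = r / 2"
    "\<And>j. 2 \<le> j \<Longrightarrow> j \<le> 6 \<Longrightarrow> lorentz f1 (b j) = 0" "\<And>j. 2 \<le> j \<Longrightarrow> j \<le> 6 \<Longrightarrow> lorentz (b j) f1 = 0"
    by (simp_all add: f1_def G del: One_nat_def)
  define f2 where "f2 = f1 - r *\<^sub>R b 1"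
  have g2: "lorentz f2 f2 = 1" "lorentz f2 f1 = 0" "lorentz f1 f2 = 0"
    "lorentz f2 (b 2) = r / 2" "lorentz (b 2) f2 = r / 2"
    "\<And>j. 3 \<le> j \<Longrightarrow> j \<le> 6 \<Longrightarrow> lorentz f2 (b j) = 0" "\<And>j. 3 \<le> j \<Longrightarrow> j \<le> 6 \<Longrightarrow> lorentz (b j) f2 = 0"
    by (simp_all add: f2_def G g1 rr algebra_simps del: One_nat_def)
  define f3 where "f3 = f2 - r *\<^sub>R b 2"
  have g3: "lorentz f3 f3 = 1" "lorentz f3 f1 = 0" "lorentz f1 f3 = 0" "lorentz f3 f2 = 0" "lorentz f2 f3 = 0"
    "lorentz f3 (b 3) = 1" "lorentz (b 3) f3 = 1"
    "\<And>j. 4 \<le> j \<Longrightarrow> j \<le> 6 \<Longrightarrow> lorentz f3 (b j) = 0" "\<And>j. 4 \<le> j \<Longrightarrow> j \<le> 6 \<Longrightarrow> lorentz (b j) f3 = 0"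
    by (simp_all add: f3_def G g1 g2 rr algebra_simps)
  define f4 where "f4 = - b 6"
  define fz where "fz = - b 4"
  define fT where "fT = 2 *\<^sub>R b 3 - 2 *\<^sub>R f3 - fz"
  have g4: "lorentz f4 f4 = 1" "lorentz f4 f1 = 0" "lorentz f1 f4 = 0" "lorentz f4 f2 = 0" "lorentz f2 f4 = 0"
    "lorentz f4 f3 = 0" "lorentz f3 f4 = 0"
    "lorentz fz fz = 1" "lorentz fz f1 = 0" "lorentz f1 fz = 0" "lorentz fz f2 = 0" "lorentz f2 fz = 0"
    "lorentz fz f3 = 0" "lorentz f3 fz = 0" "lorentz fz f4 = 0" "lorentz f4 fz = 0"
    by (simp_all add: f4_def fz_def G g1 g2 g3)
  have gT: "lorentz fT fT = -1" "lorentz fT f1 = 0" "lorentz f1 fT = 0" "lorentz fT f2 = 0" "lorentz f2 fT = 0"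
    "lorentz fT f3 = 0" "lorentz f3 fT = 0" "lorentz fT f4 = 0" "lorentz f4 fT = 0" "lorentz fT fz = 0" "lorentz fz fT = 0"
    by (simp_all add: fT_def f4_def fz_def G g1 g2 g3)
  have g5: "lorentz (b 5) f1 = 0" "lorentz (b 5) f2 = 0" "lorentz (b 5) f3 = 0" "lorentz (b 5) f4 = 1"
    "lorentz (b 5) fz = 1/2" "lorentz (b 5) fT = - 1/2"
    by (simp_all add: fT_def f4_def fz_def G g1 g2 g3)
  define f where "f = (\<lambda>(T, w1, w2, w3, w4, z). T *\<^sub>R fT + w1 *\<^sub>R f1 + w2 *\<^sub>R f2 + w3 *\<^sub>R f3 + w4 *\<^sub>R f4 + z *\<^sub>R fz)"
  have lin: "linear f"
    by (rule linearI) (auto simp: f_def scaleR_add_left scaleR_add_right split: prod.splits)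
  have iso: "lorentz (f x) (f y) = lorentz x y" for x y
    by (cases x; cases y) (simp add: f_def g1 g2 g3 g4 gT lorentz_tuple algebra_simps)
  have "bij f" by (rule bij_of_lorentz_isometry) (simp_all add: dim lin iso)
  have "b 5 - f (model_normal 5) = 0"
  proof (rule lorentz_nondegenerate)
    fix y
    obtain T w1 w2 w3 w4 z where y: "y = f (T, w1, w2, w3, w4, z)"
      using bij_is_surj[OF \<open>bij f\<close>] by (metis surjD prod.exhaust)
    have "lorentz (b 5) y = - T / 2 + w4 + z / 2"
      by (simp add: y f_def g5)
    moreover have "lorentz (f (model_normal 5)) y = - T / 2 + w4 + z / 2"
      by (simp add: y iso model_normal_simps lorentz_tuple)
    ultimately show "lorentz (b 5 - f (model_normal 5)) y = 0" by simp
  qed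
  then have b5: "f (model_normal 5) = b 5" by simp
  have half: "1 / sqrt 2 = r / 2" by (simp add: r_def real_div_sqrt field_simps)
  have bf: "\<forall>i\<le>6. f (model_normal i) = b i"
    unfolding all_le_6 b5
    unfolding model_normal_simps half f_def
    by (simp add: f1_def f2_def f3_def f4_def fz_def fT_def scaleR_diff_right rr half del: One_nat_def)
       (simp add: algebra_simps rr)
  obtain y where y: "y \<in> hyp_space" "\<forall>i\<le>6. lorentz (1, y) (b i) < 0"
    using b unfolding simply_truncated_orthoscheme_def dim by auto
  define n :: "model_space" where "n = model_normal 5 + model_normal 6"
  have n: "n = (1/2, 0, 0, 0, 0, 1/2)" by (simp add: n_def model_normal_simps)
  have nn: "lorentz n n = 0" "fst n > 0" "n \<noteq> 0" by (simp_all add: n lorentz_tuple zero_prod_def)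
  have fn: "f n = b 5 + b 6" using bf by (simp add: n_def linear_add[OF lin])
  have fnn: "lorentz (f n) (f n) = 0" "f n \<noteq> 0"
    using nn bij_is_inj[OF \<open>bij f\<close>] linear_0[OF lin] by (simp add: iso, metis injD)
  have "lorentz (1, y) (1, y) < 0" using y(1) by (simp add: lorentz_self hyp_space_iff)
  moreover have "lorentz (1, y) (f n) < 0" using y(2) by (auto simp: fn add_neg_neg)
  ultimately have pos: "fst (f n) > 0"
    using lorentz_neg_of_future[of "(1, y)" "f n"] fnn by simp
  have time: "fst (f p) > 0 \<longleftrightarrow> fst p > 0" if "lorentz p p < 0" for p
  proof -
    have "fst (f p) > 0 \<longleftrightarrow> lorentz (f p) (f n) < 0"
      using that fnn pos by (intro future_iff_null) (simp_all add: iso)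
    also have "\<dots> \<longleftrightarrow> fst p > 0"
      using that nn by (subst iso, intro future_iff_null[symmetric]) simp_all
    finally show ?thesis .
  qed
  show thesis by (rule that[of f]) (use lin iso bf time in auto)
qed

section \<open>The inball\<close>

text \<open>
  The value of \<open>s\<close> for which all inequalities in the estimate of the inradius below are equalities.
\<close>
definition sinh_inradius :: real where
  "sinh_inradius = 1 / sqrt (34 + 30 * sqrt 2)"

definition model_incenter :: "model_space" where
  "model_incenter = sinh_inradius *\<^sub>R
    (5 + 4 * sqrt 2, 1, 1 + sqrt 2, 1 + 2 * sqrt 2, 1 + 2 * sqrt 2, 1)"

lemma sinh_inradius: "sinh_inradius > 0" "sinh_inradius\<^sup>2 * (34 + 30 * sqrt 2) = 1"
proof -
  have "34 + 30 * sqrt 2 > 0" by (simp add: add_pos_pos)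
  then show "sinh_inradius > 0" "sinh_inradius\<^sup>2 * (34 + 30 * sqrt 2) = 1"
    by (simp_all add: sinh_inradius_def power_divide)
qed

lemma model_incenter:
  "lorentz model_incenter model_incenter = -1" "fst model_incenter > 0"
  "\<forall>i\<le>6. sinh_inradius \<le> - lorentz model_incenter (model_normal i)"
proof -
  let ?s = sinh_inradius and ?v = "(5 + 4 * sqrt 2, 1, 1 + sqrt 2, 1 + 2 * sqrt 2, 1 + 2 * sqrt 2, 1)
    :: model_space"
  have "lorentz ?v ?v = - (34 + 30 * sqrt 2)"
    by (simp add: lorentz_tuple algebra_simps)
  then have "lorentz model_incenter model_incenter = - (?s\<^sup>2 * (34 + 30 * sqrt 2))"
    unfolding model_incenter_def lorentz_simps by (simp only: power2_eq_square mult.assoc mult_minus_right)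
  then show "lorentz model_incenter model_incenter = -1" by (simp add: sinh_inradius)
  show "fst model_incenter > 0" by (simp add: model_incenter_def sinh_inradius add_pos_pos)
  show "\<forall>i\<le>6. ?s \<le> - lorentz model_incenter (model_normal i)"
    unfolding model_incenter_def scaleR_Pair model_constraints
    using sinh_inradius(1) by (simp add: algebra_simps)
qed

text \<open>
  With \<open>h = T - z\<close>, the constraints bound each \<open>w\<^sub>i\<close> above by \<open>v\<^sub>i\<close> and \<open>z\<close> below by \<open>s\<close>, and they
  give \<open>h \<ge> 4 (1 + \<surd>2) s\<close>; hence \<open>1 = h\<^sup>2 + 2 h z - |w|\<^sup>2 \<ge> s\<^sup>2 (34 + 30 \<surd>2)\<close>. In the case of
  equality every coordinate is determined, which makes the incenter unique. It touches all facets
  but \<open>b 6\<close>.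
\<close>
lemma model_inradius:
  assumes p: "lorentz p p = -1" and s: "s > 0" "\<forall>i\<le>6. s \<le> - lorentz p (model_normal i)"
  shows "s \<le> sinh_inradius" "s = sinh_inradius \<Longrightarrow> p = model_incenter"
proof -
  obtain T w1 w2 w3 w4 z where pt: "p = (T, w1, w2, w3, w4, z)" by (cases p)
  define r where "r = sqrt (2::real)"
  have r: "r > 0" "r * r = 2" by (simp_all add: r_def)
  define h where "h = T - z"
  define v4 v3 v2 v1 where "v4 = h / 2 - s" and "v3 = h / 2 - s" and "v2 = h / 2 - (1 + r) * s"
    and "v1 = h / 2 - (1 + 2 * r) * s"
  have c: "s \<le> w1" "r * s \<le> w2 - w1" "r * s \<le> w3 - w2" "s \<le> h / 2 - w3" "s \<le> z" "s \<le> h / 2 - w4" "s \<le> w4"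
    using s(2) unfolding pt model_constraints r_def h_def by auto
  have rs: "r * s > 0" using r s by simp
  have w: "0 < w1" "0 < w2" "0 < w3" "0 < w4" "w1 \<le> v1" "w2 \<le> v2" "w3 \<le> v3" "w4 \<le> v4"
    using c rs s(1) by (auto simp: v1_def v2_def v3_def v4_def algebra_simps)
  have h: "4 * (1 + r) * s \<le> h" using c by (simp add: algebra_simps)
  have h0: "h > 0" using h s(1) r by (smt (verit) mult_pos_pos)
  have sq: "0 \<le> v1\<^sup>2 - w1\<^sup>2" "0 \<le> v2\<^sup>2 - w2\<^sup>2" "0 \<le> v3\<^sup>2 - w3\<^sup>2" "0 \<le> v4\<^sup>2 - w4\<^sup>2"
    using w by (simp_all add: power_mono)
  have e: "0 \<le> 2 * h * (z - s)" "0 \<le> (6 + 3 * r) * s * (h - 4 * (1 + r) * s)"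
    using h0 c h s(1) r by simp_all
  have "1 = h\<^sup>2 + 2 * h * z - w1\<^sup>2 - w2\<^sup>2 - w3\<^sup>2 - w4\<^sup>2"
    using p unfolding pt lorentz_tuple h_def by (simp add: power2_eq_square algebra_simps)
  moreover have "h\<^sup>2 + 2 * h * s - v1\<^sup>2 - v2\<^sup>2 - v3\<^sup>2 - v4\<^sup>2
      = (6 + 3 * r) * s * (h - 4 * (1 + r) * s) + s\<^sup>2 * (34 + 30 * r)"
    unfolding v1_def v2_def v3_def v4_def using r(2) by (simp add: power2_eq_square field_simps)
  ultimately have main: "1 - s\<^sup>2 * (34 + 30 * r) = 2 * h * (z - s) + (6 + 3 * r) * s * (h - 4 * (1 + r) * s)
      + (v1\<^sup>2 - w1\<^sup>2) + (v2\<^sup>2 - w2\<^sup>2) + (v3\<^sup>2 - w3\<^sup>2) + (v4\<^sup>2 - w4\<^sup>2)"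
    by (simp add: algebra_simps)
  then have "s\<^sup>2 * (34 + 30 * r) \<le> sinh_inradius\<^sup>2 * (34 + 30 * r)"
    using sq e sinh_inradius(2) unfolding r_def by linarith
  then have "s\<^sup>2 \<le> sinh_inradius\<^sup>2" using r by (simp add: add_pos_pos)
  then show "s \<le> sinh_inradius" by (rule power2_le_imp_le) (use sinh_inradius(1) in simp)
  have zeros: "a = 0 \<and> b = 0 \<and> c = 0 \<and> d = 0 \<and> e = 0 \<and> g = 0"
    if "a + b + c + d + e + g = 0" "0 \<le> a" "0 \<le> b" "0 \<le> c" "0 \<le> d" "0 \<le> e" "0 \<le> g" for a b c d e g :: real
    using that by linarith
  show "p = model_incenter" if eq: "s = sinh_inradius"
  proof -
    have "1 - s\<^sup>2 * (34 + 30 * r) = 0" using sinh_inradius(2) by (simp add: eq r_def)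
    then have "2 * h * (z - s) + (6 + 3 * r) * s * (h - 4 * (1 + r) * s)
      + (v1\<^sup>2 - w1\<^sup>2) + (v2\<^sup>2 - w2\<^sup>2) + (v3\<^sup>2 - w3\<^sup>2) + (v4\<^sup>2 - w4\<^sup>2) = 0"
      unfolding main .
    then have 0: "2 * h * (z - s) = 0" "(6 + 3 * r) * s * (h - 4 * (1 + r) * s) = 0"
      "v1\<^sup>2 - w1\<^sup>2 = 0" "v2\<^sup>2 - w2\<^sup>2 = 0" "v3\<^sup>2 - w3\<^sup>2 = 0" "v4\<^sup>2 - w4\<^sup>2 = 0"
      using zeros[OF _ e sq] by blast+
    have z: "z = s" "h = 4 * (1 + r) * s" using 0(1,2) h0 s(1) r(1) by simp_all
    have "w1 = v1" "w2 = v2" "w3 = v3" "w4 = v4"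
      using 0(3-6) w by (auto intro!: power2_eq_imp_eq[symmetric])
    then have "T = s * (5 + 4 * r)" "w1 = s" "w2 = s * (1 + r)" "w3 = s * (1 + 2 * r)" "w4 = s * (1 + 2 * r)"
      using z by (simp_all add: h_def v1_def v2_def v3_def v4_def algebra_simps)
    then show ?thesis using z(1) by (simp add: pt model_incenter_def r_def eq)
  qed
qed

lemma inball_of_orthoscheme:
  fixes b :: "nat \<Rightarrow> real \<times> 'a::euclidean_space"
  assumes dim: "DIM('a) = 5" and b: "simply_truncated_orthoscheme [4, 3, 4, 3, 3] b"
  obtains c where "contained_ball b c (arsinh sinh_inradius)"
    "\<And>c' r'. contained_ball b c' r' \<Longrightarrow> r' \<le> arsinh sinh_inradius"
    "\<And>c'. contained_ball b c' (arsinh sinh_inradius) \<Longrightarrow> c' = c"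
proof -
  obtain f :: "model_space \<Rightarrow> real \<times> 'a" where
    f: "linear f" "\<And>x y. lorentz (f x) (f y) = lorentz x y"
      "\<And>i. i \<le> 6 \<Longrightarrow> f (model_normal i) = b i"
      "\<And>p. lorentz p p < 0 \<Longrightarrow> fst (f p) > 0 \<longleftrightarrow> fst p > 0"
    using orthoscheme_coordinates[OF dim b] by metis
  have "bij f" by (rule bij_of_lorentz_isometry) (simp_all add: dim f)
  have norm1: "\<forall>i \<le> DIM('a) + 1. lorentz (b i) (b i) = 1"
    using b by (simp add: simply_truncated_orthoscheme_def)
  note cb = contained_ball_iff[OF norm1, unfolded dim, simplified]
  define F where "F = f model_incenter"
  have F: "lorentz F F = -1" "fst F > 0" using f model_incenter by (simp_all add: F_def)
  define c where "c = snd F /\<^sub>R fst F"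
  have hc: "hyperboloid_point c = F" unfolding c_def by (rule hyperboloid_pointI) (rule F)+
  have "c \<in> hyp_space" unfolding c_def by (rule timelike_in_hyp_space) (simp add: F)
  moreover have "sinh_inradius \<le> - lorentz F (b i)" if "i \<le> 6" for i
    using model_incenter(3) that by (metis F_def f(2,3))
  ultimately have 1: "contained_ball b c (arsinh sinh_inradius)"
    using sinh_inradius(1) by (simp add: cb hc)
  have *: "r' \<le> arsinh sinh_inradius \<and> (r' = arsinh sinh_inradius \<longrightarrow> c' = c)"
    if "contained_ball b c' r'" for c' r'
  proof -
    have h: "c' \<in> hyp_space" "0 < r'" "\<forall>i\<le>6. sinh r' \<le> - lorentz (hyperboloid_point c') (b i)"
      using that by (auto simp: cb)
    obtain p where p: "f p = hyperboloid_point c'"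
      using bij_is_surj[OF \<open>bij f\<close>] by (metis surjD)
    have pp: "lorentz p p = -1" using lorentz_hyperboloid_point(1)[OF h(1)] by (simp add: f flip: p)
    have con: "\<forall>i\<le>6. sinh r' \<le> - lorentz p (model_normal i)"
      using h(3) unfolding p[symmetric] by (metis f(2,3))
    have "sinh r' > 0" using h(2) by simp
    note R = model_inradius[OF pp this con]
    have "r' \<le> arsinh sinh_inradius"
      using R(1) by (metis sinh_arsinh_real sinh_real_le_iff)
    moreover have "c' = c" if "r' = arsinh sinh_inradius"
    proof -
      have "p = model_incenter" using R(2) that by simp
      then have "hyperboloid_point c' = hyperboloid_point c" using p by (simp add: hc F_def)
      then show ?thesis using h(1) \<open>c \<in> hyp_space\<close> by (rule hyperboloid_point_inj)
    qed
    ultimately show ?thesis by simp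
  qed
  show thesis by (rule that[OF 1]) (use * in blast)+
qed

lemma orthoscheme_exists:
  assumes dim: "DIM('a::euclidean_space) = 5"
  shows "\<exists>b :: nat \<Rightarrow> real \<times> 'a. simply_truncated_orthoscheme [4, 3, 4, 3, 3] b"
proof -
  obtain g :: "real \<times> real \<times> real \<times> real \<times> real \<Rightarrow> 'a" and g' where
    g: "linear g" "linear g'" "\<And>x y. g x \<bullet> g y = x \<bullet> y" "\<And>x. g' (g x) = x" "\<And>y. g (g' y) = y"
    by (rule euclidean_isometry_exists[where 'a="real \<times> real \<times> real \<times> real \<times> real" and 'b='a])
      (simp_all add: dim)
  define f where "f p = (fst p, g (snd p))" for p :: "model_space"
  have f: "lorentz (f x) (f y) = lorentz x y" for x y by (simp add: f_def lorentz_def g)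
  define b where "b i = f (model_normal i)" for i
  have vertex: "\<not> outer_point p" if "orthoscheme_vertex b 0 p" for p
  proof -
    obtain T w1 w2 w3 w4 z where p: "p = f (T, w1, w2, w3, w4, z)"
    proof -
      have "p = f (fst p, g' (snd p))" by (simp add: f_def g)
      then show thesis using that by (metis prod.exhaust)
    qed
    have "\<forall>j\<le>5. j \<noteq> 0 \<longrightarrow> lorentz (T, w1, w2, w3, w4, z) (model_normal j) = 0"
      using that by (simp add: orthoscheme_vertex_def dim b_def f p)
    then have "lorentz (T, w1, w2, w3, w4, z) (model_normal j) = 0" if "j \<in> {1,2,3,4,5}" for j
      using that by auto
    from this[of 1] this[of 2] this[of 3] this[of 4] this[of 5]
    have "w1 = T / 2" "w2 = T / 2" "w3 = T / 2" "z = 0" "w4 = T / 2"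
      unfolding model_normal_simps lorentz_tuple by (auto simp: field_simps)
    then have "lorentz p p = 0" by (simp only: p f lorentz_tuple)
    then show ?thesis by (simp add: outer_point_def)
  qed
  define P where "P = f model_incenter"
  have P: "lorentz P P = -1" "fst P > 0" using model_incenter by (simp_all add: P_def f) (simp add: f_def)
  define y where "y = snd P /\<^sub>R fst P"
  have y: "y \<in> hyp_space" unfolding y_def by (rule timelike_in_hyp_space) (simp add: P)
  have Py: "P = fst P *\<^sub>R (1, y)" using P(2) by (simp add: y_def prod_eq_iff)
  have neg: "lorentz (1, y) (b i) < 0" if "i \<le> 6" for i
  proof -
    have "sinh_inradius \<le> - lorentz P (b i)"
      using model_incenter(3) that by (simp add: P_def b_def f)
    then have "lorentz P (b i) < 0" using sinh_inradius(1) by simp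
    also have "lorentz P (b i) = fst P * lorentz (1, y) (b i)"
      by (subst Py) (simp only: lorentz_simps)
    finally show ?thesis using P(2) by (simp add: mult_less_0_iff)
  qed
  have unit: "\<forall>i\<le>6. lorentz (b i) (b i) = 1"
    unfolding all_le_6 b_def f model_normal_simps lorentz_tuple by simp
  have r: "1 / sqrt 2 = sqrt 2 / (2::real)" by (simp add: field_simps)
  have adj: "lorentz (b 0) (b 1) = - cos (pi / 4)" "lorentz (b 1) (b 2) = - cos (pi / 3)"
    "lorentz (b 2) (b 3) = - cos (pi / 4)" "lorentz (b 3) (b 4) = - cos (pi / 3)"
    "lorentz (b 4) (b 5) = - cos (pi / 3)" "lorentz (b 5) (b 6) = -1"
    unfolding b_def f model_normal_simps lorentz_tuple cos_45 cos_60 by (simp_all add: r)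
  have adj': "lorentz (b i) (b (i + 1)) = - cos (pi / real ([4, 3, 4, 3, 3] ! i))" if "i < 5" for i
  proof -
    have "i \<in> {0, 1, 2, 3, 4}" using that by auto
    then show ?thesis using adj[unfolded One_nat_def] by (auto simp flip: numeral_2_eq_2)
  qed
  have orth: "\<forall>j\<le>6. \<forall>i\<le>6. i + 2 \<le> j \<longrightarrow> lorentz (b i) (b j) = 0"
    unfolding all_le_6 b_def f model_normal_simps lorentz_tuple by simp
  have "simply_truncated_orthoscheme [4, 3, 4, 3, 3] b"
    unfolding simply_truncated_orthoscheme_def dim
  proof (intro conjI)
    show "\<forall>i<5. 3 \<le> [4, 3, 4, 3, 3::nat] ! i" by (simp add: All_less_Suc numeral_eq_Suc)
    show "\<exists>y\<in>hyp_space. \<forall>i\<le>5 + 1. lorentz (1, y) (b i) < 0" using y neg by auto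
    show "\<forall>i j. i + 2 \<le> j \<and> j \<le> 5 + 1 \<longrightarrow> lorentz (b i) (b j) = 0" using orth by auto
    show "\<forall>p. orthoscheme_vertex b 0 p \<longrightarrow> \<not> outer_point p" using vertex by blast
  qed (use unit adj adj' in simp_all)
  then show ?thesis by blast
qed

section \<open>The volume of the truncated orthoscheme as an integral over a cube\<close>

abbreviation nn_integral4 :: "real measure \<Rightarrow> (real \<Rightarrow> real \<Rightarrow> real \<Rightarrow> real \<Rightarrow> ennreal) \<Rightarrow> ennreal" where
  "nn_integral4 N f \<equiv> (\<integral>\<^sup>+x. \<integral>\<^sup>+y. \<integral>\<^sup>+z. \<integral>\<^sup>+w. f x y z w \<partial>N \<partial>N \<partial>N \<partial>N)"

lemma nn_integral_lborel_pair:
  fixes f :: "'a::euclidean_space \<times> 'b::euclidean_space \<Rightarrow> ennreal"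
  assumes [measurable]: "f \<in> borel_measurable borel"
  shows "(\<integral>\<^sup>+p. f p \<partial>lborel) = (\<integral>\<^sup>+x. \<integral>\<^sup>+y. f (x, y) \<partial>lborel \<partial>lborel)"
proof -
  have "f \<in> borel_measurable (lborel \<Otimes>\<^sub>M lborel)" by (simp add: lborel_prod)
  from lborel.nn_integral_fst[OF this] show ?thesis by (simp add: lborel_prod)
qed

lemma nn_integral_lborel_tuple:
  fixes f :: "real \<times> real \<times> real \<times> real \<times> real \<Rightarrow> ennreal"
  assumes [measurable]: "f \<in> borel_measurable borel"
  shows "(\<integral>\<^sup>+p. f p \<partial>lborel) = (\<integral>\<^sup>+x1. \<integral>\<^sup>+x2. \<integral>\<^sup>+x3. \<integral>\<^sup>+x4. \<integral>\<^sup>+y. f (x1, x2, x3, x4, y) \<partial>lborel \<partial>lborel \<partial>lborel \<partial>lborel \<partial>lborel)"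
proof -
  have "(\<integral>\<^sup>+p. f p \<partial>lborel) = (\<integral>\<^sup>+x1. \<integral>\<^sup>+p. f (x1, p) \<partial>lborel \<partial>lborel)"
    by (rule nn_integral_lborel_pair) measurable
  also have "\<dots> = (\<integral>\<^sup>+x1. \<integral>\<^sup>+x2. \<integral>\<^sup>+p. f (x1, x2, p) \<partial>lborel \<partial>lborel \<partial>lborel)"
    by (intro nn_integral_cong nn_integral_lborel_pair) measurable
  also have "\<dots> = (\<integral>\<^sup>+x1. \<integral>\<^sup>+x2. \<integral>\<^sup>+x3. \<integral>\<^sup>+p. f (x1, x2, x3, p) \<partial>lborel \<partial>lborel \<partial>lborel \<partial>lborel)"
    by (intro nn_integral_cong nn_integral_lborel_pair) measurable
  also have "\<dots> = (\<integral>\<^sup>+x1. \<integral>\<^sup>+x2. \<integral>\<^sup>+x3. \<integral>\<^sup>+x4. \<integral>\<^sup>+y. f (x1, x2, x3, x4, y) \<partial>lborel \<partial>lborel \<partial>lborel \<partial>lborel \<partial>lborel)"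
    by (intro nn_integral_cong nn_integral_lborel_pair) measurable
  finally show ?thesis .
qed

lemma borel_measurable_fst_comp [measurable (raw)]:
  fixes f :: "'c \<Rightarrow> 'a::second_countable_topology \<times> 'b::second_countable_topology"
  assumes "f \<in> borel_measurable M"
  shows "(\<lambda>x. fst (f x)) \<in> borel_measurable M"
  using assms by (rule measurable_compose) (intro borel_measurable_continuous_onI continuous_intros)

lemma borel_measurable_snd_comp [measurable (raw)]:
  fixes f :: "'c \<Rightarrow> 'a::second_countable_topology \<times> 'b::second_countable_topology"
  assumes "f \<in> borel_measurable M"
  shows "(\<lambda>x. snd (f x)) \<in> borel_measurable M"
  using assms by (rule measurable_compose) (intro borel_measurable_continuous_onI continuous_intros)

text \<open>
  Each fibre over the second factor is translated.
\<close>
lemma emeasure_lborel_shear: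
  fixes M :: "(real \<times> 'a::euclidean_space) set" and g :: "'a \<Rightarrow> real"
  assumes [measurable]: "M \<in> sets borel" "g \<in> borel_measurable borel"
  shows "emeasure lborel {p. (fst p + g (snd p), snd p) \<in> M} = emeasure lborel M"
proof -
  let ?N = "{p. (fst p + g (snd p), snd p) \<in> M}"
  have M[measurable]: "M \<in> sets (borel \<Otimes>\<^sub>M borel)" using assms(1) unfolding borel_prod .
  have "{p \<in> space (borel \<Otimes>\<^sub>M borel). (fst p + g (snd p), snd p) \<in> M} \<in> sets (borel \<Otimes>\<^sub>M borel)"
    by measurable
  then have N[measurable]: "?N \<in> sets (borel \<Otimes>\<^sub>M borel)" by (simp add: space_pair_measure)
  have "emeasure lborel ?N = (\<integral>\<^sup>+y. emeasure lborel ((\<lambda>x. (x, y)) -` ?N) \<partial>lborel)"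
    by (subst lborel_prod[symmetric], rule lborel_pair.emeasure_pair_measure_alt2) simp
  also have "\<dots> = (\<integral>\<^sup>+y. emeasure lborel ((\<lambda>x. (x, y)) -` M) \<partial>lborel)"
  proof (rule nn_integral_cong)
    fix y
    have [measurable]: "(\<lambda>x. (x, y)) -` M \<in> sets borel"
      using M sets_Pair2[of M borel borel y] by simp
    have "emeasure lborel ((\<lambda>x. (x, y)) -` M) = emeasure (distr lborel borel ((+) (g y))) ((\<lambda>x. (x, y)) -` M)"
      by (simp add: lborel_distr_plus)
    also have "\<dots> = emeasure lborel ((\<lambda>x. (x, y)) -` ?N)"
      by (subst emeasure_distr) (auto intro!: arg_cong[where f="emeasure lborel"] simp: add.commute)
    finally show "emeasure lborel ((\<lambda>x. (x, y)) -` ?N) = emeasure lborel ((\<lambda>x. (x, y)) -` M)" by simp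
  qed
  also have "\<dots> = emeasure lborel M"
    by (subst lborel_prod[symmetric], rule lborel_pair.emeasure_pair_measure_alt2[symmetric]) simp
  finally show ?thesis .
qed

lemma truncated_polytope_borel:
  fixes b :: "nat \<Rightarrow> real \<times> 'a::euclidean_space"
  shows "truncated_polytope b \<in> sets borel"
proof -
  have eq: "truncated_polytope b = cball 0 1 \<inter> (\<Inter>i\<in>{..DIM('a) + 1}. {y. snd (b i) \<bullet> y \<le> fst (b i)})"
    by (auto simp: truncated_polytope_def closed_hyp_space_def lorentz_def inner_commute)
  have "closed (truncated_polytope b)"
    unfolding eq by (intro closed_Int closed_INT closed_cball ballI closed_halfspace_le)
  then show ?thesis by (rule borel_closed)
qed

lemma hyp_cone_truncated_polytope:
  fixes b :: "nat \<Rightarrow> real \<times> 'a::euclidean_space"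
  shows "hyp_cone (truncated_polytope b) =
    {p. 0 < fst p \<and> lorentz p p < 0 \<and> (\<forall>i\<le>DIM('a) + 1. lorentz p (b i) \<le> 0) \<and> - lorentz p p \<le> 1}"
proof -
  have "snd p /\<^sub>R fst p \<in> truncated_polytope b \<longleftrightarrow> (\<forall>i\<le>DIM('a) + 1. lorentz p (b i) \<le> 0)"
    if p: "0 < fst p" "lorentz p p < 0" for p
  proof -
    have "lorentz p (b i) = fst p * lorentz (1, snd p /\<^sub>R fst p) (b i)" for i
      using p(1) by (simp add: lorentz_def algebra_simps)
    then have "lorentz p (b i) \<le> 0 \<longleftrightarrow> lorentz (1, snd p /\<^sub>R fst p) (b i) \<le> 0" for i
      using p(1) by (simp add: mult_le_0_iff)
    then show ?thesis
      using timelike_in_hyp_space[OF p(2)] by (auto simp: truncated_polytope_def hyp_space_def closed_hyp_space_def)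
  qed
  then show ?thesis unfolding hyp_cone_def by blast
qed

definition model_cone :: "(model_space) set" where
  "model_cone = {p. 0 < fst p \<and> lorentz p p < 0 \<and> (\<forall>i\<le>6. lorentz p (model_normal i) \<le> 0) \<and> - lorentz p p \<le> 1}"

lemma emeasure_polytope_model:
  fixes b :: "nat \<Rightarrow> real \<times> 'a::euclidean_space"
  assumes dim: "DIM('a) = 5" and b: "simply_truncated_orthoscheme [4, 3, 4, 3, 3] b"
  shows "emeasure hyp_measure (truncated_polytope b) = 6 * emeasure lborel model_cone"
proof -
  obtain f :: "model_space \<Rightarrow> real \<times> 'a" where
    f: "linear f" "\<And>x y. lorentz (f x) (f y) = lorentz x y"
      "\<And>i. i \<le> 6 \<Longrightarrow> f (model_normal i) = b i"
      "\<And>p. lorentz p p < 0 \<Longrightarrow> fst (f p) > 0 \<longleftrightarrow> fst p > 0"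
    using orthoscheme_coordinates[OF dim b] by metis
  let ?C = "hyp_cone (truncated_polytope b)"
  have C: "?C \<in> sets borel" by (intro hyp_cone_borel truncated_polytope_borel)
  have meas: "f \<in> borel_measurable borel"
    using f(1) by (intro borel_measurable_continuous_onI linear_continuous_on) (simp add: linear_conv_bounded_linear)
  have "distr lborel borel f = lborel"
    by (rule lborel_distr_lorentz_isometry) (simp_all add: dim f)
  then have "emeasure lborel ?C = emeasure lborel (f -` ?C)"
    using emeasure_distr[of f lborel borel ?C] meas C by simp
  also have "f -` ?C = model_cone"
  proof -
    have "lorentz (f p) (b i) = lorentz p (model_normal i)" if "i \<le> 6" for p i
      using that f(2,3) by metis
    then show ?thesis
      using f(4) by (auto simp: hyp_cone_truncated_polytope model_cone_def dim f(2))
  qed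
  finally show ?thesis
    using emeasure_hyp_measure[OF truncated_polytope_borel, of b] by (simp add: dim)
qed

text \<open>
  The polytope in the affine chart \<open>T - z = 1\<close>. The coordinate \<open>y = z / (T - z)\<close> replaces the height
  \<open>t\<close> in the upper half space, by \<open>|x|\<^sup>2 + t\<^sup>2 = 1 + 2 y\<close>; the last condition is \<open>t\<^sup>2 > 0\<close>.
\<close>
definition model_region :: "(real \<times> real \<times> real \<times> real \<times> real) set" where
  "model_region = {(x1, x2, x3, x4, y). 0 \<le> x1 \<and> x1 \<le> x2 \<and> x2 \<le> x3 \<and> x3 \<le> 1/2 \<and> 0 \<le> x4 \<and> x4 \<le> 1/2 \<and> 0 \<le> y \<and>
      0 < 1 + 2 * y - (x1\<^sup>2 + x2\<^sup>2 + x3\<^sup>2 + x4\<^sup>2)}"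

lemma model_region_borel: "model_region \<in> sets borel"
proof -
  have "{p \<in> space borel. 0 \<le> fst p \<and> fst p \<le> fst (snd p) \<and> fst (snd p) \<le> fst (snd (snd p)) \<and>
      fst (snd (snd p)) \<le> 1/2 \<and> 0 \<le> fst (snd (snd (snd p))) \<and> fst (snd (snd (snd p))) \<le> 1/2 \<and>
      0 \<le> snd (snd (snd (snd p))) \<and> 0 < 1 + 2 * snd (snd (snd (snd p))) - ((fst p)\<^sup>2 + (fst (snd p))\<^sup>2 + (fst (snd (snd p)))\<^sup>2 + (fst (snd (snd (snd p))))\<^sup>2)} \<in> sets (borel :: (real \<times> real \<times> real \<times> real \<times> real) measure)"
    by measurable
  then show ?thesis
    by (simp add: model_region_def case_prod_beta)
qed

text \<open>
  The shear \<open>(T, w, z) \<mapsto> (T - z, w, z)\<close> passes from the chart \<open>T = 1\<close> to the chart \<open>T - z = 1\<close> of the cone.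
\<close>
lemma emeasure_model_cone:
  "emeasure lborel model_cone = ennreal (1/6) *
    (\<integral>\<^sup>+(x1, x2, x3, x4, y). ennreal ((1 + 2 * y - (x1\<^sup>2 + x2\<^sup>2 + x3\<^sup>2 + x4\<^sup>2)) powr (- 3)) *
       indicator model_region (x1, x2, x3, x4, y) \<partial>lborel)"
proof -
  define q :: "real \<times> real \<times> real \<times> real \<times> real \<Rightarrow> real" where
    "q = (\<lambda>(x1, x2, x3, x4, y). 1 + 2 * y - (x1\<^sup>2 + x2\<^sup>2 + x3\<^sup>2 + x4\<^sup>2))"
  have q[measurable]: "q \<in> borel_measurable borel"
    unfolding q_def case_prod_beta by (intro borel_measurable_continuous_onI continuous_intros)
  define zc :: "real \<times> real \<times> real \<times> real \<times> real \<Rightarrow> real" where "zc = (\<lambda>(x1, x2, x3, x4, y). y)"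
  have zc[measurable]: "zc \<in> borel_measurable borel"
    unfolding zc_def case_prod_beta by (intro borel_measurable_continuous_onI continuous_intros)
  have "model_cone = {p \<in> space borel. 0 < fst p \<and> lorentz p p < 0 \<and> (\<forall>i\<in>{..6}. lorentz p (model_normal i) \<le> 0) \<and> - lorentz p p \<le> 1}"
    by (simp add: model_cone_def Ball_def)
  also have "\<dots> \<in> sets borel" by measurable
  finally have mc: "model_cone \<in> sets borel" .
  note model_region_borel [measurable]
  have "{p. (fst p + zc (snd p), snd p) \<in> model_cone} =
    {p. 0 < fst p \<and> snd p /\<^sub>R fst p \<in> model_region \<and> (fst p)\<^sup>2 * q (snd p /\<^sub>R fst p) \<le> 1}"
  proof -
    have "(h + z, w1, w2, w3, w4, z) \<in> model_cone \<longleftrightarrow>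
      0 < h \<and> (w1, w2, w3, w4, z) /\<^sub>R h \<in> model_region \<and> h\<^sup>2 * q ((w1, w2, w3, w4, z) /\<^sub>R h) \<le> 1" for h w1 w2 w3 w4 z
    proof -
      let ?p = "(h + z, w1, w2, w3, w4, z)"
      have l: "lorentz ?p ?p = w1\<^sup>2 + w2\<^sup>2 + w3\<^sup>2 + w4\<^sup>2 - h\<^sup>2 - 2 * h * z"
        unfolding lorentz_tuple by (simp add: power2_eq_square algebra_simps)
      have n: "(\<forall>i\<le>6. lorentz ?p (model_normal i) \<le> 0) \<longleftrightarrow>
        0 \<le> w1 \<and> w1 \<le> w2 \<and> w2 \<le> w3 \<and> w3 \<le> h / 2 \<and> 0 \<le> z \<and> w4 \<le> h / 2 \<and> 0 \<le> w4"
        using model_constraints[of 0 "h + z" w1 w2 w3 w4 z] by simp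
      have h: "0 < h" if "?p \<in> model_cone"
      proof (rule ccontr)
        have c: "0 \<le> h" "lorentz ?p ?p < 0" using that n by (auto simp: model_cone_def)
        assume "\<not> 0 < h"
        then have "h = 0" using c(1) by simp
        then show False using c(2) sum_power2_ge_zero[of w1 w2] sum_power2_ge_zero[of w3 w4] unfolding l by simp
      qed
      show ?thesis
      proof (cases "0 < h")
        case True
        have Q: "h\<^sup>2 * q ((w1, w2, w3, w4, z) /\<^sub>R h) = - lorentz ?p ?p"
          using True unfolding l q_def by (simp add: field_simps power2_eq_square)
        then have "0 < q ((w1, w2, w3, w4, z) /\<^sub>R h) \<longleftrightarrow> lorentz ?p ?p < 0"
          using True by (metis mult_pos_pos neg_0_less_iff_less zero_less_mult_pos zero_less_power)
        then have "(w1, w2, w3, w4, z) /\<^sub>R h \<in> model_region \<longleftrightarrow>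
          0 \<le> w1 \<and> w1 \<le> w2 \<and> w2 \<le> w3 \<and> w3 \<le> h / 2 \<and> 0 \<le> z \<and> w4 \<le> h / 2 \<and> 0 \<le> w4 \<and> lorentz ?p ?p < 0"
          using True unfolding model_region_def q_def by (auto simp: field_simps)
        moreover have "0 \<le> z \<Longrightarrow> 0 < h + z" using True by simp
        ultimately show ?thesis unfolding Q model_cone_def mem_Collect_eq n using True by auto
      next
        case False
        then show ?thesis using h by auto
      qed
    qed
    then show ?thesis by (auto simp: zc_def)
  qed
  then have "emeasure lborel model_cone = emeasure lborel
     {p. 0 < fst p \<and> snd p /\<^sub>R fst p \<in> model_region \<and> (fst p)\<^sup>2 * q (snd p /\<^sub>R fst p) \<le> 1}"
    using emeasure_lborel_shear[OF mc zc] by simp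
  also have "\<dots> = ennreal (1/6) * (\<integral>\<^sup>+x. ennreal (q x powr (- 3)) * indicator model_region x \<partial>lborel)"
    by (subst emeasure_homogeneous_cone) (auto simp: q_def model_region_def)
  finally show ?thesis by (simp add: q_def case_prod_unfold)
qed

lemma nn_integral_height:
  assumes "s < (1::real)"
  shows "(\<integral>\<^sup>+y. ennreal ((1 + 2 * y - s) powr (- 3)) * indicator {0..} y \<partial>lborel) = ennreal (1/4) * ennreal (1 / (1 - s)\<^sup>2)"
proof -
  have "(\<integral>\<^sup>+y. ennreal ((1 + 2 * y - s) powr (- 3)) * indicator {0..} y \<partial>lborel) = ennreal (0 - (- (1/4) * (1 + 2 * 0 - s) powr (- 2)))"
  proof (rule nn_integral_FTC_atLeast)
    fix y :: real assume "0 \<le> y"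
    then show "((\<lambda>y. - (1/4) * (1 + 2 * y - s) powr (- 2)) has_real_derivative (1 + 2 * y - s) powr (- 3)) (at y)"
      using assms by (auto intro!: derivative_eq_intros simp: field_simps)
  next
    show "((\<lambda>y. - (1/4) * (1 + 2 * y - s) powr (- 2)) \<longlongrightarrow> 0) at_top"
      by real_asymp
  qed auto
  also have "(1 + 2 * 0 - s) powr (- 2) = 1 / (1 - s)\<^sup>2"
    using assms by (simp add: powr_minus_divide)
  finally show ?thesis by (simp flip: ennreal_mult')
qed

text \<open>
  Almost every triple lies in exactly one of the six orderings, and transpositions of neighbouring
  variables carry the six integrals into each other.
\<close>
lemma nn_integral_symmetric_triple:
  fixes g :: "real \<times> real \<times> real \<Rightarrow> ennreal"
  assumes [measurable]: "g \<in> borel_measurable borel"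
    and sym: "\<And>x y z. g (x, y, z) = g (y, x, z)" "\<And>x y z. g (x, y, z) = g (x, z, y)"
  shows "(\<integral>\<^sup>+x. \<integral>\<^sup>+y. \<integral>\<^sup>+z. g (x, y, z) \<partial>lborel \<partial>lborel \<partial>lborel) =
    6 * (\<integral>\<^sup>+x. \<integral>\<^sup>+y. \<integral>\<^sup>+z. g (x, y, z) * indicator {(x, y, z). x \<le> y \<and> y \<le> z} (x, y, z) \<partial>lborel \<partial>lborel \<partial>lborel)"
proof -
  define J where "J S = (\<integral>\<^sup>+x. \<integral>\<^sup>+y. \<integral>\<^sup>+z. g (x, y, z) * indicator S (x, y, z) \<partial>lborel \<partial>lborel \<partial>lborel)"
    for S :: "(real \<times> real \<times> real) set"
  have swap12: "J S = J S'"
    if [measurable]: "S \<in> sets borel" and S': "\<And>x y z. (x, y, z) \<in> S' \<longleftrightarrow> (y, x, z) \<in> S" for S S'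
  proof -
    have "J S = (\<integral>\<^sup>+y. \<integral>\<^sup>+x. \<integral>\<^sup>+z. g (x, y, z) * indicator S (x, y, z) \<partial>lborel \<partial>lborel \<partial>lborel)"
      unfolding J_def by (rule lborel_pair.Fubini'[symmetric]) measurable
    also have "\<dots> = J S'"
      unfolding J_def using S' by (intro nn_integral_cong) (subst sym(1), simp add: indicator_def)
    finally show ?thesis .
  qed
  have swap23: "J S = J S'"
    if [measurable]: "S \<in> sets borel" and S': "\<And>x y z. (x, y, z) \<in> S' \<longleftrightarrow> (x, z, y) \<in> S" for S S'
  proof -
    have "J S = (\<integral>\<^sup>+x. \<integral>\<^sup>+z. \<integral>\<^sup>+y. g (x, y, z) * indicator S (x, y, z) \<partial>lborel \<partial>lborel \<partial>lborel)"
      unfolding J_def by (intro nn_integral_cong lborel_pair.Fubini'[symmetric]) measurable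
    also have "\<dots> = J S'"
      unfolding J_def using S' by (intro nn_integral_cong) (subst sym(2), simp add: indicator_def)
    finally show ?thesis .
  qed
  define c1 c2 c3 :: "real \<times> real \<times> real \<Rightarrow> real"
    where "c1 = fst" and "c2 = (\<lambda>p. fst (snd p))" and "c3 = (\<lambda>p. snd (snd p))"
  define ordered where "ordered a b c = {p. a p \<le> b p \<and> b p \<le> c p}" for a b c :: "real \<times> real \<times> real \<Rightarrow> real"
  define S where "S i = [ordered c1 c2 c3, ordered c1 c3 c2, ordered c2 c1 c3,
    ordered c2 c3 c1, ordered c3 c1 c2, ordered c3 c2 c1] ! i" for i
  have S: "S 0 = {(x, y, z). x \<le> y \<and> y \<le> z}" "S 1 = {(x, y, z). x \<le> z \<and> z \<le> y}" "S 2 = {(x, y, z). y \<le> x \<and> x \<le> z}"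
     "S 3 = {(x, y, z). y \<le> z \<and> z \<le> x}" "S 4 = {(x, y, z). z \<le> x \<and> x \<le> y}" "S 5 = {(x, y, z). z \<le> y \<and> y \<le> x}"
    by (auto simp: S_def ordered_def c1_def c2_def c3_def)
  define I :: "nat set" where "I = {0, 1, 2, 3, 4, 5}"
  have sum6: "sum F I = F 0 + F 1 + F 2 + F 3 + F 4 + F 5" for F :: "nat \<Rightarrow> ennreal"
    by (simp add: I_def add.assoc)
  have [measurable]: "c1 \<in> borel_measurable borel" "c2 \<in> borel_measurable borel" "c3 \<in> borel_measurable borel"
    unfolding c1_def c2_def c3_def by measurable
  have ord: "ordered a b c \<in> sets borel"
    if [measurable]: "a \<in> borel_measurable borel" "b \<in> borel_measurable borel" "c \<in> borel_measurable borel" for a b c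
  proof -
    have "{p \<in> space borel. a p \<le> b p \<and> b p \<le> c p} \<in> sets borel" by measurable
    then show ?thesis by (simp add: ordered_def)
  qed
  have m[measurable]: "S i \<in> sets borel" if "i \<in> I" for i
    using that by (auto simp: I_def S_def intro!: ord)
  have mI: "S 0 \<in> sets borel" "S 1 \<in> sets borel" "S 2 \<in> sets borel" "S 3 \<in> sets borel" "S 4 \<in> sets borel" "S 5 \<in> sets borel"
    by (rule m, simp add: I_def)+
  have 1: "J (S 1) = J (S 0)" by (rule swap23) (simp_all only: mI, simp add: S[unfolded One_nat_def])
  have 2: "J (S 2) = J (S 0)" by (rule swap12) (simp_all only: mI, simp add: S[unfolded One_nat_def])
  have 3: "J (S 3) = J (S 1)" by (rule swap12) (simp_all only: mI, simp add: S[unfolded One_nat_def])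
  have 4: "J (S 4) = J (S 2)" by (rule swap23) (simp_all only: mI, simp add: S[unfolded One_nat_def])
  have 5: "J (S 5) = J (S 4)" by (rule swap12) (simp_all only: mI, simp add: S[unfolded One_nat_def])
  have "(\<integral>\<^sup>+x. \<integral>\<^sup>+y. \<integral>\<^sup>+z. g (x, y, z) \<partial>lborel \<partial>lborel \<partial>lborel)
     = (\<integral>\<^sup>+x. \<integral>\<^sup>+y. \<integral>\<^sup>+z. (\<Sum>i\<in>I. g (x, y, z) * indicator (S i) (x, y, z)) \<partial>lborel \<partial>lborel \<partial>lborel)"
  proof (rule nn_integral_cong)
    fix x :: real
    have "AE y in lborel. y \<noteq> x" by (rule AE_lborel_singleton)
    then show "(\<integral>\<^sup>+y. \<integral>\<^sup>+z. g (x, y, z) \<partial>lborel \<partial>lborel)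
       = (\<integral>\<^sup>+y. \<integral>\<^sup>+z. (\<Sum>i\<in>I. g (x, y, z) * indicator (S i) (x, y, z)) \<partial>lborel \<partial>lborel)"
    proof (intro nn_integral_cong_AE, eventually_elim)
      fix y assume xy: "y \<noteq> x"
      have "AE z in lborel. z \<noteq> x" "AE z in lborel. z \<noteq> y" by (rule AE_lborel_singleton)+
      then show "(\<integral>\<^sup>+z. g (x, y, z) \<partial>lborel) = (\<integral>\<^sup>+z. (\<Sum>i\<in>I. g (x, y, z) * indicator (S i) (x, y, z)) \<partial>lborel)"
      proof (intro nn_integral_cong_AE, eventually_elim)
        fix z assume "z \<noteq> x" "z \<noteq> y"
        then have "(\<Sum>i\<in>I. indicator (S i) (x, y, z) :: ennreal) = 1"
          using xy unfolding sum6 S indicator_def by auto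
        then show "g (x, y, z) = (\<Sum>i\<in>I. g (x, y, z) * indicator (S i) (x, y, z))"
          by (simp flip: sum_distrib_left)
      qed
    qed
  qed
  also have "\<dots> = (\<Sum>i\<in>I. J (S i))"
    unfolding J_def by (simp add: nn_integral_sum)
  also have "\<dots> = 6 * J (S 0)"
  proof -
    have "(6::ennreal) = 1 + 1 + 1 + 1 + 1 + 1" by simp
    then show ?thesis unfolding sum6 1 2 3 4 5 by (simp only: distrib_right mult_1)
  qed
  finally show ?thesis by (simp add: J_def S)
qed

text \<open>Half-open, so that the four-fold product avoids the ideal vertex \<open>(1/2, 1/2, 1/2, 1/2)\<close>.\<close>
definition edge_measure :: "real measure" where
  "edge_measure = density lborel (indicator {0..<1/2})"

lemma sets_edge_measure [measurable_cong, simp]: "sets edge_measure = sets borel"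
  by (simp add: edge_measure_def)

lemma space_edge_measure [simp]: "space edge_measure = UNIV"
  by (simp add: edge_measure_def)

lemma nn_integral_edge_measure:
  assumes [measurable]: "f \<in> borel_measurable borel"
  shows "(\<integral>\<^sup>+x. f x \<partial>edge_measure) = (\<integral>\<^sup>+x. f x * indicator {0..<1/2} x \<partial>lborel)"
    "(\<integral>\<^sup>+x. f x \<partial>edge_measure) = (\<integral>\<^sup>+x. f x * indicator {0..1/2} x \<partial>lborel)"
proof -
  show *: "(\<integral>\<^sup>+x. f x \<partial>edge_measure) = (\<integral>\<^sup>+x. f x * indicator {0..<1/2} x \<partial>lborel)"
    unfolding edge_measure_def by (subst nn_integral_density) (simp_all add: mult.commute)
  also have "\<dots> = (\<integral>\<^sup>+x. f x * indicator {0..1/2} x \<partial>lborel)"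
    using AE_lborel_singleton[of "1/2::real"]
    by (intro nn_integral_cong_AE) (auto elim!: eventually_mono simp: indicator_def)
  finally show "(\<integral>\<^sup>+x. f x \<partial>edge_measure) = (\<integral>\<^sup>+x. f x * indicator {0..1/2} x \<partial>lborel)" .
qed

interpretation edge_measure: finite_measure edge_measure
proof
  have "emeasure edge_measure UNIV = (\<integral>\<^sup>+x. 1 \<partial>edge_measure)" by simp
  also have "\<dots> = ennreal (1/2)" by (subst nn_integral_edge_measure) simp_all
  finally show "emeasure edge_measure (space edge_measure) \<noteq> \<infinity>" by simp
qed

text \<open>
  Up to a constant, the volume of the polytope above the point \<open>x\<close> of the prism, per unit of
  Euclidean volume of the base, where \<open>s = |x|\<^sup>2\<close>.
\<close>
definition cusp_density :: "real \<Rightarrow> ennreal" where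
  "cusp_density s = ennreal (1 / (1 - s)\<^sup>2)"

lemma cusp_density_measurable [measurable]: "cusp_density \<in> borel_measurable borel"
  unfolding cusp_density_def by measurable

text \<open>
  Integrating over \<open>y\<close> leaves the prism \<open>0 \<le> x\<^sub>1 \<le> x\<^sub>2 \<le> x\<^sub>3 \<le> 1/2\<close>, \<open>0 \<le> x\<^sub>4 \<le> 1/2\<close>, a sixth of a
  cube. The factor is \<open>1/24 = 6 \<cdot> 1/6 \<cdot> 1/4 \<cdot> 1/6\<close>: cone to volume, chart, height, symmetry.
\<close>
lemma emeasure_truncated_polytope:
  fixes b :: "nat \<Rightarrow> real \<times> 'a::euclidean_space"
  assumes dim: "DIM('a) = 5" and b: "simply_truncated_orthoscheme [4, 3, 4, 3, 3] b"
  shows "emeasure hyp_measure (truncated_polytope b) = ennreal (1/24) *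
    nn_integral4 edge_measure (\<lambda>x y z w. cusp_density (x\<^sup>2 + y\<^sup>2 + z\<^sup>2 + w\<^sup>2))"
proof -
  let ?T = "{(x, y, z). x \<le> y \<and> y \<le> (z::real)}"
  define k where "k = (\<lambda>(x, y, z). \<integral>\<^sup>+w. cusp_density (x\<^sup>2 + y\<^sup>2 + z\<^sup>2 + w\<^sup>2) \<partial>edge_measure)"
  define g where "g = (\<lambda>(x, y, z). k (x, y, z) * (indicator {0..1/2} x * indicator {0..1/2} y * indicator {0..1/2} z))"
  have [measurable]: "k \<in> borel_measurable borel" "g \<in> borel_measurable borel"
    unfolding g_def k_def case_prod_beta by measurable
  have k_meas: "(\<lambda>z. k (x, y, z)) \<in> borel_measurable borel"
    "(\<lambda>y. \<integral>\<^sup>+z. k (x, y, z) \<partial>edge_measure) \<in> borel_measurable borel"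
    "(\<lambda>x. \<integral>\<^sup>+y. \<integral>\<^sup>+z. k (x, y, z) \<partial>edge_measure \<partial>edge_measure) \<in> borel_measurable borel" for x y
    by measurable
  let ?f = "\<lambda>(x1, x2, x3, x4, y). ennreal ((1 + 2 * y - (x1\<^sup>2 + x2\<^sup>2 + x3\<^sup>2 + x4\<^sup>2)) powr (- 3)) *
       indicator model_region (x1, x2, x3, x4, y)"
  have [measurable]: "model_region \<in> sets borel" by (rule model_region_borel)
  have [measurable]: "?f \<in> borel_measurable borel"
    unfolding case_prod_unfold by measurable
  have inner: "(\<integral>\<^sup>+x4. \<integral>\<^sup>+y. ?f (x1, x2, x3, x4, y) \<partial>lborel \<partial>lborel) =
     ennreal (1/4) * (g (x1, x2, x3) * indicator ?T (x1, x2, x3))" for x1 x2 x3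
  proof (cases "0 \<le> x1 \<and> x1 \<le> x2 \<and> x2 \<le> x3 \<and> x3 \<le> 1/2")
    case True
    have "(\<integral>\<^sup>+y. ?f (x1, x2, x3, x4, y) \<partial>lborel) = ennreal (1/4) * (cusp_density (x1\<^sup>2 + x2\<^sup>2 + x3\<^sup>2 + x4\<^sup>2) * indicator {0..<1/2} x4)"
      if "x4 \<noteq> 1/2" for x4
    proof (cases "0 \<le> x4 \<and> x4 < 1/2")
      case x4: True
      let ?s = "x1\<^sup>2 + x2\<^sup>2 + x3\<^sup>2 + x4\<^sup>2"
      have "x1\<^sup>2 \<le> (1/2)\<^sup>2" "x2\<^sup>2 \<le> (1/2)\<^sup>2" "x3\<^sup>2 \<le> (1/2)\<^sup>2" "x4\<^sup>2 < (1/2)\<^sup>2"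
        using True x4 by (auto intro!: power_mono power_strict_mono)
      then have s: "?s < 1" by (simp add: power2_eq_square)
      have "(\<integral>\<^sup>+y. ?f (x1, x2, x3, x4, y) \<partial>lborel) = (\<integral>\<^sup>+y. ennreal ((1 + 2 * y - ?s) powr (- 3)) * indicator {0..} y \<partial>lborel)"
        using True x4 s by (intro nn_integral_cong) (auto simp: model_region_def indicator_def)
      also have "\<dots> = ennreal (1/4) * cusp_density ?s"
        unfolding cusp_density_def by (rule nn_integral_height) (rule s)
      finally show ?thesis using x4 by simp
    next
      case False
      then have 0: "?f (x1, x2, x3, x4, y) = 0" for y using that by (auto simp: model_region_def)
      have "(\<integral>\<^sup>+y. ?f (x1, x2, x3, x4, y) \<partial>lborel) = 0" unfolding 0 by simp
      then show ?thesis using False by simp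
    qed
    then have "(\<integral>\<^sup>+x4. \<integral>\<^sup>+y. ?f (x1, x2, x3, x4, y) \<partial>lborel \<partial>lborel) =
      (\<integral>\<^sup>+x4. ennreal (1/4) * (cusp_density (x1\<^sup>2 + x2\<^sup>2 + x3\<^sup>2 + x4\<^sup>2) * indicator {0..<1/2} x4) \<partial>lborel)"
      using AE_lborel_singleton[of "1/2::real"] by (intro nn_integral_cong_AE) (auto elim!: eventually_mono)
    also have "\<dots> = ennreal (1/4) * k (x1, x2, x3)"
      by (simp add: k_def nn_integral_cmult nn_integral_edge_measure(1))
    finally show ?thesis using True by (simp add: g_def)
  next
    case False
    then have 0: "?f (x1, x2, x3, x4, y) = 0" for x4 y by (auto simp: model_region_def)
    have "(\<integral>\<^sup>+x4. \<integral>\<^sup>+y. ?f (x1, x2, x3, x4, y) \<partial>lborel \<partial>lborel) = 0" unfolding 0 by simp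
    moreover have "g (x1, x2, x3) * indicator ?T (x1, x2, x3) = 0"
      using False by (auto simp: g_def indicator_def)
    ultimately show ?thesis by simp
  qed
  have "{p \<in> space borel. fst p \<le> fst (snd p) \<and> fst (snd p) \<le> snd (snd p)} \<in> sets (borel :: (real \<times> real \<times> real) measure)"
    by measurable
  then have T[measurable]: "?T \<in> sets borel" by (simp add: case_prod_beta)
  have "(\<integral>\<^sup>+p. ?f p \<partial>lborel) = (\<integral>\<^sup>+x1. \<integral>\<^sup>+x2. \<integral>\<^sup>+x3. \<integral>\<^sup>+x4. \<integral>\<^sup>+y. ?f (x1, x2, x3, x4, y) \<partial>lborel \<partial>lborel \<partial>lborel \<partial>lborel \<partial>lborel)"
    by (rule nn_integral_lborel_tuple) measurable
  also have "\<dots> = ennreal (1/4) * (\<integral>\<^sup>+x1. \<integral>\<^sup>+x2. \<integral>\<^sup>+x3. g (x1, x2, x3) * indicator ?T (x1, x2, x3) \<partial>lborel \<partial>lborel \<partial>lborel)"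
    unfolding inner by (simp add: nn_integral_cmult)
  finally have f: "(\<integral>\<^sup>+p. ?f p \<partial>lborel) = \<dots>" .
  have "6 * (\<integral>\<^sup>+x1. \<integral>\<^sup>+x2. \<integral>\<^sup>+x3. g (x1, x2, x3) * indicator ?T (x1, x2, x3) \<partial>lborel \<partial>lborel \<partial>lborel)
    = (\<integral>\<^sup>+x. \<integral>\<^sup>+y. \<integral>\<^sup>+z. g (x, y, z) \<partial>lborel \<partial>lborel \<partial>lborel)"
    by (rule nn_integral_symmetric_triple[symmetric]) (simp_all add: g_def k_def ac_simps)
  also have "\<dots> = (\<integral>\<^sup>+x. \<integral>\<^sup>+y. \<integral>\<^sup>+z. k (x, y, z) \<partial>edge_measure \<partial>edge_measure \<partial>edge_measure)"
  proof -
    have 1: "(\<integral>\<^sup>+z. g (x, y, z) \<partial>lborel) =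
      (\<integral>\<^sup>+z. k (x, y, z) \<partial>edge_measure) * indicator {0..1/2} y * indicator {0..1/2} x" for x y
    proof -
      have "(\<integral>\<^sup>+z. g (x, y, z) \<partial>lborel) =
        (\<integral>\<^sup>+z. (k (x, y, z) * indicator {0..1/2} z) * (indicator {0..1/2} y * indicator {0..1/2} x) \<partial>lborel)"
        by (intro nn_integral_cong) (simp add: g_def ac_simps)
      also have "\<dots> = (\<integral>\<^sup>+z. k (x, y, z) * indicator {0..1/2} z \<partial>lborel) * (indicator {0..1/2} y * indicator {0..1/2} x)"
        by (rule nn_integral_multc) measurable
      finally show ?thesis by (simp only: nn_integral_edge_measure(2) k_meas mult.assoc)
    qed
    have "(\<integral>\<^sup>+y. \<integral>\<^sup>+z. g (x, y, z) \<partial>lborel \<partial>lborel) =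
      (\<integral>\<^sup>+y. \<integral>\<^sup>+z. k (x, y, z) \<partial>edge_measure \<partial>edge_measure) * indicator {0..1/2} x" for x
      unfolding 1 by (subst nn_integral_multc, measurable) (simp only: nn_integral_edge_measure(2)[OF k_meas(2)])
    then show ?thesis by (simp only: nn_integral_edge_measure(2)[OF k_meas(3)])
  qed
  finally have g: "6 * (\<integral>\<^sup>+x1. \<integral>\<^sup>+x2. \<integral>\<^sup>+x3. g (x1, x2, x3) * indicator ?T (x1, x2, x3) \<partial>lborel \<partial>lborel \<partial>lborel) = \<dots>" .
  have "emeasure hyp_measure (truncated_polytope b) = 6 * (ennreal (1/6) * (\<integral>\<^sup>+p. ?f p \<partial>lborel))"
    unfolding emeasure_polytope_model[OF dim b] emeasure_model_cone by (simp add: case_prod_unfold)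
  also have "\<dots> = ennreal (1/24) * (6 * (\<integral>\<^sup>+x1. \<integral>\<^sup>+x2. \<integral>\<^sup>+x3. g (x1, x2, x3) * indicator ?T (x1, x2, x3) \<partial>lborel \<partial>lborel \<partial>lborel))"
  proof -
    have "6 * (ennreal (1/6) * (ennreal (1/4) * a)) = ennreal (1/24) * (6 * a)" for a
    proof -
      have 6: "(6::ennreal) = ennreal 6" by simp
      have "6 * (ennreal (1/6) * (ennreal (1/4) * a)) = (ennreal 6 * ennreal (1/6) * ennreal (1/4)) * a"
        by (simp only: 6 mult.assoc)
      also have "ennreal 6 * ennreal (1/6) * ennreal (1/4) = ennreal (6 * (1/6) * (1/4))"
        by (subst ennreal_mult, simp, simp)+ simp
      also have "ennreal (6 * (1/6) * (1/4)) = ennreal (1/24) * ennreal 6"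
        by (subst ennreal_mult[symmetric]) simp_all
      also have "\<dots> * a = ennreal (1/24) * (6 * a)" by (simp only: 6 mult.assoc)
      finally show ?thesis .
    qed
    then show ?thesis unfolding f .
  qed
  also have "\<dots> = ennreal (1/24) *
    nn_integral4 edge_measure (\<lambda>x y z w. cusp_density (x\<^sup>2 + y\<^sup>2 + z\<^sup>2 + w\<^sup>2))"
    unfolding g by (simp add: k_def)
  finally show ?thesis .
qed

section \<open>Moments of sums of squares\<close>

definition binomial_conv :: "(nat \<Rightarrow> real) \<Rightarrow> (nat \<Rightarrow> real) \<Rightarrow> nat \<Rightarrow> real" where
  "binomial_conv a b k = (\<Sum>j\<le>k. real (k choose j) * (a j * b (k - j)))"

lemma binomial_conv_nonneg:
  assumes "\<And>j. 0 \<le> a j" "\<And>j. 0 \<le> b j"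
  shows "0 \<le> binomial_conv a b k"
  unfolding binomial_conv_def using assms by (intro sum_nonneg) simp

lemma binomial_conv_mono:
  assumes "\<And>j. j \<le> k \<Longrightarrow> 0 \<le> a j \<and> a j \<le> a' j" "\<And>j. j \<le> k \<Longrightarrow> 0 \<le> b j \<and> b j \<le> b' j"
  shows "binomial_conv a b k \<le> binomial_conv a' b' k"
  unfolding binomial_conv_def using assms
  by (intro sum_mono mult_left_mono mult_mono) (auto intro: order_trans)

lemma binomial_conv_scale:
  "binomial_conv (\<lambda>j. c * q ^ j * a j) (\<lambda>j. d * q ^ j * b j) k = c * d * q ^ k * binomial_conv a b k"
proof -
  have "real (k choose j) * ((c * q ^ j * a j) * (d * q ^ (k - j) * b (k - j)))
      = c * d * q ^ k * (real (k choose j) * (a j * b (k - j)))" if "j \<le> k" for j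
  proof -
    have "q ^ k = q ^ j * q ^ (k - j)" using that by (simp flip: power_add)
    then show ?thesis by simp
  qed
  then show ?thesis unfolding binomial_conv_def sum_distrib_left by (intro sum.cong) auto
qed

text \<open>Moments of a sum of independent quantities, from the binomial theorem.\<close>
lemma nn_integral_power_add:
  assumes "sigma_finite_measure N"
    and [measurable]: "F \<in> borel_measurable M" "G \<in> borel_measurable N"
    and nonneg: "\<And>x. 0 \<le> F x" "\<And>y. 0 \<le> G y" "\<And>j. 0 \<le> a j" "\<And>j. 0 \<le> b j"
    and F: "\<And>j. (\<integral>\<^sup>+x. ennreal (F x ^ j) \<partial>M) = ennreal (a j)"
    and G: "\<And>j. (\<integral>\<^sup>+y. ennreal (G y ^ j) \<partial>N) = ennreal (b j)"
  shows "(\<integral>\<^sup>+x. \<integral>\<^sup>+y. ennreal ((F x + G y) ^ k) \<partial>N \<partial>M) = ennreal (binomial_conv a b k)"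
proof -
  interpret N: sigma_finite_measure N by fact
  have "(\<integral>\<^sup>+x. \<integral>\<^sup>+y. ennreal ((F x + G y) ^ k) \<partial>N \<partial>M)
      = (\<integral>\<^sup>+x. \<integral>\<^sup>+y. (\<Sum>j\<le>k. ennreal (real (k choose j)) * (ennreal (F x ^ j) * ennreal (G y ^ (k - j)))) \<partial>N \<partial>M)"
  proof (intro nn_integral_cong)
    fix x y
    have "ennreal ((F x + G y) ^ k) = ennreal (\<Sum>j\<le>k. real (k choose j) * (F x ^ j * G y ^ (k - j)))"
      by (simp add: binomial_ring mult.assoc)
    also have "\<dots> = (\<Sum>j\<le>k. ennreal (real (k choose j) * (F x ^ j * G y ^ (k - j))))"
      using nonneg by (subst sum_ennreal) auto
    also have "\<dots> = (\<Sum>j\<le>k. ennreal (real (k choose j)) * (ennreal (F x ^ j) * ennreal (G y ^ (k - j))))"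
      using nonneg by (intro sum.cong) (simp_all add: ennreal_mult)
    finally show "ennreal ((F x + G y) ^ k) = \<dots>" .
  qed
  also have "\<dots> = (\<Sum>j\<le>k. ennreal (real (k choose j)) * (ennreal (a j) * ennreal (b (k - j))))"
    by (simp add: nn_integral_sum nn_integral_cmult nn_integral_multc F G)
  also have "\<dots> = (\<Sum>j\<le>k. ennreal (real (k choose j) * (a j * b (k - j))))"
    using nonneg by (intro sum.cong) (simp_all add: ennreal_mult)
  also have "\<dots> = ennreal (binomial_conv a b k)"
    unfolding binomial_conv_def using nonneg by (subst sum_ennreal) auto
  finally show ?thesis .
qed

lemma nn_integral_nested_pairs:
  fixes f :: "real \<times> real \<Rightarrow> real \<times> real \<Rightarrow> ennreal"
  assumes "sigma_finite_measure N" and [measurable_cong]: "sets N = sets borel"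
    and [measurable]: "(\<lambda>(p, q). f p q) \<in> borel_measurable borel"
  shows "nn_integral4 N (\<lambda>x y z w. f (x, y) (z, w)) = (\<integral>\<^sup>+p. \<integral>\<^sup>+q. f p q \<partial>(N \<Otimes>\<^sub>M N) \<partial>(N \<Otimes>\<^sub>M N))"
proof -
  interpret N: sigma_finite_measure N by fact
  interpret NN: pair_sigma_finite N N ..
  have space: "space N = UNIV" using sets_eq_imp_space_eq[OF assms(2)] by simp
  have f[measurable]: "(\<lambda>pq. f (fst pq) (snd pq)) \<in> borel_measurable borel"
    using assms(3) by (simp add: case_prod_unfold)
  have f': "(\<lambda>(p, q). f p q) \<in> borel_measurable ((N \<Otimes>\<^sub>M N) \<Otimes>\<^sub>M (N \<Otimes>\<^sub>M N))"
    using f by (simp add: case_prod_unfold cong: measurable_cong_sets sets_pair_measure_cong flip: borel_prod)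
  have fp: "(\<lambda>q. f p q) \<in> borel_measurable (N \<Otimes>\<^sub>M N)" for p
    using measurable_compose[OF measurable_Pair1' f', of p] by (simp add: space_pair_measure space)
  have "(\<integral>\<^sup>+p. \<integral>\<^sup>+q. f p q \<partial>(N \<Otimes>\<^sub>M N) \<partial>(N \<Otimes>\<^sub>M N))
     = (\<integral>\<^sup>+x. \<integral>\<^sup>+y. \<integral>\<^sup>+q. f (x, y) q \<partial>(N \<Otimes>\<^sub>M N) \<partial>N \<partial>N)"
    by (rule N.nn_integral_fst[symmetric]) (rule NN.borel_measurable_nn_integral[OF f'])
  also have "\<dots> = nn_integral4 N (\<lambda>x y z w. f (x, y) (z, w))"
    by (intro nn_integral_cong N.nn_integral_fst[symmetric] fp)
  finally show ?thesis by simp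
qed

text \<open>Grouped in pairs, so that two convolutions suffice instead of three.\<close>
lemma nn_integral_four_squares:
  fixes N :: "real measure"
  assumes "sigma_finite_measure N" and N[measurable_cong]: "sets N = sets borel"
    and a: "\<And>j. 0 \<le> a j" "\<And>j. (\<integral>\<^sup>+x. ennreal ((x\<^sup>2) ^ j) \<partial>N) = ennreal (a j)"
  shows "nn_integral4 N (\<lambda>x y z w. ennreal ((x\<^sup>2 + y\<^sup>2 + z\<^sup>2 + w\<^sup>2) ^ k))
    = ennreal (binomial_conv (binomial_conv a a) (binomial_conv a a) k)"
proof -
  interpret N: sigma_finite_measure N by fact
  interpret NN: pair_sigma_finite N N ..
  define n where "n p = (fst p)\<^sup>2 + (snd p)\<^sup>2" for p :: "real \<times> real"
  have n[measurable]: "n \<in> borel_measurable (N \<Otimes>\<^sub>M N)" "n \<in> borel_measurable borel"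
    unfolding n_def by measurable
  have "(\<integral>\<^sup>+p. ennreal (n p ^ j) \<partial>(N \<Otimes>\<^sub>M N)) = ennreal (binomial_conv a a j)" for j
  proof -
    have "(\<integral>\<^sup>+p. ennreal (n p ^ j) \<partial>(N \<Otimes>\<^sub>M N)) = (\<integral>\<^sup>+x. \<integral>\<^sup>+y. ennreal (n (x, y) ^ j) \<partial>N \<partial>N)"
      by (rule N.nn_integral_fst[symmetric]) measurable
    also have "\<dots> = ennreal (binomial_conv a a j)"
      unfolding n_def fst_conv snd_conv
      by (rule nn_integral_power_add) (use a in \<open>auto intro: assms(1)\<close>)
    finally show ?thesis .
  qed
  then have "(\<integral>\<^sup>+p. \<integral>\<^sup>+q. ennreal ((n p + n q) ^ k) \<partial>(N \<Otimes>\<^sub>M N) \<partial>(N \<Otimes>\<^sub>M N))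
      = ennreal (binomial_conv (binomial_conv a a) (binomial_conv a a) k)"
    by (intro nn_integral_power_add)
       (auto intro!: binomial_conv_nonneg a NN.sigma_finite_measure_axioms simp: n_def)
  moreover have "nn_integral4 N (\<lambda>x y z w. ennreal ((n (x, y) + n (z, w)) ^ k))
     = (\<integral>\<^sup>+p. \<integral>\<^sup>+q. ennreal ((n p + n q) ^ k) \<partial>(N \<Otimes>\<^sub>M N) \<partial>(N \<Otimes>\<^sub>M N))"
    by (rule nn_integral_nested_pairs) (use assms in \<open>auto simp: n_def case_prod_unfold intro!: borel_measurable_continuous_onI continuous_intros\<close>)
  ultimately show ?thesis by (simp add: n_def add.assoc)
qed

lemma edge_moment:
  "(\<integral>\<^sup>+x. ennreal ((x\<^sup>2) ^ j) \<partial>edge_measure) = ennreal ((1/2) * (1/4) ^ j * (1 / real (2 * j + 1)))"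
proof -
  have "(\<integral>\<^sup>+x. ennreal ((x\<^sup>2) ^ j) \<partial>edge_measure) = (\<integral>\<^sup>+x. ennreal (x ^ (2 * j)) * indicator {0..1/2} x \<partial>lborel)"
    by (subst nn_integral_edge_measure(2)) (simp_all add: power_mult)
  also have "\<dots> = ennreal ((1/2) ^ (2 * j + 1) / real (2 * j + 1) - 0 ^ (2 * j + 1) / real (2 * j + 1))"
  proof (rule nn_integral_FTC_Icc)
    show "((\<lambda>x. x ^ (2 * j + 1) / real (2 * j + 1)) has_real_derivative x ^ (2 * j)) (at x)" for x
      using DERIV_cdivide[OF DERIV_pow[of "2 * j + 1" x UNIV], of "real (2 * j + 1)"] by simp
  qed auto
  also have "(1/2) ^ (2 * j + 1) / real (2 * j + 1) - 0 ^ (2 * j + 1) / real (2 * j + 1) = (1/2) * (1/4) ^ j * (1 / real (2 * j + 1))"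
    by (simp add: power_mult power2_eq_square)
  finally show ?thesis .
qed

text \<open>
  The weight of the majorant below, the arcsine law up to a constant: it dominates the singularity
  at the ideal vertex and is a product of functions of one variable.
\<close>
definition arcsine_measure :: "real measure" where
  "arcsine_measure = density edge_measure (\<lambda>x. ennreal (1 / sqrt (1/4 - x\<^sup>2)))"

text \<open>
  The even moments of \<open>sin \<theta> / 2\<close>, that is, central binomial coefficients over powers of \<open>16\<close>.
\<close>
fun arcsine_moment :: "nat \<Rightarrow> real" where
  "arcsine_moment 0 = 1"
| "arcsine_moment (Suc j) = arcsine_moment j * (2 * real j + 1) / (8 * (real j + 1))"

lemma arcsine_moment_nonneg: "0 \<le> arcsine_moment j"
  by (induction j) simp_all

text \<open>
  In the induction step the derivative of \<open>x\<close> to the power \<open>2 j + 1\<close> times \<open>\<surd>(1/4 - x\<^sup>2)\<close>, which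
  vanishes at both ends, relates two consecutive moments.
\<close>
lemma arcsine_has_integral:
  "((\<lambda>x. x ^ (2 * j) / sqrt (1/4 - x\<^sup>2)) has_integral pi / 2 * arcsine_moment j) {0..1/2::real}"
proof (induction j)
  case 0
  have "((\<lambda>x. 1 / sqrt (1/4 - x\<^sup>2)) has_integral arcsin (2 * (1/2)) - arcsin (2 * 0)) {0..1/2::real}"
  proof (rule fundamental_theorem_of_calculus_interior)
    show "continuous_on {0..1/2::real} (\<lambda>x. arcsin (2 * x))"
      by (intro continuous_intros) auto
    fix x :: real assume x: "x \<in> {0<..<1/2}"
    have "sqrt (1 - (2 * x)\<^sup>2) = sqrt (4 * (1/4 - x\<^sup>2))" by (simp add: power2_eq_square)
    also have "\<dots> = 2 * sqrt (1/4 - x\<^sup>2)" by (subst real_sqrt_mult) simp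
    finally have "((\<lambda>x. arcsin (2 * x)) has_real_derivative 1 / sqrt (1/4 - x\<^sup>2)) (at x)"
      using x by (auto intro!: derivative_eq_intros simp: field_simps)
    then show "((\<lambda>x. arcsin (2 * x)) has_vector_derivative 1 / sqrt (1/4 - x\<^sup>2)) (at x)"
      by (simp add: has_real_derivative_iff_has_vector_derivative)
  qed simp
  then show ?case by simp
next
  case (Suc j)
  let ?d = "\<lambda>x::real. (2 * real j + 1) / 4 * (x ^ (2 * j) / sqrt (1/4 - x\<^sup>2)) - (2 * real j + 2) * (x ^ (2 * Suc j) / sqrt (1/4 - x\<^sup>2))"
  have "(?d has_integral (1/2) ^ (2 * j + 1) * sqrt (1/4 - (1/2)\<^sup>2) - 0 ^ (2 * j + 1) * sqrt (1/4 - 0\<^sup>2)) {0..1/2}"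
  proof (rule fundamental_theorem_of_calculus_interior)
    show "continuous_on {0..1/2::real} (\<lambda>x. x ^ (2 * j + 1) * sqrt (1/4 - x\<^sup>2))"
      by (intro continuous_intros)
    fix x :: real assume x: "x \<in> {0<..<1/2}"
    then have "x\<^sup>2 < (1/2)\<^sup>2" by (intro power_strict_mono) auto
    then have pos: "1/4 - x\<^sup>2 > 0" by (simp add: power2_eq_square)
    define r where "r = sqrt (1/4 - x\<^sup>2)"
    have r: "r > 0" "r * r = 1/4 - x\<^sup>2" using pos by (simp_all add: r_def)
    have d1: "((\<lambda>x. x ^ (2 * j + 1)) has_real_derivative (2 * real j + 1) * x ^ (2 * j)) (at x)"
      using DERIV_pow[of "2 * j + 1" x UNIV] by (simp add: add.commute)
    have d2: "((\<lambda>x. sqrt (1/4 - x\<^sup>2)) has_real_derivative - x / r) (at x)"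
      using pos by (auto intro!: derivative_eq_intros simp: r_def field_simps)
    have "((\<lambda>x. x ^ (2 * j + 1) * sqrt (1/4 - x\<^sup>2)) has_real_derivative
       (2 * real j + 1) * x ^ (2 * j) * r + x ^ (2 * j + 1) * (- x / r)) (at x)"
      using DERIV_mult[OF d1 d2] by (simp add: r_def mult.commute)
    also have "(2 * real j + 1) * x ^ (2 * j) * r + x ^ (2 * j + 1) * (- x / r) =
        ((2 * real j + 1) * x ^ (2 * j) * (r * r) - x ^ (2 * j + 2)) / r"
      using r(1) by (simp add: field_simps)
    also have "\<dots> = ?d x"
      unfolding r(2) unfolding r_def[symmetric] using r(1) by (simp add: field_simps power2_eq_square)
    finally show "((\<lambda>x. x ^ (2 * j + 1) * sqrt (1/4 - x\<^sup>2)) has_vector_derivative ?d x) (at x)"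
      by (simp add: has_real_derivative_iff_has_vector_derivative)
  qed simp
  then have d0: "(?d has_integral 0) {0..1/2}" by (simp add: power2_eq_square)
  have "((\<lambda>x. 1 / (2 * real j + 2) * ((2 * real j + 1) / 4 * (x ^ (2 * j) / sqrt (1/4 - x\<^sup>2)) - ?d x)) has_integral
     1 / (2 * real j + 2) * ((2 * real j + 1) / 4 * (pi / 2 * arcsine_moment j) - 0)) {0..1/2}"
    by (intro has_integral_mult_right has_integral_diff Suc d0)
  moreover have "1 / (2 * real j + 2) * (u - (u - (2 * real j + 2) * v)) = v" for u v :: real
    by (simp add: add_eq_0_iff)
  then have "1 / (2 * real j + 2) * ((2 * real j + 1) / 4 * (x ^ (2 * j) / sqrt (1/4 - x\<^sup>2)) - ?d x)
     = x ^ (2 * Suc j) / sqrt (1/4 - x\<^sup>2)" for x :: real .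
  moreover have "1 / (2 * real j + 2) * ((2 * real j + 1) / 4 * (pi / 2 * arcsine_moment j) - 0) = pi / 2 * arcsine_moment (Suc j)"
    by (simp add: field_simps)
  ultimately show ?case by (simp only:)
qed

lemma sets_arcsine_measure [measurable_cong, simp]: "sets arcsine_measure = sets borel"
  by (simp add: arcsine_measure_def)

lemma nn_integral_arcsine_measure:
  assumes [measurable]: "f \<in> borel_measurable borel"
  shows "(\<integral>\<^sup>+x. f x \<partial>arcsine_measure) = (\<integral>\<^sup>+x. ennreal (1 / sqrt (1/4 - x\<^sup>2)) * f x \<partial>edge_measure)"
  unfolding arcsine_measure_def by (rule nn_integral_density) measurable

lemma arcsine_moments:
  "(\<integral>\<^sup>+x. ennreal ((x\<^sup>2) ^ j) \<partial>arcsine_measure) = ennreal (pi / 2 * arcsine_moment j)"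
proof -
  have "(\<integral>\<^sup>+x. ennreal ((x\<^sup>2) ^ j) \<partial>arcsine_measure) =
     (\<integral>\<^sup>+x. ennreal (1 / sqrt (1/4 - x\<^sup>2)) * ennreal ((x\<^sup>2) ^ j) * indicator {0..1/2} x \<partial>lborel)"
    by (subst nn_integral_arcsine_measure, measurable, subst nn_integral_edge_measure(2)) simp_all
  also have "\<dots> = (\<integral>\<^sup>+x. ennreal (x ^ (2 * j) / sqrt (1/4 - x\<^sup>2)) * indicator {0..1/2} x \<partial>lborel)"
    by (intro nn_integral_cong) (auto simp: indicator_def power_mult simp flip: ennreal_mult'')
  also have "\<dots> = ennreal (pi / 2 * arcsine_moment j)"
  proof (rule nn_integral_has_integral_lebesgue')
    fix x :: real assume "x \<in> {0..1/2}"
    then have "x\<^sup>2 \<le> (1/2)\<^sup>2" by (intro power_mono) auto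
    then show "0 \<le> x ^ (2 * j) / sqrt (1/4 - x\<^sup>2)" by (simp add: power2_eq_square)
  qed (rule arcsine_has_integral)
  finally show ?thesis .
qed

interpretation arcsine_measure: finite_measure arcsine_measure
proof
  have "emeasure arcsine_measure (space arcsine_measure) = (\<integral>\<^sup>+x. ennreal ((x\<^sup>2) ^ 0) \<partial>arcsine_measure)"
    by simp
  then show "emeasure arcsine_measure (space arcsine_measure) \<noteq> \<infinity>"
    unfolding arcsine_moments by simp
qed

definition edge_moment4 :: "nat \<Rightarrow> real" where
  "edge_moment4 = (let a = (\<lambda>j. (1/2) * (1/4) ^ j * (1 / real (2 * j + 1))) in
     binomial_conv (binomial_conv a a) (binomial_conv a a))"

definition arcsine_moment4 :: "nat \<Rightarrow> real" where
  "arcsine_moment4 = (let a = (\<lambda>j. pi / 2 * arcsine_moment j) in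
     binomial_conv (binomial_conv a a) (binomial_conv a a))"

lemma edge_moment4:
  "nn_integral4 edge_measure (\<lambda>x y z w. ennreal ((x\<^sup>2 + y\<^sup>2 + z\<^sup>2 + w\<^sup>2) ^ k))
    = ennreal (edge_moment4 k)" "0 \<le> edge_moment4 k"
  unfolding edge_moment4_def Let_def
  by (rule nn_integral_four_squares edge_measure.sigma_finite_measure_axioms sets_edge_measure edge_moment
       | simp add: binomial_conv_nonneg)+

lemma arcsine_moment4:
  "nn_integral4 arcsine_measure (\<lambda>x y z w. ennreal ((x\<^sup>2 + y\<^sup>2 + z\<^sup>2 + w\<^sup>2) ^ k))
    = ennreal (arcsine_moment4 k)" "0 \<le> arcsine_moment4 k"
  unfolding arcsine_moment4_def Let_def
  by (rule nn_integral_four_squares arcsine_measure.sigma_finite_measure_axioms sets_arcsine_measure arcsine_moments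
       | simp add: binomial_conv_nonneg arcsine_moment_nonneg)+

section \<open>Evaluation with integers\<close>

text \<open>
  Binomial convolution of integer sequences, given by their initial segments: \<open>r\<close> runs through the
  rows of Pascal's triangle, and \<open>acc\<close> collects the entries of the second list in reverse order.
\<close>
fun binomial_conv_rows :: "int list \<Rightarrow> int list \<Rightarrow> int list \<Rightarrow> int list \<Rightarrow> int list" where
  "binomial_conv_rows r acc xs [] = []"
| "binomial_conv_rows r acc xs (y # ys) = sum_list (map2 (*) r (map2 (*) xs (y # acc))) #
     binomial_conv_rows (map2 (+) (0 # r) (r @ [0])) (y # acc) xs ys"

definition binomial_conv_list :: "int list \<Rightarrow> int list \<Rightarrow> int list" where
  "binomial_conv_list xs ys = binomial_conv_rows [1] [] xs ys"

lemma length_binomial_conv_rows [simp]: "length (binomial_conv_rows r acc xs ys) = length ys"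
  by (induction ys arbitrary: r acc) auto

lemma binomial_conv_rows_nth:
  assumes "i < length ys" "length acc + length ys \<le> length xs" "n = length acc"
    and "r = map (\<lambda>j. int (n choose j)) [0..<Suc n]"
  shows "binomial_conv_rows r acc xs ys ! i =
    (\<Sum>j\<le>n + i. int ((n + i) choose j) * (xs ! j * (rev acc @ ys) ! (n + i - j)))"
  using assms
proof (induction ys arbitrary: i r acc n)
  case (Cons y ys)
  show ?case
  proof (cases i)
    case 0
    have len: "length (map2 (*) r (map2 (*) xs (y # acc))) = Suc n"
      using Cons.prems by simp
    have "sum_list (map2 (*) r (map2 (*) xs (y # acc))) = (\<Sum>j<Suc n. int (n choose j) * (xs ! j * (rev acc @ y # ys) ! (n - j)))"
      unfolding sum_list_sum_nth len atLeast0LessThan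
    proof (rule sum.cong)
      fix j assume "j \<in> {..<Suc n}"
      then have j: "j \<le> n" by simp
      have "(y # acc) ! j = (rev acc @ y # ys) ! (n - j)"
        using j Cons.prems(3) by (cases j) (auto simp: nth_append rev_nth)
      then show "map2 (*) r (map2 (*) xs (y # acc)) ! j = int (n choose j) * (xs ! j * (rev acc @ y # ys) ! (n - j))"
        using j Cons.prems by (simp del: upt_Suc)
    qed simp
    then show ?thesis using 0 by (simp add: lessThan_Suc_atMost)
  next
    case (Suc i')
    have row: "map2 (+) (0 # r) (r @ [0]) = map (\<lambda>j. int (Suc n choose j)) [0..<Suc (Suc n)]"
    proof (rule nth_equalityI)
      fix j assume "j < length (map2 (+) (0 # r) (r @ [0]))"
      then have "j \<le> Suc n" using Cons.prems by simp
      then show "map2 (+) (0 # r) (r @ [0]) ! j = map (\<lambda>j. int (Suc n choose j)) [0..<Suc (Suc n)] ! j"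
        using Cons.prems(4) by (cases j) (auto simp: nth_append less_Suc_eq_le binomial_eq_0 simp del: upt_Suc)
    qed (use Cons.prems in simp)
    have "binomial_conv_rows (map2 (+) (0 # r) (r @ [0])) (y # acc) xs ys ! i' =
       (\<Sum>j\<le>Suc n + i'. int ((Suc n + i') choose j) * (xs ! j * (rev (y # acc) @ ys) ! (Suc n + i' - j)))"
      by (rule Cons.IH) (use Cons.prems Suc row in auto)
    then show ?thesis using Suc by simp
  qed
qed simp

lemma binomial_conv_list_nth:
  assumes "k < length ys" "length ys \<le> length xs"
  shows "binomial_conv_list xs ys ! k = (\<Sum>j\<le>k. int (k choose j) * (xs ! j * ys ! (k - j)))"
  unfolding binomial_conv_list_def using binomial_conv_rows_nth[of k ys "[]" xs 0 "[1]"] assms by simp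

text \<open>
  Horner scheme for \<open>\<Sum> (i + k) x\<^sub>k 4\<^sup>-\<^sup>k\<close> without fractions.
\<close>
fun weighted_sum :: "int \<Rightarrow> int \<Rightarrow> int list \<Rightarrow> int" where
  "weighted_sum acc i [] = acc"
| "weighted_sum acc i (x # xs) = weighted_sum (4 * acc + i * x) (i + 1) xs"

lemma weighted_sum:
  "real_of_int (weighted_sum acc i xs) = 4 ^ length xs * (acc + (\<Sum>k<length xs. (i + int k) * (xs ! k) * (1/4) ^ Suc k))"
proof (induction xs arbitrary: acc i)
  case (Cons x xs)
  define S where "S = (\<Sum>k<length xs. (i + 1 + int k) * (xs ! k) * (1/4) ^ Suc k :: real)"
  have "(\<Sum>k<length xs. (i + int (Suc k)) * ((x # xs) ! Suc k) * (1/4) ^ Suc (Suc k)) = 1/4 * S"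
    unfolding S_def sum_distrib_left by (intro sum.cong) (simp_all add: algebra_simps)
  then show ?case
    unfolding weighted_sum.simps Cons.IH length_Cons sum.lessThan_Suc_shift
    by (simp add: S_def algebra_simps)
qed simp

definition fourfold :: "int list \<Rightarrow> int list" where
  "fourfold xs = (let ys = binomial_conv_list xs xs in binomial_conv_list ys ys)"

lemma length_fourfold [simp]: "length (fourfold xs) = length xs"
  by (simp add: fourfold_def Let_def binomial_conv_list_def)

text \<open>
  Five decimals of \<open>1 / (2 j + 1)\<close>, rounded in either direction, for the first 32 moments of an
  edge. Truncation at 32 terms loses \<open>0.3\<close> percent of the integral, and the upper bound exceeds it
  by \<open>0.8\<close> percent; the decimals of the density leave room for \<open>0.37\<close> and \<open>1.05\<close> percent,
  respectively.
\<close>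
definition odd_reciprocals_below :: "int list" where
  "odd_reciprocals_below = map (\<lambda>j. 10^5 div (2 * j + 1)) [0..31]"

definition odd_reciprocals_above :: "int list" where
  "odd_reciprocals_above = map (\<lambda>j. 10^5 div (2 * j + 1) + 1) [0..31]"

definition central_binomials :: "int list" where
  "central_binomials = [1, 2, 6, 20, 70, 252,
    924, 3432, 12870, 48620, 184756, 705432,
    2704156, 10400600, 40116600, 155117520, 601080390, 2333606220,
    9075135300, 35345263800, 137846528820, 538257874440, 2104098963720, 8233430727600,
    32247603683100, 126410606437752, 495918532948104, 1946939425648112, 7648690600760440, 30067266499541040,
    118264581564861424, 465428353255261088, 1832624140942590534, 7219428434016265740]"

text \<open>
  The bounds here and below are the exact integers, rounded to eight digits.
\<close>
lemma weighted_sum_below: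
  "12897908 * 10 ^ 32 \<le> weighted_sum 0 1 (fourfold odd_reciprocals_below)"
  by code_simp

lemma weighted_sum_above:
  "weighted_sum 0 1 (fourfold odd_reciprocals_above) \<le> 12898942 * 10 ^ 32"
  by code_simp

lemma central_binomials_tail:
  "let c = fourfold central_binomials in 33 * 16 * c ! 32 - 32 * c ! 33 \<le> 26534518 * 10 ^ 30"
  by code_simp

lemma central_binomials_rec:
  "length central_binomials = 34 \<and>
   list_all (\<lambda>(c, d, i). (i + 1) * d = (4 * i + 2) * c) (zip central_binomials (zip (tl central_binomials) [0..32]))"
  by code_simp

section \<open>Enclosing the integral over the cube\<close>

lemma AE_edge_measure: "AE x in edge_measure. x \<in> {0..<1/2}"
  unfolding edge_measure_def by (subst AE_density) (auto simp: indicator_def)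

lemma AE_arcsine_measure: "AE x in arcsine_measure. x \<in> {0..<1/2}"
  unfolding arcsine_measure_def
  by (subst AE_density, measurable) (rule eventually_mono[OF AE_edge_measure], simp)

lemma nn_integral4_mono:
  assumes N: "AE x in N. x \<in> A"
    and le: "\<And>x y z w. x \<in> A \<Longrightarrow> y \<in> A \<Longrightarrow> z \<in> A \<Longrightarrow> w \<in> A \<Longrightarrow> f x y z w \<le> g x y z w"
  shows "nn_integral4 N (\<lambda>x y z w. f x y z w) \<le> nn_integral4 N (\<lambda>x y z w. g x y z w)"
proof -
  have step: "(\<integral>\<^sup>+x. F x \<partial>N) \<le> (\<integral>\<^sup>+x. G x \<partial>N)" if "\<And>x. x \<in> A \<Longrightarrow> F x \<le> G x" for F G
    by (intro nn_integral_mono_AE eventually_mono[OF N] that)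
  show ?thesis by (intro step le)
qed

text \<open>
  The Taylor polynomial of \<open>1 / (1 - s)\<^sup>2\<close> with an explicit remainder, whose sign is evident.
\<close>
lemma taylor_remainder:
  fixes s :: real
  assumes "s \<noteq> 1"
  shows "1 / (1 - s)\<^sup>2 = (\<Sum>k<n. (real k + 1) * s ^ k) + s ^ n * (1 + real n * (1 - s)) / (1 - s)\<^sup>2"
proof (induction n)
  case (Suc n)
  have nz: "1 - s \<noteq> 0" using assms by simp
  have "s ^ n * (1 + real n * (1 - s)) = (real n + 1) * s ^ n * (1 - s)\<^sup>2 + s ^ Suc n * (1 + real (Suc n) * (1 - s))"
    by (simp add: algebra_simps power2_eq_square)
  then have "s ^ n * (1 + real n * (1 - s)) / (1 - s)\<^sup>2 =
     (real n + 1) * s ^ n + s ^ Suc n * (1 + real (Suc n) * (1 - s)) / (1 - s)\<^sup>2"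
    using nz by (simp only: add_divide_distrib) simp
  then show ?case using Suc by simp
qed simp

text \<open>Twice the inequality between arithmetic and geometric means, for \<open>1 - s = \<Sum> (1/4 - x\<^sup>2)\<close>.\<close>
lemma four_term_am_gm:
  fixes a b c d :: real
  assumes "0 \<le> a" "0 \<le> b" "0 \<le> c" "0 \<le> d"
  shows "16 * (sqrt a * sqrt b * sqrt c * sqrt d) \<le> (a + b + c + d)\<^sup>2"
proof -
  have two: "2 * (sqrt u * sqrt v) \<le> u + v" if "0 \<le> u" "0 \<le> v" for u v :: real
    using sum_squares_bound[of "sqrt u" "sqrt v"] that by simp
  have "16 * (sqrt a * sqrt b * sqrt c * sqrt d) = 4 * ((2 * (sqrt a * sqrt b)) * (2 * (sqrt c * sqrt d)))"
    by simp
  also have "\<dots> \<le> 4 * ((a + b) * (c + d))"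
    using assms two[of a b] two[of c d] by (intro mult_left_mono mult_mono) auto
  also have "\<dots> \<le> (a + b + c + d)\<^sup>2"
    using sum_squares_bound[of "a + b" "c + d"] by (simp add: power2_eq_square algebra_simps)
  finally show ?thesis .
qed

definition cube_integral :: ennreal where
  "cube_integral = nn_integral4 edge_measure (\<lambda>x y z w. cusp_density (x\<^sup>2 + y\<^sup>2 + z\<^sup>2 + w\<^sup>2))"

lemma sum_squares_less_1:
  assumes "x \<in> {0..<1/2}" "y \<in> {0..<1/2}" "z \<in> {0..<1/2}" "w \<in> {0..<1/2::real}"
  shows "x\<^sup>2 < 1/4" "y\<^sup>2 < 1/4" "z\<^sup>2 < 1/4" "w\<^sup>2 < 1/4" "x\<^sup>2 + y\<^sup>2 + z\<^sup>2 + w\<^sup>2 < 1"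
proof -
  have *: "u\<^sup>2 < 1/4" if "u \<in> {0..<1/2}" for u :: real
    using that power_strict_mono[of u "1/2" 2] by (simp add: power2_eq_square)
  show "x\<^sup>2 < 1/4" "y\<^sup>2 < 1/4" "z\<^sup>2 < 1/4" "w\<^sup>2 < 1/4" using assms * by auto
  then show "x\<^sup>2 + y\<^sup>2 + z\<^sup>2 + w\<^sup>2 < 1" by simp
qed

lemma nn_integral_taylor_polynomial:
  "nn_integral4 edge_measure (\<lambda>x y z w. (\<Sum>k<n. ennreal (real k + 1) * ennreal ((x\<^sup>2 + y\<^sup>2 + z\<^sup>2 + w\<^sup>2) ^ k)))
    = ennreal (\<Sum>k<n. (real k + 1) * edge_moment4 k)"
proof -
  have "nn_integral4 edge_measure (\<lambda>x y z w. (\<Sum>k<n. ennreal (real k + 1) * ennreal ((x\<^sup>2 + y\<^sup>2 + z\<^sup>2 + w\<^sup>2) ^ k)))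
    = (\<Sum>k<n. ennreal (real k + 1) * ennreal (edge_moment4 k))"
    by (simp add: nn_integral_sum nn_integral_cmult edge_moment4(1) del: ennreal_plus)
  also have "\<dots> = (\<Sum>k<n. ennreal ((real k + 1) * edge_moment4 k))"
    by (intro sum.cong refl ennreal_mult[symmetric] edge_moment4(2)) simp
  also have "\<dots> = ennreal (\<Sum>k<n. (real k + 1) * edge_moment4 k)"
    by (rule sum_ennreal) (simp add: edge_moment4(2))
  finally show ?thesis .
qed

lemma taylor_polynomial_ennreal:
  assumes "0 \<le> s"
  shows "(\<Sum>k<n. ennreal (real k + 1) * ennreal (s ^ k)) = ennreal (\<Sum>k<n. (real k + 1) * s ^ k)"
proof -
  have "(\<Sum>k<n. ennreal (real k + 1) * ennreal (s ^ k)) = (\<Sum>k<n. ennreal ((real k + 1) * s ^ k))"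
    using assms by (intro sum.cong refl ennreal_mult[symmetric]) simp_all
  then show ?thesis using assms by (subst (asm) sum_ennreal) simp_all
qed

lemma cube_integral_lower: "ennreal (\<Sum>k<n. (real k + 1) * edge_moment4 k) \<le> cube_integral"
  unfolding nn_integral_taylor_polynomial[symmetric] cube_integral_def
proof (rule nn_integral4_mono[OF AE_edge_measure])
  fix x y z w :: real assume *: "x \<in> {0..<1/2}" "y \<in> {0..<1/2}" "z \<in> {0..<1/2}" "w \<in> {0..<1/2}"
  let ?s = "x\<^sup>2 + y\<^sup>2 + z\<^sup>2 + w\<^sup>2"
  have s: "0 \<le> ?s" "?s < 1" using sum_squares_less_1[OF *] by simp_all
  have "0 \<le> ?s ^ n * (1 + real n * (1 - ?s)) / (1 - ?s)\<^sup>2" using s by simp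
  then have "(\<Sum>k<n. (real k + 1) * ?s ^ k) \<le> 1 / (1 - ?s)\<^sup>2"
    using taylor_remainder[of ?s n] s(2) by linarith
  then show "(\<Sum>k<n. ennreal (real k + 1) * ennreal (?s ^ k)) \<le> cusp_density ?s"
    unfolding cusp_density_def taylor_polynomial_ennreal[OF s(1)] by (rule ennreal_leI)
qed

lemma nn_integral_arcsine4:
  assumes [measurable]: "(\<lambda>(x, y, z, w). f x y z w) \<in> borel_measurable borel"
  shows "nn_integral4 arcsine_measure (\<lambda>x y z w. f x y z w)
   = nn_integral4 edge_measure (\<lambda>x y z w. ennreal (1 / sqrt (1/4 - x\<^sup>2)) * (ennreal (1 / sqrt (1/4 - y\<^sup>2)) *
       (ennreal (1 / sqrt (1/4 - z\<^sup>2)) * (ennreal (1 / sqrt (1/4 - w\<^sup>2)) * f x y z w))))"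
proof -
  define F where "F = (\<lambda>(x, y, z, w). f x y z w)"
  have [measurable]: "F \<in> borel_measurable borel" using assms by (simp add: F_def)
  have f: "f x y z w = F (x, y, z, w)" for x y z w by (simp add: F_def)
  show ?thesis unfolding f by (simp add: nn_integral_arcsine_measure nn_integral_cmult)
qed

text \<open>
  Stated as an upper bound, which follows from additivity of the integral without subtracting in \<open>ennreal\<close>.
\<close>
lemma arcsine_remainder:
  "nn_integral4 arcsine_measure (\<lambda>x y z w. ennreal ((x\<^sup>2 + y\<^sup>2 + z\<^sup>2 + w\<^sup>2) ^ n * (1 + real n * (1 - (x\<^sup>2 + y\<^sup>2 + z\<^sup>2 + w\<^sup>2)))))
    \<le> ennreal ((real n + 1) * arcsine_moment4 n - real n * arcsine_moment4 (Suc n))" (is "?X \<le> _")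
  "0 \<le> (real n + 1) * arcsine_moment4 n - real n * arcsine_moment4 (Suc n)"
proof -
  let ?s = "\<lambda>x y z w. x\<^sup>2 + y\<^sup>2 + z\<^sup>2 + w\<^sup>2 :: real"
  let ?A = "(real n + 1) * arcsine_moment4 n" and ?B = "real n * arcsine_moment4 (Suc n)"
  have nonneg: "0 \<le> ?A" "0 \<le> ?B" by (simp_all add: arcsine_moment4(2))
  have "?X + ennreal (real n) * ennreal (arcsine_moment4 (Suc n)) =
     nn_integral4 arcsine_measure (\<lambda>x y z w. ennreal (?s x y z w ^ n * (1 + real n * (1 - ?s x y z w))) + ennreal (real n) * ennreal (?s x y z w ^ Suc n))"
    by (simp add: nn_integral_add nn_integral_cmult arcsine_moment4(1) del: power_Suc)
  also have "\<dots> \<le> nn_integral4 arcsine_measure (\<lambda>x y z w. ennreal (real n + 1) * ennreal (?s x y z w ^ n))"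
  proof (rule nn_integral4_mono[OF AE_arcsine_measure])
    fix x y z w :: real assume *: "x \<in> {0..<1/2}" "y \<in> {0..<1/2}" "z \<in> {0..<1/2}" "w \<in> {0..<1/2}"
    define s where "s = ?s x y z w"
    have s: "0 \<le> s" "s < 1" using sum_squares_less_1[OF *] by (simp_all add: s_def)
    have "ennreal (s ^ n * (1 + real n * (1 - s))) + ennreal (real n) * ennreal (s ^ Suc n)
      = ennreal (s ^ n * (1 + real n * (1 - s)) + real n * s ^ Suc n)"
      using s by (simp add: ennreal_mult del: power_Suc)
    also have "s ^ n * (1 + real n * (1 - s)) + real n * s ^ Suc n = (real n + 1) * s ^ n"
      by (simp add: algebra_simps)
    also have "ennreal \<dots> = ennreal (real n + 1) * ennreal (s ^ n)"
      using s by (intro ennreal_mult) simp_all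
    finally show "ennreal (?s x y z w ^ n * (1 + real n * (1 - ?s x y z w))) + ennreal (real n) * ennreal (?s x y z w ^ Suc n)
      \<le> ennreal (real n + 1) * ennreal (?s x y z w ^ n)"
      by (simp only: s_def order_refl)
  qed
  also have "\<dots> = ennreal (real n + 1) * ennreal (arcsine_moment4 n)"
    by (simp add: nn_integral_cmult arcsine_moment4(1) del: ennreal_plus)
  finally have le: "?X + ennreal ?B \<le> ennreal ?A"
    using arcsine_moment4(2) by (simp add: ennreal_mult del: ennreal_plus)
  have "ennreal ?B \<le> ?X + ennreal ?B" by simp
  also note le
  finally show "0 \<le> ?A - ?B" using nonneg by (simp add: ennreal_le_iff)
  show "?X \<le> ennreal (?A - ?B)"
  proof (cases ?X)
    case (real r)
    then have "ennreal (r + ?B) \<le> ennreal ?A" using le nonneg by (simp add: ennreal_plus)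
    then have "r + ?B \<le> ?A" using nonneg by (simp add: ennreal_le_iff)
    then show ?thesis unfolding real(2) by (intro ennreal_leI) simp
  next
    case top
    then show ?thesis using le by (simp add: top_unique)
  qed
qed

text \<open>
  The remainder is unbounded near the ideal vertex, where \<open>s = 1\<close>. Replacing \<open>(1 - s)\<^sup>2\<close> by the
  smaller quantity \<open>16 \<Prod> \<surd>(1/4 - x\<^sup>2)\<close> makes it a polynomial integrated against a product of arcsine
  weights.
\<close>
lemma cube_integral_upper:
  "cube_integral \<le> ennreal ((\<Sum>k<n. (real k + 1) * edge_moment4 k) +
     1/16 * ((real n + 1) * arcsine_moment4 n - real n * arcsine_moment4 (Suc n)))"
proof -
  let ?s = "\<lambda>x y z w. x\<^sup>2 + y\<^sup>2 + z\<^sup>2 + w\<^sup>2 :: real"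
  let ?t = "\<lambda>s::real. \<Sum>k<n. ennreal (real k + 1) * ennreal (s ^ k)"
  let ?h = "\<lambda>s::real. s ^ n * (1 + real n * (1 - s))"
  let ?r = "\<lambda>x y z w::real. ennreal (1 / sqrt (1/4 - x\<^sup>2)) * (ennreal (1 / sqrt (1/4 - y\<^sup>2)) *
       (ennreal (1 / sqrt (1/4 - z\<^sup>2)) * (ennreal (1 / sqrt (1/4 - w\<^sup>2)) * ennreal (?h (?s x y z w)))))"
  let ?P = "\<Sum>k<n. (real k + 1) * edge_moment4 k"
  let ?R = "(real n + 1) * arcsine_moment4 n - real n * arcsine_moment4 (Suc n)"
  have "cube_integral \<le> nn_integral4 edge_measure (\<lambda>x y z w. ?t (?s x y z w) + ennreal (1/16) * ?r x y z w)"
    unfolding cube_integral_def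
  proof (rule nn_integral4_mono[OF AE_edge_measure])
    fix x y z w :: real assume *: "x \<in> {0..<1/2}" "y \<in> {0..<1/2}" "z \<in> {0..<1/2}" "w \<in> {0..<1/2}"
    define s where "s = ?s x y z w"
    have s: "0 \<le> s" "s < 1" using sum_squares_less_1[OF *] by (simp_all add: s_def)
    define a b c d where "a = sqrt (1/4 - x\<^sup>2)" and "b = sqrt (1/4 - y\<^sup>2)"
      and "c = sqrt (1/4 - z\<^sup>2)" and "d = sqrt (1/4 - w\<^sup>2)"
    have pos: "0 < a" "0 < b" "0 < c" "0 < d"
      using sum_squares_less_1[OF *] by (simp_all add: a_def b_def c_def d_def)
    have "16 * (a * b * c * d) \<le> ((1/4 - x\<^sup>2) + (1/4 - y\<^sup>2) + (1/4 - z\<^sup>2) + (1/4 - w\<^sup>2))\<^sup>2"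
      unfolding a_def b_def c_def d_def
      by (rule four_term_am_gm) (use sum_squares_less_1[OF *] in simp_all)
    also have "(1/4 - x\<^sup>2) + (1/4 - y\<^sup>2) + (1/4 - z\<^sup>2) + (1/4 - w\<^sup>2) = 1 - s" by (simp add: s_def)
    finally have ge: "16 * (a * b * c * d) \<le> (1 - s)\<^sup>2" .
    have h: "0 \<le> ?h s" using s by simp
    have "?h s / (1 - s)\<^sup>2 \<le> ?h s / (16 * (a * b * c * d))"
      using ge h pos s by (intro divide_left_mono) auto
    also have "\<dots> = 1/16 * (1 / a * (1 / b * (1 / c * (1 / d * ?h s))))" by simp
    finally have "1 / (1 - s)\<^sup>2 \<le> (\<Sum>k<n. (real k + 1) * s ^ k) + 1/16 * (1 / a * (1 / b * (1 / c * (1 / d * ?h s))))"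
      using taylor_remainder[of s n] s(2) by linarith
    then have "cusp_density s \<le> ennreal ((\<Sum>k<n. (real k + 1) * s ^ k) + 1/16 * (1 / a * (1 / b * (1 / c * (1 / d * ?h s)))))"
      unfolding cusp_density_def by (rule ennreal_leI)
    also have "\<dots> = ennreal (\<Sum>k<n. (real k + 1) * s ^ k) + ennreal (1/16 * (1 / a * (1 / b * (1 / c * (1 / d * ?h s)))))"
      using s h pos by (intro ennreal_plus sum_nonneg mult_nonneg_nonneg) auto
    also have "ennreal (1/16 * (1 / a * (1 / b * (1 / c * (1 / d * ?h s))))) =
        ennreal (1/16) * (ennreal (1 / a) * (ennreal (1 / b) * (ennreal (1 / c) * (ennreal (1 / d) * ennreal (?h s)))))"
      using pos h by (simp only: ennreal_mult mult_nonneg_nonneg divide_nonneg_nonneg order_less_imp_le zero_le_one zero_le_numeral)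
    finally show "cusp_density (?s x y z w) \<le> ?t (?s x y z w) + ennreal (1/16) * ?r x y z w"
      using taylor_polynomial_ennreal[OF s(1), of n] by (simp only: s_def a_def b_def c_def d_def)
  qed
  also have "\<dots> = nn_integral4 edge_measure (\<lambda>x y z w. ?t (?s x y z w))
     + ennreal (1/16) * nn_integral4 edge_measure (\<lambda>x y z w. ?r x y z w)"
    by (simp add: nn_integral_add nn_integral_cmult del: ennreal_plus)
  also have "nn_integral4 edge_measure (\<lambda>x y z w. ?r x y z w)
     = nn_integral4 arcsine_measure (\<lambda>x y z w. ennreal (?h (?s x y z w)))"
    by (rule nn_integral_arcsine4[symmetric]) (simp add: case_prod_unfold)
  also have "ennreal (1/16) * \<dots> \<le> ennreal (1/16) * ennreal ?R"
    by (intro mult_left_mono arcsine_remainder(1)) simp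
  also have "ennreal (1/16) * ennreal ?R = ennreal (1/16 * ?R)"
    by (rule ennreal_mult[symmetric], simp, rule arcsine_remainder(2))
  also have "nn_integral4 edge_measure (\<lambda>x y z w. ?t (?s x y z w)) = ennreal ?P"
    by (rule nn_integral_taylor_polynomial)
  also have "ennreal ?P + ennreal (1/16 * ?R) = ennreal (?P + 1/16 * ?R)"
    by (rule ennreal_plus[symmetric])
       (intro sum_nonneg mult_nonneg_nonneg edge_moment4(2) arcsine_remainder(2); simp)+
  finally show ?thesis by simp
qed

lemma binomial_conv_cong:
  assumes "\<And>j. j \<le> k \<Longrightarrow> a j = a' j" "\<And>j. j \<le> k \<Longrightarrow> b j = b' j"
  shows "binomial_conv a b k = binomial_conv a' b' k"
  unfolding binomial_conv_def using assms by (intro sum.cong) auto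

lemma binomial_conv_twice_scale:
  assumes "\<And>j. j \<le> k \<Longrightarrow> a j = c * q ^ j * b j"
  shows "binomial_conv (binomial_conv a a) (binomial_conv a a) k =
    c ^ 4 * q ^ k * binomial_conv (binomial_conv b b) (binomial_conv b b) k"
proof -
  have "binomial_conv a a j = (c * c) * q ^ j * binomial_conv b b j" if "j \<le> k" for j
    using that assms by (subst binomial_conv_scale[symmetric], intro binomial_conv_cong) auto
  then have "binomial_conv (binomial_conv a a) (binomial_conv a a) k =
     (c * c) * (c * c) * q ^ k * binomial_conv (binomial_conv b b) (binomial_conv b b) k"
    by (subst binomial_conv_scale[symmetric], intro binomial_conv_cong) auto
  then show ?thesis by (simp add: power4_eq_xxxx mult.assoc)
qed

lemma binomial_conv_twice_mono:
  assumes "\<And>j. j \<le> k \<Longrightarrow> 0 \<le> a j \<and> a j \<le> b j"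
  shows "binomial_conv (binomial_conv a a) (binomial_conv a a) k \<le> binomial_conv (binomial_conv b b) (binomial_conv b b) k"
proof -
  have "0 \<le> binomial_conv a a j \<and> binomial_conv a a j \<le> binomial_conv b b j" if "j \<le> k" for j
  proof
    show "0 \<le> binomial_conv a a j"
      unfolding binomial_conv_def using assms that by (intro sum_nonneg mult_nonneg_nonneg) auto
    show "binomial_conv a a j \<le> binomial_conv b b j"
      using assms that by (intro binomial_conv_mono) auto
  qed
  then show ?thesis by (intro binomial_conv_mono) auto
qed

lemma binomial_conv_list_real:
  assumes "k < length ys" "length ys \<le> length xs"
  shows "real_of_int (binomial_conv_list xs ys ! k) = binomial_conv (\<lambda>j. real_of_int (xs ! j)) (\<lambda>j. real_of_int (ys ! j)) k"
  unfolding binomial_conv_def by (subst binomial_conv_list_nth[OF assms]) simp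

lemma fourfold_nth:
  fixes xs :: "int list"
  defines "x \<equiv> \<lambda>j. real_of_int (xs ! j)"
  assumes "k < length xs"
  shows "real_of_int (fourfold xs ! k) = binomial_conv (binomial_conv x x) (binomial_conv x x) k"
proof -
  let ?ys = "binomial_conv_list xs xs"
  have len: "length ?ys = length xs" by (simp add: binomial_conv_list_def)
  have y: "real_of_int (?ys ! j) = binomial_conv x x j" if "j < length xs" for j
    unfolding x_def using that by (intro binomial_conv_list_real) auto
  have "real_of_int (fourfold xs ! k) = binomial_conv (\<lambda>j. real_of_int (?ys ! j)) (\<lambda>j. real_of_int (?ys ! j)) k"
    unfolding fourfold_def Let_def by (rule binomial_conv_list_real) (simp_all add: len assms)
  also have "\<dots> = binomial_conv (binomial_conv x x) (binomial_conv x x) k"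
    using assms(2) by (intro binomial_conv_cong y) auto
  finally show ?thesis .
qed

lemma edge_moment4_fourfold:
  fixes xs :: "int list"
  assumes k: "k < length xs"
  defines "F \<equiv> 1 / 16 * (1/4) ^ k * (fourfold xs ! k / 10 ^ 20)"
  shows "(\<And>j. j < length xs \<Longrightarrow> 0 \<le> xs ! j \<and> xs ! j \<le> 10^5 / real (2 * j + 1)) \<Longrightarrow> F \<le> edge_moment4 k"
    "(\<And>j. j < length xs \<Longrightarrow> 10^5 / real (2 * j + 1) \<le> xs ! j) \<Longrightarrow> edge_moment4 k \<le> F"
proof -
  define u where "u j = 1 / real (2 * j + 1)" for j :: nat
  define x where "x j = real_of_int (xs ! j) / 10 ^ 5" for j
  have e: "edge_moment4 k = (1/2) ^ 4 * (1/4) ^ k * binomial_conv (binomial_conv u u) (binomial_conv u u) k"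
    unfolding edge_moment4_def Let_def by (rule binomial_conv_twice_scale) (simp add: u_def)
  have "binomial_conv (binomial_conv x x) (binomial_conv x x) k = (1 / 10 ^ 5) ^ 4 * 1 ^ k * real_of_int (fourfold xs ! k)"
    unfolding fourfold_nth[OF k] by (rule binomial_conv_twice_scale) (simp add: x_def)
  then have "binomial_conv (binomial_conv x x) (binomial_conv x x) k = fourfold xs ! k / 10 ^ 20"
    by (simp add: power_divide)
  then have F: "F = (1/2) ^ 4 * (1/4) ^ k * binomial_conv (binomial_conv x x) (binomial_conv x x) k"
    unfolding F_def by (simp only:) (simp add: power_divide)
  show "F \<le> edge_moment4 k" if *: "\<And>j. j < length xs \<Longrightarrow> 0 \<le> xs ! j \<and> xs ! j \<le> 10^5 / real (2 * j + 1)"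
    unfolding e F using k * by (intro mult_left_mono binomial_conv_twice_mono) (fastforce simp: x_def u_def field_simps)+
  show "edge_moment4 k \<le> F" if *: "\<And>j. j < length xs \<Longrightarrow> 10^5 / real (2 * j + 1) \<le> xs ! j"
    unfolding e F using k * by (intro mult_left_mono binomial_conv_twice_mono) (fastforce simp: x_def u_def field_simps)+
qed

lemma weighted_sum_fourfold:
  assumes "length xs = n" "n > 0"
  shows "(\<Sum>k<n. (real k + 1) * (1 / 16 * (1/4) ^ k * (fourfold xs ! k / 10 ^ 20))) =
    weighted_sum 0 1 (fourfold xs) / (4 ^ (n + 1) * 10 ^ 20)"
proof -
  have "(\<Sum>k<n. (1 + int k) * (fourfold xs ! k) * (1/4) ^ Suc k) = 4 * 10 ^ 20 * (\<Sum>k<n. (real k + 1) * (1 / 16 * (1/4) ^ k * (fourfold xs ! k / 10 ^ 20)))"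
    unfolding sum_distrib_left by (intro sum.cong) (simp_all add: algebra_simps)
  then show ?thesis using weighted_sum[of 0 1 "fourfold xs"] assms(1) by simp
qed

lemma odd_reciprocals:
  assumes "j < 32"
  shows "0 \<le> odd_reciprocals_below ! j" "odd_reciprocals_below ! j \<le> 10^5 / real (2 * j + 1)"
    "10^5 / real (2 * j + 1) \<le> odd_reciprocals_above ! j"
proof -
  have n: "odd_reciprocals_below ! j = 10^5 div (2 * int j + 1)" "odd_reciprocals_above ! j = 10^5 div (2 * int j + 1) + 1"
    using assms by (simp_all add: odd_reciprocals_below_def odd_reciprocals_above_def nth_upto)
  show "0 \<le> odd_reciprocals_below ! j" unfolding n by (simp add: pos_imp_zdiv_nonneg_iff)
  show "odd_reciprocals_below ! j \<le> 10^5 / real (2 * j + 1)"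
    unfolding n using real_of_int_div4[of "10^5" "2 * int j + 1"] by (simp add: add.commute)
  show "10^5 / real (2 * j + 1) \<le> odd_reciprocals_above ! j"
    unfolding n using real_of_int_div3[of "10^5" "2 * int j + 1"] by (simp add: add.commute)
qed

lemma length_odd_reciprocals [simp]: "length odd_reciprocals_below = 32" "length odd_reciprocals_above = 32"
  by (simp_all add: odd_reciprocals_below_def odd_reciprocals_above_def)

lemma cube_integral_ge: "ennreal 0.17479 \<le> cube_integral"
proof -
  have "0.17479 \<le> weighted_sum 0 1 (fourfold odd_reciprocals_below) / (4 ^ (32 + 1) * 10 ^ 20 :: real)"
    using weighted_sum_below by (simp add: field_simps del: weighted_sum.simps)
  also have "\<dots> = (\<Sum>k<32. (real k + 1) * (1 / 16 * (1/4) ^ k * (fourfold odd_reciprocals_below ! k / 10 ^ 20)))"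
    by (rule weighted_sum_fourfold[symmetric]) simp_all
  also have "\<dots> \<le> (\<Sum>k<32. (real k + 1) * edge_moment4 k)"
  proof (rule sum_mono)
    fix k :: nat assume "k \<in> {..<32}"
    then show "(real k + 1) * (1 / 16 * (1/4) ^ k * (fourfold odd_reciprocals_below ! k / 10 ^ 20)) \<le> (real k + 1) * edge_moment4 k"
      using odd_reciprocals by (intro mult_left_mono edge_moment4_fourfold(1)) auto
  qed
  finally have "ennreal 0.17479 \<le> ennreal (\<Sum>k<32. (real k + 1) * edge_moment4 k)" by (rule ennreal_leI)
  also have "\<dots> \<le> cube_integral" by (rule cube_integral_lower)
  finally show ?thesis .
qed

lemma arcsine_moment_central_binomials:
  "j < 34 \<Longrightarrow> arcsine_moment j = (1/16) ^ j * real_of_int (central_binomials ! j)"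
proof (induction j)
  case (Suc j)
  have "(int j + 1) * central_binomials ! Suc j = (4 * int j + 2) * central_binomials ! j"
    using central_binomials_rec Suc.prems
    by (auto simp: list_all_length nth_tl nth_upto dest!: spec[of _ j])
  then have "real_of_int ((int j + 1) * central_binomials ! Suc j) = real_of_int ((4 * int j + 2) * central_binomials ! j)"
    by (rule arg_cong)
  then have "real_of_int (central_binomials ! Suc j) = 16 * (real_of_int (central_binomials ! j) * (2 * real j + 1) / (8 * (real j + 1)))"
    by (simp add: field_simps)
  then show ?case using Suc by simp
qed (simp add: central_binomials_def)

lemma arcsine_moment4_fourfold:
  assumes "k < 34"
  shows "arcsine_moment4 k = (pi / 2) ^ 4 * (1/16) ^ k * real_of_int (fourfold central_binomials ! k)"
proof -
  have "k < length central_binomials" using assms central_binomials_rec by simp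
  then show ?thesis
    unfolding arcsine_moment4_def Let_def fourfold_nth[OF \<open>k < length central_binomials\<close>]
    using assms by (intro binomial_conv_twice_scale) (simp add: arcsine_moment_central_binomials)
qed

lemma cube_integral_le: "cube_integral \<le> ennreal 0.17668"
proof -
  have "(\<Sum>k<32. (real k + 1) * edge_moment4 k)
    \<le> (\<Sum>k<32. (real k + 1) * (1 / 16 * (1/4) ^ k * (fourfold odd_reciprocals_above ! k / 10 ^ 20)))"
  proof (rule sum_mono)
    fix k :: nat assume "k \<in> {..<32}"
    then show "(real k + 1) * edge_moment4 k \<le> (real k + 1) * (1 / 16 * (1/4) ^ k * (fourfold odd_reciprocals_above ! k / 10 ^ 20))"
      using odd_reciprocals by (intro mult_left_mono edge_moment4_fourfold(2)) auto
  qed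
  also have "\<dots> = weighted_sum 0 1 (fourfold odd_reciprocals_above) / (4 ^ (32 + 1) * 10 ^ 20 :: real)"
    by (rule weighted_sum_fourfold) simp_all
  also have "\<dots> \<le> 0.174814"
    using weighted_sum_above by (simp add: field_simps del: weighted_sum.simps)
  finally have 1: "(\<Sum>k<32. (real k + 1) * edge_moment4 k) \<le> 0.174814" .
  let ?c = "fourfold central_binomials"
  have "(pi / 2) ^ 4 \<le> (3.1416 / 2) ^ 4" using pi_approx(2) by (intro power_mono) auto
  then have pi4: "(pi / 2) ^ 4 \<le> 6.0882" by (simp add: power4_eq_xxxx)
  define c32 c33 where "c32 = real_of_int (?c ! 32)" and "c33 = real_of_int (?c ! 33)"
  define B :: real where "B = 26534518 * 10 ^ 30 / 16 ^ 33"
  have "real_of_int (33 * 16 * ?c ! 32 - 32 * ?c ! 33) \<le> real_of_int (26534518 * 10 ^ 30)"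
    using central_binomials_tail unfolding Let_def of_int_le_iff .
  then have c: "(33 * 16 * c32 - 32 * c33) / 16 ^ 33 \<le> B"
    unfolding B_def c32_def c33_def by (intro divide_right_mono) simp_all
  have "(real 32 + 1) * arcsine_moment4 32 - real 32 * arcsine_moment4 (Suc 32)
      = 33 * ((pi / 2) ^ 4 * (1/16) ^ 32 * c32) - 32 * ((pi / 2) ^ 4 * (1/16) ^ 33 * c33)"
    using arcsine_moment4_fourfold[of 32] arcsine_moment4_fourfold[of 33] by (simp add: c32_def c33_def)
  also have "\<dots> = (pi / 2) ^ 4 * ((33 * 16 * c32 - 32 * c33) / 16 ^ 33)"
    by (simp add: power_one_over algebra_simps diff_divide_distrib)
  also have "\<dots> \<le> (pi / 2) ^ 4 * B"
    by (intro mult_left_mono c) simp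
  also have "\<dots> \<le> 6.0882 * B"
    by (intro mult_right_mono pi4) (simp add: B_def)
  finally have 2: "1/16 * ((real 32 + 1) * arcsine_moment4 32 - real 32 * arcsine_moment4 (Suc 32)) \<le> 0.001855"
    by (simp add: B_def)
  have "cube_integral \<le> ennreal ((\<Sum>k<32. (real k + 1) * edge_moment4 k) +
     1/16 * ((real 32 + 1) * arcsine_moment4 32 - real 32 * arcsine_moment4 (Suc 32)))"
    by (rule cube_integral_upper)
  also have "\<dots> \<le> ennreal 0.17668" by (intro ennreal_leI order.trans[OF add_mono[OF 1 2]]) simp
  finally show ?thesis .
qed

section \<open>The volume of hyperbolic balls\<close>

text \<open>The Lorentz reflection that exchanges the two points.\<close>
lemma lorentz_isometry_to_point:
  fixes P :: "real \<times> 'a::euclidean_space"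
  assumes P: "lorentz P P = -1" "fst P > 0"
  obtains f :: "real \<times> 'a \<Rightarrow> real \<times> 'a" where
    "linear f" "\<And>x y. lorentz (f x) (f y) = lorentz x y" "f (1, 0) = P"
    "\<And>p. lorentz p p < 0 \<Longrightarrow> fst (f p) > 0 \<longleftrightarrow> fst p > 0"
proof -
  define e :: "real \<times> 'a" where "e = (1, 0)"
  have e: "lorentz e e = -1" "fst e > 0" by (simp_all add: e_def lorentz_def)
  have time: "fst (f p) > 0 \<longleftrightarrow> fst p > 0"
    if f: "\<And>x y. lorentz (f x) (f y) = lorentz x y" "f e = P" and p: "lorentz p p < 0" for f :: "real \<times> 'a \<Rightarrow> real \<times> 'a" and p
  proof -
    have "p \<noteq> 0" "f p \<noteq> 0" using p f(1)[of p p] by auto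
    then show ?thesis
      using lorentz_neg_of_future[of e p] lorentz_neg_of_future[of P "f p"] e P p f(1)[of p p] f(1)[of e p] f(2)
      by simp
  qed
  show thesis
  proof (cases "P = e")
    case True
    show thesis by (rule that[of id]) (use True in \<open>simp_all add: e_def linear_id\<close>)
  next
    case False
    define u where "u = P - e"
    define f where "f x = x - (2 * lorentz x u / lorentz u u) *\<^sub>R u" for x
    have uu: "lorentz u u = - 2 * (1 + lorentz e P)"
      by (simp add: u_def e P lorentz_commute[of P e])
    have "norm (snd P) \<noteq> 0"
    proof
      assume 0: "norm (snd P) = 0"
      then have "(fst P)\<^sup>2 = 1" using P(1) by (simp add: lorentz_self)
      then have "fst P = 1" using P(2) by (simp add: power2_eq_1_iff)
      then show False using 0 False by (simp add: e_def prod_eq_iff)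
    qed
    then have "0 < (norm (snd P))\<^sup>2" by simp
    then have "1 < (fst P)\<^sup>2" using P(1) unfolding lorentz_self by linarith
    then have "1\<^sup>2 < (fst P)\<^sup>2" by simp
    then have "1 < fst P" by (rule power2_less_imp_less) (use P(2) in simp)
    then have nz: "lorentz u u \<noteq> 0" unfolding uu by (simp add: e_def lorentz_def)
    have lin: "linear f"
      by (rule linearI) (simp_all add: f_def add_divide_distrib algebra_simps)
    have iso: "lorentz (f x) (f y) = lorentz x y" for x y
    proof -
      define k where "k = lorentz u u"
      have "lorentz (f x) (f y) = lorentz x y - 2 * lorentz y u / k * lorentz x u - 2 * lorentz x u / k * lorentz y u
          + 2 * lorentz x u / k * (2 * lorentz y u / k) * k"
        unfolding f_def lorentz_simps k_def[symmetric] lorentz_commute[of u y] by (simp only: algebra_simps)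
      also have "\<dots> = lorentz x y" using nz by (simp add: k_def[symmetric] field_simps)
      finally show ?thesis .
    qed
    have "lorentz e u = 1 + lorentz e P" by (simp add: u_def e)
    then have "2 * lorentz e u / lorentz u u = - 1" using nz uu by (simp add: field_simps)
    then have fe: "f e = P" by (simp add: f_def u_def)
    show thesis by (rule that[of f]) (use lin iso fe time[OF iso fe] in \<open>simp_all add: e_def\<close>)
  qed
qed

lemma hyp_ball_borel:
  assumes "c \<in> hyp_space" "0 \<le> r"
  shows "hyp_ball c r \<in> sets borel"
proof -
  have "hyp_ball c r = {y \<in> space borel. y \<in> hyp_space \<and> - lorentz (hyperboloid_point c) ((1 / sqrt (1 - (norm y)\<^sup>2)) *\<^sub>R (1, y)) \<le> cosh r}"
    using hyp_ball_iff[OF assms] by (auto simp: hyperboloid_point_def[of y for y])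
  also have "\<dots> \<in> sets borel" unfolding lorentz_def fst_scaleR snd_scaleR fst_conv snd_conv by measurable
  finally show ?thesis .
qed

lemma hyp_cone_hyp_ball:
  assumes "c \<in> hyp_space" "0 \<le> r"
  shows "hyp_cone (hyp_ball c r) = {p. 0 < fst p \<and> lorentz p p < 0 \<and>
    - lorentz (hyperboloid_point c) p \<le> cosh r * sqrt (- lorentz p p) \<and> - lorentz p p \<le> 1}"
proof -
  have "snd p /\<^sub>R fst p \<in> hyp_ball c r \<longleftrightarrow> - lorentz (hyperboloid_point c) p \<le> cosh r * sqrt (- lorentz p p)"
    if p: "0 < fst p" "lorentz p p < 0" for p
    unfolding hyp_ball_iff[OF assms] hyperboloid_point_of_timelike[OF p(2,1)]
    using timelike_in_hyp_space[OF p(2)] p(2) by (simp add: field_simps)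
  then show ?thesis unfolding hyp_cone_def by blast
qed

lemma zero_hyp_space: "0 \<in> hyp_space"
  by (simp add: hyp_space_def)

lemma hyperboloid_point_0: "hyperboloid_point 0 = (1, 0)"
  by (simp add: hyperboloid_point_def)

lemma emeasure_hyp_ball_center:
  fixes c :: "'a::euclidean_space"
  assumes dim: "DIM('a) = 5" and c: "c \<in> hyp_space" and r: "0 \<le> r"
  shows "emeasure hyp_measure (hyp_ball c r) = emeasure hyp_measure (hyp_ball (0 :: 'a) r)"
proof -
  obtain f :: "real \<times> 'a \<Rightarrow> real \<times> 'a" where f: "linear f" "\<And>x y. lorentz (f x) (f y) = lorentz x y"
    "f (1, 0) = hyperboloid_point c" "\<And>p. lorentz p p < 0 \<Longrightarrow> fst (f p) > 0 \<longleftrightarrow> fst p > 0"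
    using lorentz_isometry_to_point[OF lorentz_hyperboloid_point[OF c]] by metis
  have meas: "f \<in> borel_measurable borel"
    using f(1) by (intro borel_measurable_continuous_onI linear_continuous_on) (simp add: linear_conv_bounded_linear)
  have "lorentz (hyperboloid_point c) (f p) = lorentz (hyperboloid_point 0) p" for p
    using f(2)[of "(1, 0)" p] by (simp add: f(3) hyperboloid_point_0)
  then have "f -` hyp_cone (hyp_ball c r) = hyp_cone (hyp_ball 0 r)"
    using f(4) by (auto simp: hyp_cone_hyp_ball c r zero_hyp_space f(2))
  moreover have "distr lborel borel f = lborel"
    by (rule lborel_distr_lorentz_isometry) (simp_all add: dim f)
  then have "emeasure lborel (hyp_cone (hyp_ball c r)) = emeasure lborel (f -` hyp_cone (hyp_ball c r))"
    using emeasure_distr[of f lborel borel "hyp_cone (hyp_ball c r)"] meas hyp_cone_borel[OF hyp_ball_borel[OF c r]] by simp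
  ultimately show ?thesis
    by (simp add: emeasure_hyp_measure hyp_ball_borel c r zero_hyp_space)
qed

lemma hyp_ball_0:
  assumes "0 \<le> r"
  shows "hyp_ball 0 r = cball 0 (sinh r / cosh r)"
proof (rule set_eqI)
  fix y :: 'a
  have C: "cosh r > 0" and S: "0 \<le> sinh r" using assms by (simp_all add: cosh_real_pos)
  have R: "(sinh r / cosh r)\<^sup>2 = 1 - 1 / (cosh r)\<^sup>2" "sinh r / cosh r < 1"
    using C by (simp_all add: power_divide sinh_square_eq diff_divide_distrib sinh_less_cosh_real)
  have "y \<in> hyp_ball 0 r \<longleftrightarrow> (norm y)\<^sup>2 < 1 \<and> 1 / sqrt (1 - (norm y)\<^sup>2) \<le> cosh r"
    by (simp add: hyp_ball_iff zero_hyp_space assms hyperboloid_point_0 hyp_space_iff)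
       (simp add: hyperboloid_point_def lorentz_def)
  also have "\<dots> \<longleftrightarrow> (norm y)\<^sup>2 \<le> (sinh r / cosh r)\<^sup>2"
  proof (cases "(norm y)\<^sup>2 < 1")
    case True
    then have "1 / sqrt (1 - (norm y)\<^sup>2) \<le> cosh r \<longleftrightarrow> 1 / cosh r \<le> sqrt (1 - (norm y)\<^sup>2)"
      using C by (simp add: field_simps)
    also have "\<dots> \<longleftrightarrow> (1 / cosh r)\<^sup>2 \<le> 1 - (norm y)\<^sup>2"
    proof -
      have "1 / cosh r = sqrt ((1 / cosh r)\<^sup>2)" using C by simp
      then show ?thesis by (metis real_sqrt_le_iff)
    qed
    finally show ?thesis using True unfolding R by (auto simp: power_divide)
  next
    case False
    have "(sinh r / cosh r)\<^sup>2 < 1" unfolding R using C by simp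
    then show ?thesis using False by linarith
  qed
  also have "\<dots> \<longleftrightarrow> norm y \<le> sinh r / cosh r"
    using S C by (simp add: abs_le_square_iff[symmetric] del: power_divide)
  finally show "y \<in> hyp_ball 0 r \<longleftrightarrow> y \<in> cball 0 (sinh r / cosh r)" by simp
qed

text \<open>
  The density with respect to Lebesgue measure is at least \<open>1\<close>.
\<close>
lemma hyp_measure_ge_lborel:
  assumes [measurable]: "A \<in> sets borel" and "A \<subseteq> hyp_space"
  shows "emeasure lborel A \<le> emeasure hyp_measure A"
proof -
  have "emeasure lborel A = (\<integral>\<^sup>+y. indicator A y \<partial>lborel)" by simp
  also have "\<dots> \<le> (\<integral>\<^sup>+y. ennreal ((1 - (norm y)\<^sup>2) powr (- (real DIM('a) + 1) / 2)) * indicator hyp_space y * indicator A y \<partial>lborel)"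
  proof (rule nn_integral_mono)
    fix y :: 'a
    show "indicator A y \<le> ennreal ((1 - (norm y)\<^sup>2) powr (- (real DIM('a) + 1) / 2)) * indicator hyp_space y * indicator A y"
    proof (cases "y \<in> A")
      case True
      then have y: "y \<in> hyp_space" "(norm y)\<^sup>2 < 1" using assms(2) hyp_space_iff by auto
      have "1 \<le> (1 - (norm y)\<^sup>2) powr (- (real DIM('a) + 1) / 2)"
        using powr_mono'[of "- (real DIM('a) + 1) / 2" 0 "1 - (norm y)\<^sup>2"] y(2) by simp
      then show ?thesis using True y by simp
    qed simp
  qed
  also have "\<dots> = emeasure hyp_measure A"
    unfolding hyp_measure_def by (rule emeasure_density[symmetric]) measurable
  finally show ?thesis .
qed

text \<open>
  The factor \<open>t\<close>, which is between \<open>1\<close> and \<open>C\<close>, makes the integrand elementary.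
\<close>
lemma has_integral_ball_correction:
  assumes "1 \<le> (C::real)"
  shows "((\<lambda>t. t * sqrt (t\<^sup>2 - 1) ^ 5) has_integral sqrt (C\<^sup>2 - 1) ^ 7 / 7) {1..C}"
proof -
  have "((\<lambda>t. t * sqrt (t\<^sup>2 - 1) ^ 5) has_integral sqrt (C\<^sup>2 - 1) ^ 7 / 7 - sqrt (1\<^sup>2 - 1) ^ 7 / 7) {1..C}"
  proof (rule fundamental_theorem_of_calculus_interior)
    show "continuous_on {1..C} (\<lambda>t. sqrt (t\<^sup>2 - 1) ^ 7 / 7)" by (intro continuous_intros) simp
    fix t assume "t \<in> {1<..<C}"
    then have "1 < t\<^sup>2" by (simp add: one_less_power)
    then have p: "0 < t\<^sup>2 - 1" by simp
    define r where "r = sqrt (t\<^sup>2 - 1)"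
    have r: "r > 0" using p by (simp add: r_def)
    have "((\<lambda>t. sqrt (t\<^sup>2 - 1)) has_real_derivative t / r) (at t)"
      using p by (auto intro!: derivative_eq_intros simp: r_def field_simps)
    then have "((\<lambda>t. sqrt (t\<^sup>2 - 1) ^ 7 / 7) has_real_derivative (7 * (t / r * r ^ 6)) / 7) (at t)"
      using DERIV_cdivide[OF DERIV_power[of "\<lambda>t. sqrt (t\<^sup>2 - 1)" "t / r" t UNIV 7], of 7] by (simp add: r_def ac_simps)
    also have "(7 * (t / r * r ^ 6)) / 7 = t * r ^ 5" using r by (simp add: eval_nat_numeral)
    finally show "((\<lambda>t. sqrt (t\<^sup>2 - 1) ^ 7 / 7) has_vector_derivative t * sqrt (t\<^sup>2 - 1) ^ 5) (at t)"
      by (simp add: has_real_derivative_iff_has_vector_derivative r_def)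
  qed (use assms in simp)
  then show ?thesis by simp
qed

lemma nn_integral_ball_correction:
  assumes C: "1 \<le> (C::real)" and S: "S = sqrt (C\<^sup>2 - 1)"
  shows "(\<integral>\<^sup>+t. ennreal (sqrt (t\<^sup>2 - 1) ^ 5) * indicator {1..C} t \<partial>lborel) \<le> ennreal (S ^ 7 / 7)"
    "ennreal (S ^ 7 / (7 * C)) \<le> (\<integral>\<^sup>+t. ennreal (sqrt (t\<^sup>2 - 1) ^ 5) * indicator {1..C} t \<partial>lborel)"
proof -
  have pos: "0 \<le> sqrt (t\<^sup>2 - 1)" if "t \<in> {1..C}" for t using that by (simp add: one_le_power)
  have I: "(\<integral>\<^sup>+t. ennreal (t * sqrt (t\<^sup>2 - 1) ^ 5) * indicator {1..C} t \<partial>lborel) = ennreal (S ^ 7 / 7)"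
    unfolding S by (rule nn_integral_has_integral_lebesgue'[OF _ has_integral_ball_correction[OF C]])
      (use pos in \<open>auto intro!: mult_nonneg_nonneg\<close>)
  have J: "(\<integral>\<^sup>+t. ennreal (t * sqrt (t\<^sup>2 - 1) ^ 5 / C) * indicator {1..C} t \<partial>lborel) = ennreal (S ^ 7 / 7 / C)"
    unfolding S by (rule nn_integral_has_integral_lebesgue'[OF _ has_integral_divide[OF has_integral_ball_correction[OF C]]])
      (use pos C in \<open>auto intro!: divide_nonneg_nonneg mult_nonneg_nonneg\<close>)
  show "(\<integral>\<^sup>+t. ennreal (sqrt (t\<^sup>2 - 1) ^ 5) * indicator {1..C} t \<partial>lborel) \<le> ennreal (S ^ 7 / 7)"
    unfolding I[symmetric]
  proof (rule nn_integral_mono)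
    fix t
    have "sqrt (t\<^sup>2 - 1) ^ 5 \<le> t * sqrt (t\<^sup>2 - 1) ^ 5" if "t \<in> {1..C}"
      using mult_right_mono[of 1 t "sqrt (t\<^sup>2 - 1) ^ 5"] pos[OF that] that by simp
    then show "ennreal (sqrt (t\<^sup>2 - 1) ^ 5) * indicator {1..C} t \<le> ennreal (t * sqrt (t\<^sup>2 - 1) ^ 5) * indicator {1..C} t"
      by (auto simp: indicator_def intro: ennreal_leI)
  qed
  have "ennreal (S ^ 7 / 7 / C) \<le> (\<integral>\<^sup>+t. ennreal (sqrt (t\<^sup>2 - 1) ^ 5) * indicator {1..C} t \<partial>lborel)"
    unfolding J[symmetric]
  proof (rule nn_integral_mono)
    fix t
    have "t * sqrt (t\<^sup>2 - 1) ^ 5 / C \<le> sqrt (t\<^sup>2 - 1) ^ 5" if "t \<in> {1..C}"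
      using mult_right_mono[of t C "sqrt (t\<^sup>2 - 1) ^ 5"] pos[OF that] that C by (simp add: field_simps)
    then show "ennreal (t * sqrt (t\<^sup>2 - 1) ^ 5 / C) * indicator {1..C} t \<le> ennreal (sqrt (t\<^sup>2 - 1) ^ 5) * indicator {1..C} t"
      by (auto simp: indicator_def intro: ennreal_leI)
  qed
  then show "ennreal (S ^ 7 / (7 * C)) \<le> (\<integral>\<^sup>+t. ennreal (sqrt (t\<^sup>2 - 1) ^ 5) * indicator {1..C} t \<partial>lborel)"
    by (simp add: mult.commute)
qed


text \<open>
  The cone over a ball of radius \<open>R = tanh r\<close> is the solid cone \<open>|x| \<le> R t\<close>, \<open>t \<le> cosh r\<close> minus its
  part above the hyperboloid.
\<close>
lemma hyp_ball_volume:
  assumes dim: "DIM('a::euclidean_space) = 5" and r: "0 < r"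
  defines "V \<equiv> unit_ball_vol 5" and "S \<equiv> sinh r" and "C \<equiv> cosh r"
  shows "emeasure hyp_measure (hyp_ball (0::'a) r) < \<infinity>"
    "V * (S ^ 5 * C - 6 / 7 * S ^ 7) \<le> measure hyp_measure (hyp_ball (0::'a) r)"
    "measure hyp_measure (hyp_ball (0::'a) r) \<le> V * (S ^ 5 * C - 6 / 7 * (S ^ 7 / C))"
proof -
  have S: "0 < S" using r by (simp add: S_def)
  have CS: "C\<^sup>2 = 1 + S\<^sup>2" by (simp add: C_def S_def cosh_square_eq)
  have "1\<^sup>2 < C\<^sup>2" unfolding CS using S by simp
  then have C: "1 < C" by (rule power2_less_imp_less) (simp add: C_def cosh_real_nonneg)
  have SC: "S = sqrt (C\<^sup>2 - 1)" using S by (simp add: CS)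
  have V: "0 \<le> V" by (simp add: V_def)
  define R where "R = S / C"
  have "R\<^sup>2 = (C\<^sup>2 - 1) / C\<^sup>2" by (simp add: R_def power_divide CS)
  also have "\<dots> = 1 - 1 / C\<^sup>2" using C by (simp add: diff_divide_distrib)
  finally have R: "0 < R" "R\<^sup>2 = 1 - 1 / C\<^sup>2" using S C by (simp_all add: R_def)
  have R1: "R\<^sup>2 < 1" using R C by simp
  define X where "X = hyp_cone (cball (0::'a) R)"
  define Y where "Y = {p :: real \<times> 'a. 1 < fst p \<and> fst p \<le> C \<and> norm (snd p) < sqrt ((fst p)\<^sup>2 - 1)}"
  define Z where "Z = {p :: real \<times> 'a. 0 < fst p \<and> fst p \<le> C \<and> norm (snd p) \<le> R * fst p}"
  have memX: "p \<in> X \<longleftrightarrow> p \<in> Z \<and> p \<notin> Y" for p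
  proof -
    define t n where "t = fst p" and "n = norm (snd p)"
    have l: "lorentz p p = n\<^sup>2 - t\<^sup>2" by (simp add: lorentz_self t_def n_def)
    have n: "0 \<le> n" by (simp add: n_def)
    have sq: "n \<le> R * t \<longleftrightarrow> n\<^sup>2 \<le> R\<^sup>2 * t\<^sup>2" if "0 < t"
      using that n R(1) by (simp add: power_mult_distrib[symmetric] power2_le_iff_abs_le abs_mult)
    have X: "p \<in> X \<longleftrightarrow> 0 < t \<and> n\<^sup>2 < t\<^sup>2 \<and> n \<le> R * t \<and> t\<^sup>2 - n\<^sup>2 \<le> 1"
      by (auto simp: X_def hyp_cone_def l t_def[symmetric] n_def[symmetric] field_simps)
    have Y: "p \<in> Y \<longleftrightarrow> 1 < t \<and> t \<le> C \<and> n\<^sup>2 < t\<^sup>2 - 1"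
    proof -
      have "n < sqrt (t\<^sup>2 - 1) \<longleftrightarrow> n\<^sup>2 < t\<^sup>2 - 1" using n real_sqrt_less_iff[of "n\<^sup>2" "t\<^sup>2 - 1"] by simp
      then show ?thesis by (simp add: Y_def t_def n_def)
    qed
    have Z: "p \<in> Z \<longleftrightarrow> 0 < t \<and> t \<le> C \<and> n \<le> R * t" by (simp add: Z_def t_def n_def)
    show ?thesis
    proof (cases "0 < t \<and> n \<le> R * t")
      case True
      then have "n\<^sup>2 \<le> R\<^sup>2 * t\<^sup>2" using sq by simp
      also have "R\<^sup>2 * t\<^sup>2 < 1 * t\<^sup>2" using R1 True by (intro mult_strict_right_mono) auto
      finally have lt: "n\<^sup>2 < t\<^sup>2" by simp
      have tC: "t \<le> C" if "t\<^sup>2 - n\<^sup>2 \<le> 1"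
      proof -
        have "t\<^sup>2 - R\<^sup>2 * t\<^sup>2 \<le> 1" using that \<open>n\<^sup>2 \<le> R\<^sup>2 * t\<^sup>2\<close> by linarith
        then have "t\<^sup>2 / C\<^sup>2 \<le> 1" unfolding R by (simp add: algebra_simps)
        then have "t\<^sup>2 \<le> C\<^sup>2" using C by (simp add: field_simps)
        then show ?thesis by (rule power2_le_imp_le) (use C in simp)
      qed
      have t1: "1 < t" if "\<not> t\<^sup>2 - n\<^sup>2 \<le> 1"
      proof -
        have "1\<^sup>2 < t\<^sup>2" using that zero_le_power2[of n] unfolding one_power2 by linarith
        then show ?thesis by (rule power2_less_imp_less) (use True in simp)
      qed
      show ?thesis unfolding X Y Z using True lt tC t1 by auto
    next
      case False
      then show ?thesis unfolding X Z by auto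
    qed
  qed
  have YZ: "Y \<subseteq> Z"
  proof
    fix p assume "p \<in> Y"
    then have p: "1 < fst p" "fst p \<le> C" "norm (snd p) < sqrt ((fst p)\<^sup>2 - 1)" by (auto simp: Y_def)
    have "(fst p)\<^sup>2 - 1 \<le> R\<^sup>2 * (fst p)\<^sup>2"
    proof -
      have "(fst p)\<^sup>2 \<le> C\<^sup>2" using p by (intro power_mono) auto
      then have "(fst p)\<^sup>2 / C\<^sup>2 \<le> 1" using C by (simp add: field_simps)
      then show ?thesis unfolding R by (simp add: algebra_simps)
    qed
    then have "sqrt ((fst p)\<^sup>2 - 1) \<le> sqrt ((R * fst p)\<^sup>2)" by (simp add: power_mult_distrib)
    then have "sqrt ((fst p)\<^sup>2 - 1) \<le> R * fst p" using p R(1) by simp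
    then show "p \<in> Z" using p by (auto simp: Z_def)
  qed
  have Xd: "X = Z - Y" using memX by blast
  have "{p \<in> space (borel \<Otimes>\<^sub>M borel). 1 < fst p \<and> fst p \<le> C \<and> norm (snd p) < sqrt ((fst p)\<^sup>2 - 1)} \<in> sets (borel \<Otimes>\<^sub>M (borel :: 'a measure))"
    by measurable
  then have Ym: "Y \<in> sets (borel \<Otimes>\<^sub>M borel)" by (simp add: Y_def space_pair_measure)
  have "{p \<in> space (borel \<Otimes>\<^sub>M borel). 0 < fst p \<and> fst p \<le> C \<and> norm (snd p) \<le> R * fst p} \<in> sets (borel \<Otimes>\<^sub>M (borel :: 'a measure))"
    by measurable
  then have Zm: "Z \<in> sets (borel \<Otimes>\<^sub>M borel)" by (simp add: Z_def space_pair_measure)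
  have sb: "Y \<in> sets borel" "Z \<in> sets borel" using Ym Zm unfolding borel_prod by simp_all
  have "emeasure lborel Z = (\<integral>\<^sup>+t. emeasure lborel (Pair t -` Z) \<partial>lborel)"
    by (subst lborel_prod[symmetric], rule lborel.emeasure_pair_measure_alt) (use Zm in simp)
  also have "\<dots> = (\<integral>\<^sup>+t. ennreal (V * R ^ 5) * (ennreal (t ^ 5) * indicator {0<..C} t) \<partial>lborel)"
  proof (rule nn_integral_cong)
    fix t
    have "Pair t -` Z = (if 0 < t \<and> t \<le> C then cball 0 (R * t) else {})"
      by (auto simp: Z_def)
    then show "emeasure lborel (Pair t -` Z) = ennreal (V * R ^ 5) * (ennreal (t ^ 5) * indicator {0<..C} t)"
      using R(1) V by (auto simp: emeasure_cball dim V_def power_mult_distrib ennreal_mult[symmetric] mult.assoc)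
  qed
  also have "\<dots> = ennreal (V * R ^ 5) * ennreal (C ^ Suc 5 / real (Suc 5))"
    by (subst nn_integral_cmult, measurable, subst nn_integral_power_up_to) (use C in simp_all)
  also have "\<dots> = ennreal (V * R ^ 5 * (C ^ 6 / 6))"
    using V R(1) C by (subst ennreal_mult[symmetric]) simp_all
  also have "V * R ^ 5 * (C ^ 6 / 6) = V * (S ^ 5 * C) / 6"
    using C by (simp add: R_def power_divide field_simps eval_nat_numeral)
  finally have Ze: "emeasure lborel Z = ennreal (V * (S ^ 5 * C) / 6)" .
  have Ye: "emeasure lborel Y = ennreal V * (\<integral>\<^sup>+t. ennreal (sqrt (t\<^sup>2 - 1) ^ 5) * indicator {1..C} t \<partial>lborel)"
  proof -
    have "emeasure lborel Y = (\<integral>\<^sup>+t. emeasure lborel (Pair t -` Y) \<partial>lborel)"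
      by (subst lborel_prod[symmetric], rule lborel.emeasure_pair_measure_alt) (use Ym in simp)
    also have "\<dots> = (\<integral>\<^sup>+t. ennreal V * (ennreal (sqrt (t\<^sup>2 - 1) ^ 5) * indicator {1..C} t) \<partial>lborel)"
    proof (rule nn_integral_cong)
      fix t :: real
      show "emeasure lborel (Pair t -` Y) = ennreal V * (ennreal (sqrt (t\<^sup>2 - 1) ^ 5) * indicator {1..C} t)"
      proof (cases "1 < t \<and> t \<le> C")
        case True
        then have "0 \<le> t\<^sup>2 - 1" by (simp add: one_le_power)
        moreover have "Pair t -` Y = ball 0 (sqrt (t\<^sup>2 - 1))" using True by (auto simp: Y_def)
        ultimately show ?thesis using True V by (simp add: emeasure_ball dim V_def ennreal_mult)
      next
        case False
        then have "Pair t -` Y = {}" by (auto simp: Y_def)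
        then show ?thesis using False by (cases "t = 1") (auto simp: indicator_def)
      qed
    qed
    also have "\<dots> = ennreal V * (\<integral>\<^sup>+t. ennreal (sqrt (t\<^sup>2 - 1) ^ 5) * indicator {1..C} t \<partial>lborel)"
      by (rule nn_integral_cmult) measurable
    finally show ?thesis .
  qed
  have Yu: "emeasure lborel Y \<le> ennreal (V * (S ^ 7 / 7))"
    unfolding Ye using nn_integral_ball_correction(1)[of C S] C SC V S
    by (subst ennreal_mult) (auto intro!: mult_left_mono)
  have Yl: "ennreal (V * (S ^ 7 / (7 * C))) \<le> emeasure lborel Y"
    unfolding Ye using nn_integral_ball_correction(2)[of C S] C SC V S
    by (subst ennreal_mult) (auto intro!: mult_left_mono)
  obtain y where y: "emeasure lborel Y = ennreal y" "0 \<le> y"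
    using Yu by (cases "emeasure lborel Y") (auto simp: top_unique)
  have y7: "V * (S ^ 7 / (7 * C)) \<le> y" "y \<le> V * (S ^ 7 / 7)"
  proof -
    show "V * (S ^ 7 / (7 * C)) \<le> y" using Yl by (simp only: y(1) ennreal_le_iff[OF y(2)])
    have "0 \<le> V * (S ^ 7 / 7)" using V S by simp
    then show "y \<le> V * (S ^ 7 / 7)" using Yu by (simp only: y(1) ennreal_le_iff)
  qed
  have "emeasure lborel X = emeasure lborel Z - emeasure lborel Y"
    unfolding Xd by (rule emeasure_Diff) (use y YZ sb in simp_all)
  also have "\<dots> = ennreal (V * (S ^ 5 * C) / 6 - y)"
    unfolding Ze y(1) by (rule ennreal_minus) (rule y(2))
  finally have X: "emeasure lborel X = ennreal (V * (S ^ 5 * C) / 6 - y)" .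
  have "y \<le> V * (S ^ 5 * C) / 6"
  proof -
    have "ennreal y \<le> ennreal (V * (S ^ 5 * C) / 6)"
      unfolding y(1)[symmetric] Ze[symmetric] by (rule emeasure_mono) (use YZ sb in simp_all)
    then show ?thesis using V S C by (subst (asm) ennreal_le_iff) simp_all
  qed
  then have nn: "0 \<le> V * (S ^ 5 * C) / 6 - y" by simp
  have "hyp_ball (0::'a) r = cball 0 R" using hyp_ball_0[of r] r by (simp add: R_def S_def C_def)
  then have e: "emeasure hyp_measure (hyp_ball (0::'a) r) = ennreal (6 * (V * (S ^ 5 * C) / 6 - y))"
    using X nn by (subst ennreal_mult) (simp_all add: emeasure_hyp_measure dim X_def[symmetric])
  then show "emeasure hyp_measure (hyp_ball (0::'a) r) < \<infinity>" by simp
  have m: "measure hyp_measure (hyp_ball (0::'a) r) = V * (S ^ 5 * C) - 6 * y"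
    unfolding measure_def e using nn by (simp add: algebra_simps)
  show "V * (S ^ 5 * C - 6 / 7 * S ^ 7) \<le> measure hyp_measure (hyp_ball (0::'a) r)"
    unfolding m using y7(2) by (simp add: algebra_simps)
  show "measure hyp_measure (hyp_ball (0::'a) r) \<le> V * (S ^ 5 * C - 6 / 7 * (S ^ 7 / C))"
    unfolding m using y7(1) by (simp add: algebra_simps)
qed

lemma measure_hyp_ball_strict_mono:
  assumes dim: "DIM('a::euclidean_space) = 5" and r: "0 < r" "r < r'"
  shows "measure hyp_measure (hyp_ball (0::'a) r) < measure hyp_measure (hyp_ball (0::'a) r')"
proof -
  define R R' where "R = sinh r / cosh r" and "R' = sinh r' / cosh r'"
  have R: "0 < R" "R < R'" "R' < 1"
    using r cosh_real_pos by (auto simp: R_def R'_def tanh_real_lt_1 simp flip: tanh_def)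
  have b: "hyp_ball (0::'a) r = cball 0 R" "hyp_ball (0::'a) r' = cball 0 R'"
    using r by (simp_all add: hyp_ball_0 R_def R'_def)
  have fin: "emeasure hyp_measure (cball (0::'a) R) < \<infinity>" "emeasure hyp_measure (cball (0::'a) R') < \<infinity>"
    using hyp_ball_volume(1)[OF dim] r by (simp_all flip: b)
  have sub: "cball (0::'a) R \<subseteq> cball 0 R'" using R by (simp add: subset_cball)
  have "0 < measure lborel (cball (0::'a) R') - measure lborel (cball (0::'a) R)"
    using R by (simp add: content_cball dim power_strict_mono)
  also have "\<dots> = measure lborel (cball (0::'a) R' - cball 0 R)"
    using sub R by (subst measure_Diff) (auto simp: emeasure_cball)
  finally have "0 < emeasure lborel (cball (0::'a) R' - cball 0 R)"
    by (metis less_numeral_extra(3) measure_def enn2real_0 not_gr_zero)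
  also have "\<dots> \<le> emeasure hyp_measure (cball (0::'a) R' - cball 0 R)"
    by (rule hyp_measure_ge_lborel) (use R in \<open>auto simp: hyp_space_def\<close>)
  finally have "0 < measure hyp_measure (cball (0::'a) R' - cball 0 R)"
    using fin(2) emeasure_mono[of "cball (0::'a) R' - cball 0 R" "cball 0 R'" hyp_measure]
    by (simp add: measure_def enn2real_positive_iff)
  also have "\<dots> = measure hyp_measure (cball (0::'a) R') - measure hyp_measure (cball (0::'a) R)"
    using fin sub by (intro measure_Diff) auto
  finally show ?thesis by (simp add: b)
qed

section \<open>The density of the inball packing\<close>

lemma inball_iff:
  fixes b :: "nat \<Rightarrow> real \<times> 'a::euclidean_space"
  assumes dim: "DIM('a) = 5" and b: "simply_truncated_orthoscheme [4, 3, 4, 3, 3] b"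
  shows "\<exists>c\<in>hyp_space. (\<forall>B. inball b B \<longleftrightarrow> B = hyp_ball c (arsinh sinh_inradius)) \<and>
    contained_ball b c (arsinh sinh_inradius) \<and>
    (\<forall>c' r'. contained_ball b c' r' \<longrightarrow> r' \<le> arsinh sinh_inradius) \<and>
    (\<forall>c'. contained_ball b c' (arsinh sinh_inradius) \<longrightarrow> c' = c)"
proof -
  obtain c where c: "contained_ball b c (arsinh sinh_inradius)"
    "\<And>c' r'. contained_ball b c' r' \<Longrightarrow> r' \<le> arsinh sinh_inradius"
    "\<And>c'. contained_ball b c' (arsinh sinh_inradius) \<Longrightarrow> c' = c"
    using inball_of_orthoscheme[OF dim b] by metis
  have "inball b B \<longleftrightarrow> B = hyp_ball c (arsinh sinh_inradius)" for B
  proof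
    assume "inball b B"
    then obtain c1 r1 where *: "contained_ball b c1 r1" "B = hyp_ball c1 r1" "\<And>c' r'. contained_ball b c' r' \<Longrightarrow> r' \<le> r1"
      by (auto simp: inball_def)
    have r1: "r1 = arsinh sinh_inradius" using c(2)[OF *(1)] *(3)[OF c(1)] by simp
    then have "c1 = c" using c(3) *(1) by blast
    then show "B = hyp_ball c (arsinh sinh_inradius)" using *(2) r1 by simp
  next
    assume "B = hyp_ball c (arsinh sinh_inradius)"
    then show "inball b B" unfolding inball_def using c(1,2) by blast
  qed
  moreover have "c \<in> hyp_space" using c(1) by (simp add: contained_ball_def)
  ultimately show ?thesis using c by blast
qed

lemma packing_density_hyp_ball:
  fixes b :: "nat \<Rightarrow> real \<times> 'a::euclidean_space"
  assumes dim: "DIM('a) = 5" and b: "simply_truncated_orthoscheme [4, 3, 4, 3, 3] b"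
    and c: "c \<in> hyp_space" "0 < r"
  shows "packing_density b (hyp_ball c r) = measure hyp_measure (hyp_ball (0 :: 'a) r) / (enn2real cube_integral / 24)"
proof -
  have "measure hyp_measure (truncated_polytope b) = enn2real cube_integral / 24"
    unfolding measure_def emeasure_truncated_polytope[OF dim b] cube_integral_def
    by (simp add: enn2real_mult)
  moreover have "measure hyp_measure (hyp_ball c r) = measure hyp_measure (hyp_ball (0 :: 'a) r)"
    unfolding measure_def using emeasure_hyp_ball_center[OF dim c(1)] c(2) by simp
  ultimately show ?thesis unfolding packing_density_def by (simp only:)
qed

lemma cube_integral_bounds: "0.17479 \<le> enn2real cube_integral" "enn2real cube_integral \<le> 0.17668"
proof -
  obtain x where x: "cube_integral = ennreal x" "0 \<le> x"
    using cube_integral_le by (cases cube_integral) (auto simp: top_unique)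
  then show "0.17479 \<le> enn2real cube_integral" "enn2real cube_integral \<le> 0.17668"
    using cube_integral_ge cube_integral_le by (simp_all only: x enn2real_ennreal ennreal_le_iff) simp_all
qed

lemma sinh_inradius_bounds: "0.114387 \<le> sinh_inradius" "sinh_inradius \<le> 0.114388"
proof -
  have "1.41421 \<le> sqrt 2" by (rule real_le_rsqrt) (simp add: power2_eq_square)
  moreover have "sqrt 2 \<le> 1.41422" by (rule real_le_lsqrt) (simp_all add: power2_eq_square)
  ultimately have b: "76.4263 \<le> 34 + 30 * sqrt 2" "34 + 30 * sqrt 2 \<le> 76.4266" by simp_all
  have s: "sinh_inradius\<^sup>2 = 1 / (34 + 30 * sqrt 2)"
    using sinh_inradius(2) b by (simp add: field_simps)
  have "(0.114387)\<^sup>2 \<le> (1 / 76.4266 :: real)" by (simp add: power2_eq_square)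
  also have "\<dots> \<le> sinh_inradius\<^sup>2" unfolding s using b by (intro divide_left_mono) auto
  finally show "0.114387 \<le> sinh_inradius" by (rule power2_le_imp_le) (use sinh_inradius in simp)
  have "sinh_inradius\<^sup>2 \<le> 1 / 76.4263" unfolding s using b by (intro divide_left_mono) auto
  also have "\<dots> \<le> (0.114388)\<^sup>2" by (simp add: power2_eq_square)
  finally show "sinh_inradius \<le> 0.114388" by (rule power2_le_imp_le) simp
qed

lemma inball_volume_bounds:
  assumes dim: "DIM('a::euclidean_space) = 5"
  shows "0.000102380 \<le> measure hyp_measure (hyp_ball (0::'a) (arsinh sinh_inradius))"
    "measure hyp_measure (hyp_ball (0::'a) (arsinh sinh_inradius)) \<le> 0.000102680"
proof -
  define S where "S = sinh_inradius"
  define C where "C = cosh (arsinh S)"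
  have S: "0.114387 \<le> S" "S \<le> 0.114388" using sinh_inradius_bounds by (simp_all add: S_def)
  have "C\<^sup>2 = 1 + S\<^sup>2" by (simp add: C_def S_def cosh_square_eq)
  moreover have "0.114387\<^sup>2 \<le> S\<^sup>2" "S\<^sup>2 \<le> 0.114388\<^sup>2" using S by (intro power_mono; simp)+
  ultimately have "1.00652\<^sup>2 \<le> C\<^sup>2" "C\<^sup>2 \<le> 1.00653\<^sup>2" by (simp_all add: power2_eq_square)
  then have C: "1.00652 \<le> C" "C \<le> 1.00653"
    by (auto intro: power2_le_imp_le simp: C_def cosh_real_nonneg)
  have pi: "3.1415 \<le> pi" "pi \<le> 3.1416" using pi_approx by simp_all
  have pi2: "3.1415\<^sup>2 \<le> pi\<^sup>2" "pi\<^sup>2 \<le> 3.1416\<^sup>2" using pi by (intro power_mono; simp)+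
  have r: "0 < arsinh sinh_inradius" using sinh_inradius(1) by simp
  note vol = hyp_ball_volume[OF dim r, folded S_def, unfolded sinh_arsinh_real unit_ball_vol_5, folded C_def]
  have S5: "0.114387 ^ 5 \<le> S ^ 5" "S ^ 5 \<le> 0.114388 ^ 5" and S7: "0.114387 ^ 7 \<le> S ^ 7" "S ^ 7 \<le> 0.114388 ^ 7"
    using S by (intro power_mono; simp)+
  have SC: "0.114387 ^ 5 * 1.00652 \<le> S ^ 5 * C" "S ^ 5 * C \<le> 0.114388 ^ 5 * 1.00653"
    using S5 C S by (intro mult_mono; simp)+
  have S7C: "0.114387 ^ 7 / 1.00653 \<le> S ^ 7 / C"
    using S7 C S by (intro frac_le) simp_all
  have "0.000102380 \<le> 8 / 15 * 3.1415\<^sup>2 * (0.114387 ^ 5 * 1.00652 - 6 / 7 * 0.114388 ^ 7 :: real)"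
    by (simp add: eval_nat_numeral)
  also have "\<dots> \<le> 8 / 15 * pi\<^sup>2 * (S ^ 5 * C - 6 / 7 * S ^ 7)"
  proof (rule mult_mono)
    show "0.114387 ^ 5 * 1.00652 - 6 / 7 * 0.114388 ^ 7 \<le> S ^ 5 * C - 6 / 7 * S ^ 7"
      using SC S7 by linarith
  qed (use pi2 in \<open>simp_all add: eval_nat_numeral\<close>)
  also note vol(2)
  finally show "0.000102380 \<le> measure hyp_measure (hyp_ball (0::'a) (arsinh sinh_inradius))"
    by (simp only: S_def)
  note vol(3)
  also have "8 / 15 * pi\<^sup>2 * (S ^ 5 * C - 6 / 7 * (S ^ 7 / C)) \<le>
      8 / 15 * pi\<^sup>2 * (0.114388 ^ 5 * 1.00653 - 6 / 7 * (0.114387 ^ 7 / 1.00653))"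
    using SC S7C by (intro mult_left_mono) (linarith, simp)
  also have "\<dots> \<le> 8 / 15 * 3.1416\<^sup>2 * (0.114388 ^ 5 * 1.00653 - 6 / 7 * (0.114387 ^ 7 / 1.00653))"
    using pi2 by (intro mult_right_mono) (simp_all add: eval_nat_numeral)
  also have "\<dots> \<le> 0.000102680" by (simp add: eval_nat_numeral)
  finally show "measure hyp_measure (hyp_ball (0::'a) (arsinh sinh_inradius)) \<le> 0.000102680"
    by (simp only: S_def)
qed

text \<open>
  Every packing ball has at most the inradius, and equality determines its centre; volumes of
  polytope and ball do not depend on the choice of the normals, so the density is a strictly
  increasing function of the radius alone.
\<close>
theorem theorem3p6:
  shows
    "(\<exists>b :: nat \<Rightarrow> real \<times> (real ^ 5). simply_truncated_orthoscheme [4, 3, 4, 3, 3] b) \<and>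
     (\<forall>m. \<forall>b :: nat \<Rightarrow> real \<times> (real ^ 5).
        simply_truncated_orthoscheme m b \<longrightarrow> m = [4, 3, 4, 3, 3]) \<and>
     (\<forall>b :: nat \<Rightarrow> real \<times> (real ^ 5).
        simply_truncated_orthoscheme [4, 3, 4, 3, 3] b \<longrightarrow>
        (\<exists>!B. inball b B) \<and>
        (\<forall>B. inball b B \<longrightarrow>
           congruent_ball_packing b (group_images b B) (packing_density b B) \<and>
           (\<forall>m'. \<forall>b' :: nat \<Rightarrow> real \<times> (real ^ 5). \<forall>P' d'.
              simply_truncated_orthoscheme m' b' \<and> congruent_ball_packing b' P' d' \<longrightarrow>
              d' \<le> packing_density b B) \<and>
           (\<forall>P' d'. congruent_ball_packing b P' d' \<and> P' \<noteq> group_images b B \<longrightarrow>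
              d' < packing_density b B) \<and>
           \<bar>packing_density b B - 0.0140\<bar> \<le> 0.0001))"
proof (intro conjI allI impI)
  have dim: "DIM(real ^ 5) = 5" by simp
  let ?r = "arsinh sinh_inradius" and ?I = "enn2real cube_integral"
  have r0: "0 < ?r" using sinh_inradius(1) by simp
  have I: "0 < ?I / 24" using cube_integral_bounds(1) by simp
  show "\<exists>b :: nat \<Rightarrow> real \<times> (real ^ 5). simply_truncated_orthoscheme [4, 3, 4, 3, 3] b"
    by (rule orthoscheme_exists) (rule dim)
  show unique: "m = [4, 3, 4, 3, 3]" if "simply_truncated_orthoscheme m b" for m and b :: "nat \<Rightarrow> real \<times> (real ^ 5)"
    by (rule symbol_unique[OF dim that])
  fix b :: "nat \<Rightarrow> real \<times> (real ^ 5)"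
  assume b: "simply_truncated_orthoscheme [4, 3, 4, 3, 3] b"
  obtain c where c: "c \<in> hyp_space" "\<forall>B. inball b B \<longleftrightarrow> B = hyp_ball c ?r" "contained_ball b c ?r"
    "\<forall>c' r'. contained_ball b c' r' \<longrightarrow> r' \<le> ?r" "\<forall>c'. contained_ball b c' ?r \<longrightarrow> c' = c"
    using inball_iff[OF dim b] by blast
  show "\<exists>!B. inball b B" using c(2) by simp
  fix B assume "inball b B"
  then have B: "B = hyp_ball c ?r" using c(2) by simp
  have dens: "packing_density b B = measure hyp_measure (hyp_ball (0 :: real ^ 5) ?r) / (?I / 24)"
    unfolding B by (rule packing_density_hyp_ball[OF dim b c(1) r0])
  show "congruent_ball_packing b (group_images b B) (packing_density b B)"
    unfolding congruent_ball_packing_def using c(3) B by blast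
  show "d' \<le> packing_density b B"
    if *: "simply_truncated_orthoscheme m' b' \<and> congruent_ball_packing b' P' d'"
    for m' P' d' and b' :: "nat \<Rightarrow> real \<times> (real ^ 5)"
  proof -
    have b': "simply_truncated_orthoscheme [4, 3, 4, 3, 3] b'" using * unique[of m' b'] by simp
    obtain c' r' where c': "contained_ball b' c' r'" "d' = packing_density b' (hyp_ball c' r')"
      using * by (auto simp: congruent_ball_packing_def)
    have "r' \<le> ?r" using inball_iff[OF dim b'] c'(1) by blast
    moreover have r': "0 < r'" "c' \<in> hyp_space" using c'(1) by (auto simp: contained_ball_def)
    ultimately have "measure hyp_measure (hyp_ball (0 :: real ^ 5) r') \<le> measure hyp_measure (hyp_ball (0 :: real ^ 5) ?r)"
      using measure_hyp_ball_strict_mono[OF dim r'(1), of ?r] by (cases "r' = ?r") auto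
    then show ?thesis
      unfolding dens c'(2) packing_density_hyp_ball[OF dim b' r'(2,1)] using I by (intro divide_right_mono) auto
  qed
  show "d' < packing_density b B" if *: "congruent_ball_packing b P' d' \<and> P' \<noteq> group_images b B" for P' d'
  proof -
    obtain c' r' where c': "contained_ball b c' r'" "P' = group_images b (hyp_ball c' r')" "d' = packing_density b (hyp_ball c' r')"
      using * by (auto simp: congruent_ball_packing_def)
    have "r' \<noteq> ?r"
    proof
      assume "r' = ?r"
      then have "c' = c" using c(5) c'(1) by blast
      then show False using * c'(2) B \<open>r' = ?r\<close> by simp
    qed
    moreover have "r' \<le> ?r" using c(4) c'(1) by blast
    ultimately have "r' < ?r" by simp
    moreover have r': "0 < r'" "c' \<in> hyp_space" using c'(1) by (auto simp: contained_ball_def)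
    ultimately have "measure hyp_measure (hyp_ball (0 :: real ^ 5) r') < measure hyp_measure (hyp_ball (0 :: real ^ 5) ?r)"
      by (intro measure_hyp_ball_strict_mono dim)
    then show ?thesis
      unfolding dens c'(3) packing_density_hyp_ball[OF dim b r'(2,1)] using I by (rule divide_strict_right_mono)
  qed
  have "0.0139 * (?I / 24) \<le> measure hyp_measure (hyp_ball (0 :: real ^ 5) ?r)"
    using inball_volume_bounds(1)[OF dim] cube_integral_bounds(2) by simp
  moreover have "measure hyp_measure (hyp_ball (0 :: real ^ 5) ?r) \<le> 0.0141 * (?I / 24)"
    using inball_volume_bounds(2)[OF dim] cube_integral_bounds(1) by simp
  ultimately have "0.0139 \<le> packing_density b B" "packing_density b B \<le> 0.0141"
    unfolding dens using I by (simp_all only: pos_le_divide_eq pos_divide_le_eq)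
  then show "\<bar>packing_density b B - 0.0140\<bar> \<le> 0.0001" by linarith
qed

end
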